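(* Let $\mathbf F$ be the full subcategory of $\omega\text{-}\mathbf{cat}$ consisting of $\omega$-categories with strongly loop-free atomic bases. Then the functor $C\mapsto\hom(-,C)|_{\mathbf F}$ is an equivalence from $\omega\text{-}\mathbf{cat}$ to the category of contravariant set-valued functors on $\mathbf F$ which take colimits in $\omega\text{-}\mathbf{cat}$ (that is, those colimit cocones of $\omega\text{-}\mathbf{cat}$ that lie in $\mathbf F$) to limits in the category of sets.
   Context: Signs $\alpha,\beta$ range over $\{-,+\}$; $m,n$ are nonnegative integers. $\omega$-categories. An $\omega$-category is a set with unary operators $d^-_n,d^+_n$ and partially defined binary composition operators $(x,y)\mapsto x\#_n y$ ($n\ge 0$) such that: (i) $x\#_n y$ is defined iff $d^+_n x=d^-_n y$; (ii) for every $x$ there is $n$ with $d^-_n x=d^+_n x=x$; (iii) $d^\beta_m d^\alpha_n x=d^\beta_m x$ if $m<n$, and $=d^\alpha_n x$ if $m\ge n$; (iv) $d^-_n x\#_n x=x\#_n d^+_n x=x$; (v) if $x\#_n y$ is defined then $d^\alpha_m(x\#_n y)=d^\alpha_m x=d^\alpha_m y=d^\alpha_m x\#_n d^\alpha_m y$ for $m<n$, $d^-_n(x\#_n y)=d^-_n x$, $d^+_n(x\#_n y)=d^+_n y$, and $d^\alpha_m(x\#_n y)=d^\alpha_m x\#_n d^\alpha_m y$ for $m>n$; (vi) $(x\#_n y)\#_n z=x\#_n(y\#_n z)$ if either side is defined; (vii) if $m<n$ then $(x\#_n y)\#_m(x'\#_n y')=(x\#_m x')\#_n(y\#_m y')$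 when the left side is defined. A morphism is a function commuting with all these operators; the category is $\omega\text{-}\mathbf{cat}$. For an $\omega$-category $C$, $C_n=\{x\in C: d^-_n x=x\}=\{x\in C:d^+_n x=x\}$, a sub-$\omega$-category. Augmented directed complexes. An augmented directed complex $K$ is an augmented chain complex $(K_n,\partial,\epsilon)$ of abelian groups concentrated in nonnegative dimensions together with a submonoid $K^*_n\subset K_n$ for each $n$. For an $\omega$-category $C$, the augmented directed complex $\lambda C$ is defined as follows: $(\lambda C)_n$ is the abelian group generated by elements $[x]_n$ for $x\in C_n$ subject to relations $[x\#_m y]_n=[x]_n+[y]_n$ for $m<n$; $\partial[x]_{n+1}=[d^+_n x]_n-[d^-_n x]_n$; $\epsilon[x]_0=1$; and $(\lambda C)^*_n$ is the submonoid generated by the elements $[x]_n$. Bases. A basis for an augmented directed complex $K$ is a set $B\subset\bigsqcup_n K_n$ such that each $K_n$ is free abelian with basis $B\cap K_n$ and $K^*_n$ is the submonoid generated by $B\cap K_n$ (unique if it exists). Then $K_n$ is a lattice under $x\le y\iff y-x\in K^*_n$, with meet $\wedge$; for $x\in K_{n+1}$, $\partial^\pm x\in K_n$ are the unique elements with $\partial x=\partial^+x-\partial^-x$, $\partial^-x\wedge\partial^+x=0$. The basis is strongly loop-free if there is a partial ordering $\le_{\mathbf N}$ on $B$ such that $a<_{\mathbf N}b$ whenever $a\le\partial^-b$ or $\partial^+a\ge b$. An $\omega$-category $C$ is composition-generated by a subset $E$ if each $e\in E$ is assigned a nonnegative integer dimension $|e|$ and, for each $n\ge0$, $C_n$ is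 generated under the composition operations $\#_m$ (without the $d^\alpha_m$) by the elements of $E$ of dimension at most $n$. A basis for $C$ is a set $E$ of composition-generators such that $\lambda C$ has a basis and $e\mapsto[e]_{|e|}$ maps $E$ bijectively onto it; it is atomic if $[d^-_n e]_n\wedge[d^+_n e]_n=0$ in $(\lambda C)_n$ for $e\in E$, $n<|e|$, and strongly loop-free if the basis for $\lambda C$ is strongly loop-free. *)

theory Defs
  imports
    "HOL-Algebra.Free_Abelian_Groups"
    "HOL-Algebra.Generated_Groups"
    "HOL-Algebra.Lattice"
    "HOL-Library.Equipollence"
    "HOL-Library.Countable_Set"
begin

section \<open>Size\<close>

text \<open>
  The type \<open>'u\<close> plays the role of the universe of sets: a set, over whatever type, is small if
  it has strictly smaller cardinality than \<open>'u\<close>.  When \<open>'u\<close> is (strongly) inaccessible, the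
  small sets are, up to bijection, the elements of a Grothendieck universe containing an
  infinite set.
\<close>

definition small :: "'u itself \<Rightarrow> 's set \<Rightarrow> bool" where
  "small _ S \<longleftrightarrow> S \<prec> (UNIV :: 'u set)"

definition inaccessible :: "'u itself \<Rightarrow> bool" where
  "inaccessible u \<longleftrightarrow>
     uncountable (UNIV :: 'u set) \<and>
     (\<forall>S :: 'u set. small u S \<longrightarrow> small u (Pow S)) \<and>
     (\<forall>(I :: 'u set) (X :: 'u \<Rightarrow> 'u set).
        small u I \<and> (\<forall>i\<in>I. small u (X i)) \<longrightarrow> small u (\<Union>i\<in>I. X i))"


section \<open>Categories, functors, equivalences\<close>

text \<open>
  Hom-sets of different pairs of objects need not be disjoint, so composition takes the objects
  as arguments: \<open>Cmp C a b c g f\<close> is the composite of \<open>f : a \<rightarrow> b\<close> and \<open>g : b \<rightarrow> c\<close>.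
\<close>

record ('o, 'm) category =
  Ob :: "'o set"
  Hom :: "'o \<Rightarrow> 'o \<Rightarrow> 'm set"
  Idn :: "'o \<Rightarrow> 'm"
  Cmp :: "'o \<Rightarrow> 'o \<Rightarrow> 'o \<Rightarrow> 'm \<Rightarrow> 'm \<Rightarrow> 'm"

definition is_category :: "('o, 'm) category \<Rightarrow> bool" where
  "is_category C \<longleftrightarrow>
     (\<forall>a\<in>Ob C. Idn C a \<in> Hom C a a) \<and>
     (\<forall>a\<in>Ob C. \<forall>b\<in>Ob C. \<forall>c\<in>Ob C. \<forall>f\<in>Hom C a b. \<forall>g\<in>Hom C b c.
        Cmp C a b c g f \<in> Hom C a c) \<and>
     (\<forall>a\<in>Ob C. \<forall>b\<in>Ob C. \<forall>f\<in>Hom C a b.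
        Cmp C a a b f (Idn C a) = f \<and> Cmp C a b b (Idn C b) f = f) \<and>
     (\<forall>a\<in>Ob C. \<forall>b\<in>Ob C. \<forall>c\<in>Ob C. \<forall>d\<in>Ob C.
        \<forall>f\<in>Hom C a b. \<forall>g\<in>Hom C b c. \<forall>h\<in>Hom C c d.
        Cmp C a c d h (Cmp C a b c g f) = Cmp C a b d (Cmp C b c d h g) f)"

definition op_cat :: "('o, 'm) category \<Rightarrow> ('o, 'm) category" where
  "op_cat C = \<lparr>Ob = Ob C, Hom = (\<lambda>a b. Hom C b a), Idn = Idn C,
               Cmp = (\<lambda>a b c g f. Cmp C c b a f g)\<rparr>"

definition full_subcat :: "('o, 'm) category \<Rightarrow> 'o set \<Rightarrow> ('o, 'm) category" where
  "full_subcat C X = C\<lparr>Ob := Ob C \<inter> X\<rparr>"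

definition is_iso_arrow :: "('o, 'm) category \<Rightarrow> 'o \<Rightarrow> 'o \<Rightarrow> 'm \<Rightarrow> bool" where
  "is_iso_arrow C a b f \<longleftrightarrow>
     f \<in> Hom C a b \<and>
     (\<exists>g\<in>Hom C b a. Cmp C a b a g f = Idn C a \<and> Cmp C b a b f g = Idn C b)"

record ('o, 'm, 'p, 'n) funct =
  fob :: "'o \<Rightarrow> 'p"
  far :: "'o \<Rightarrow> 'o \<Rightarrow> 'm \<Rightarrow> 'n"

definition is_functor ::
    "('o, 'm) category \<Rightarrow> ('p, 'n) category \<Rightarrow> ('o, 'm, 'p, 'n) funct \<Rightarrow> bool" where
  "is_functor C D F \<longleftrightarrow>
     is_category C \<and> is_category D \<and>
     (\<forall>a\<in>Ob C. fob F a \<in> Ob D) \<and>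
     (\<forall>a\<in>Ob C. \<forall>b\<in>Ob C. \<forall>f\<in>Hom C a b. far F a b f \<in> Hom D (fob F a) (fob F b)) \<and>
     (\<forall>a\<in>Ob C. far F a a (Idn C a) = Idn D (fob F a)) \<and>
     (\<forall>a\<in>Ob C. \<forall>b\<in>Ob C. \<forall>c\<in>Ob C. \<forall>f\<in>Hom C a b. \<forall>g\<in>Hom C b c.
        far F a c (Cmp C a b c g f) =
        Cmp D (fob F a) (fob F b) (fob F c) (far F b c g) (far F a b f))"

definition id_functor :: "('o, 'm, 'o, 'm) funct" where
  "id_functor = \<lparr>fob = (\<lambda>a. a), far = (\<lambda>a b f. f)\<rparr>"

definition comp_functor ::
    "('p, 'n, 'q, 'k) funct \<Rightarrow> ('o, 'm, 'p, 'n) funct \<Rightarrow> ('o, 'm, 'q, 'k) funct" where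
  "comp_functor G F =
     \<lparr>fob = (\<lambda>a. fob G (fob F a)),
      far = (\<lambda>a b f. far G (fob F a) (fob F b) (far F a b f))\<rparr>"

text \<open>The functor \<open>op_cat C \<rightarrow> op_cat D\<close> given by a functor \<open>C \<rightarrow> D\<close>.\<close>

definition op_functor :: "('o, 'm, 'p, 'n) funct \<Rightarrow> ('o, 'm, 'p, 'n) funct" where
  "op_functor F = \<lparr>fob = fob F, far = (\<lambda>a b. far F b a)\<rparr>"

definition is_nat_trans ::
    "('o, 'm) category \<Rightarrow> ('p, 'n) category \<Rightarrow> ('o, 'm, 'p, 'n) funct \<Rightarrow>
     ('o, 'm, 'p, 'n) funct \<Rightarrow> ('o \<Rightarrow> 'n) \<Rightarrow> bool" where
  "is_nat_trans C D F G \<eta> \<longleftrightarrow>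
     (\<forall>a\<in>Ob C. \<eta> a \<in> Hom D (fob F a) (fob G a)) \<and>
     (\<forall>a\<in>Ob C. \<forall>b\<in>Ob C. \<forall>f\<in>Hom C a b.
        Cmp D (fob F a) (fob F b) (fob G b) (\<eta> b) (far F a b f) =
        Cmp D (fob F a) (fob G a) (fob G b) (far G a b f) (\<eta> a))"

definition nat_isomorphic ::
    "('o, 'm) category \<Rightarrow> ('p, 'n) category \<Rightarrow> ('o, 'm, 'p, 'n) funct \<Rightarrow>
     ('o, 'm, 'p, 'n) funct \<Rightarrow> bool" where
  "nat_isomorphic C D F G \<longleftrightarrow>
     (\<exists>\<eta>. is_nat_trans C D F G \<eta> \<and>
          (\<forall>a\<in>Ob C. is_iso_arrow D (fob F a) (fob G a) (\<eta> a)))"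

definition is_equivalence ::
    "('o, 'm) category \<Rightarrow> ('p, 'n) category \<Rightarrow> ('o, 'm, 'p, 'n) funct \<Rightarrow> bool" where
  "is_equivalence C D F \<longleftrightarrow>
     is_functor C D F \<and>
     (\<exists>G. is_functor D C G \<and>
          nat_isomorphic C C id_functor (comp_functor G F) \<and>
          nat_isomorphic D D (comp_functor F G) id_functor)"

text \<open>
  Morphisms are required to be \<open>undefined\<close> off the objects of \<open>C\<close>, so that natural
  transformations are equal as soon as their components are.  No such condition is imposed on
  functors: two functors agreeing on \<open>C\<close> are isomorphic objects.
\<close>

definition functor_cat ::
    "('o, 'm) category \<Rightarrow> ('p, 'n) category \<Rightarrow> (('o, 'm, 'p, 'n) funct, 'o \<Rightarrow> 'n) category" where
  "functor_cat C D =
     \<lparr>Ob = {F. is_functor C D F},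
      Hom = (\<lambda>F G. {\<eta> \<in> extensional (Ob C). is_nat_trans C D F G \<eta>}),
      Idn = (\<lambda>F. \<lambda>a\<in>Ob C. Idn D (fob F a)),
      Cmp = (\<lambda>F G H \<beta> \<alpha>. \<lambda>a\<in>Ob C. Cmp D (fob F a) (fob G a) (fob H a) (\<beta> a) (\<alpha> a))\<rparr>"

text \<open>
  The category of small sets with elements in \<open>'s\<close>.  If \<open>'u\<close> embeds in \<open>'s\<close>, then up to
  bijection these are all the small sets.
\<close>

definition set_cat :: "'u itself \<Rightarrow> ('s set, 's \<Rightarrow> 's) category" where
  "set_cat u =
     \<lparr>Ob = {S. small u S},
      Hom = (\<lambda>S T. S \<rightarrow>\<^sub>E T),
      Idn = (\<lambda>S. \<lambda>x\<in>S. x),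
      Cmp = (\<lambda>S T V g f. compose S g f)\<rparr>"


section \<open>Limits and colimits\<close>

definition is_cone ::
    "('j, 'k) category \<Rightarrow> ('o, 'm) category \<Rightarrow> ('j, 'k, 'o, 'm) funct \<Rightarrow> 'o \<Rightarrow> ('j \<Rightarrow> 'm) \<Rightarrow> bool"
  where
  "is_cone J C D c \<pi> \<longleftrightarrow>
     c \<in> Ob C \<and>
     (\<forall>j\<in>Ob J. \<pi> j \<in> Hom C c (fob D j)) \<and>
     (\<forall>i\<in>Ob J. \<forall>j\<in>Ob J. \<forall>u\<in>Hom J i j.
        Cmp C c (fob D i) (fob D j) (far D i j u) (\<pi> i) = \<pi> j)"

definition is_limit ::
    "('j, 'k) category \<Rightarrow> ('o, 'm) category \<Rightarrow> ('j, 'k, 'o, 'm) funct \<Rightarrow> 'o \<Rightarrow> ('j \<Rightarrow> 'm) \<Rightarrow> bool"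
  where
  "is_limit J C D c \<pi> \<longleftrightarrow>
     is_functor J C D \<and> is_cone J C D c \<pi> \<and>
     (\<forall>c' \<pi>'. is_cone J C D c' \<pi>' \<longrightarrow>
        (\<exists>!h. h \<in> Hom C c' c \<and> (\<forall>j\<in>Ob J. Cmp C c' c (fob D j) (\<pi> j) h = \<pi>' j)))"

definition is_cocone ::
    "('j, 'k) category \<Rightarrow> ('o, 'm) category \<Rightarrow> ('j, 'k, 'o, 'm) funct \<Rightarrow> 'o \<Rightarrow> ('j \<Rightarrow> 'm) \<Rightarrow> bool"
  where
  "is_cocone J C D c \<iota> \<longleftrightarrow>
     c \<in> Ob C \<and>
     (\<forall>j\<in>Ob J. \<iota> j \<in> Hom C (fob D j) c) \<and>
     (\<forall>i\<in>Ob J. \<forall>j\<in>Ob J. \<forall>u\<in>Hom J i j.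
        Cmp C (fob D i) (fob D j) c (\<iota> j) (far D i j u) = \<iota> i)"

definition is_colimit ::
    "('j, 'k) category \<Rightarrow> ('o, 'm) category \<Rightarrow> ('j, 'k, 'o, 'm) funct \<Rightarrow> 'o \<Rightarrow> ('j \<Rightarrow> 'm) \<Rightarrow> bool"
  where
  "is_colimit J C D c \<iota> \<longleftrightarrow>
     is_functor J C D \<and> is_cocone J C D c \<iota> \<and>
     (\<forall>c' \<iota>'. is_cocone J C D c' \<iota>' \<longrightarrow>
        (\<exists>!h. h \<in> Hom C c c' \<and> (\<forall>j\<in>Ob J. Cmp C (fob D j) c c' h (\<iota> j) = \<iota>' j)))"

definition small_category :: "'u itself \<Rightarrow> ('j, 'k) category \<Rightarrow> bool" where
  "small_category u J \<longleftrightarrow>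
     is_category J \<and> small u (Ob J) \<and> (\<forall>a\<in>Ob J. \<forall>b\<in>Ob J. small u (Hom J a b))"

text \<open>
  A contravariant set-valued functor \<open>P\<close> on the full subcategory of \<open>C\<close> on \<open>X\<close> takes colimits in
  \<open>C\<close> to limits if it sends every small diagram in \<open>X\<close>, together with a cocone with vertex in
  \<open>X\<close> that is a colimit cocone in \<open>C\<close> (not just in \<open>X\<close>), to a limit cone.  Every small
  category is isomorphic to one whose objects and arrows are elements of \<open>'u\<close>.
\<close>

definition takes_colimits_to_limits ::
    "'u itself \<Rightarrow> ('o, 'm) category \<Rightarrow> 'o set \<Rightarrow> ('o, 'm, 's set, 's \<Rightarrow> 's) funct \<Rightarrow> bool" where
  "takes_colimits_to_limits u C X P \<longleftrightarrow>
     (\<forall>(J :: ('u, 'u) category) D c \<iota>.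
        small_category u J \<and> is_functor J (full_subcat C X) D \<and> c \<in> Ob (full_subcat C X) \<and>
        is_colimit J C D c \<iota> \<longrightarrow>
        is_limit (op_cat J) (set_cat u) (comp_functor P (op_functor D))
          (fob P c) (\<lambda>j. far P c (fob D j) (\<iota> j)))"

text \<open>In the last line \<open>\<iota> j\<close> is an arrow \<open>c \<rightarrow> fob D j\<close> of the opposite category.\<close>

definition colimit_to_limit_functors ::
    "'u itself \<Rightarrow> ('o, 'm) category \<Rightarrow> 'o set \<Rightarrow>
     (('o, 'm, 's set, 's \<Rightarrow> 's) funct, 'o \<Rightarrow> 's \<Rightarrow> 's) category" where
  "colimit_to_limit_functors u C X =
     full_subcat (functor_cat (op_cat (full_subcat C X)) (set_cat u))
       {P. takes_colimits_to_limits u C X P}"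

text \<open>\<open>hom_into C c\<close> is \<open>hom(-, c)\<close>; an arrow \<open>f : b \<rightarrow> a\<close> of \<open>C\<close> is an arrow
  \<open>a \<rightarrow> b\<close> of the opposite category and acts by precomposition.\<close>

definition hom_into :: "('o, 'm) category \<Rightarrow> 'o \<Rightarrow> ('o, 'm, 'm set, 'm \<Rightarrow> 'm) funct" where
  "hom_into C c =
     \<lparr>fob = (\<lambda>a. Hom C a c),
      far = (\<lambda>a b f. \<lambda>g\<in>Hom C a c. Cmp C b a c g f)\<rparr>"

text \<open>
  The functor \<open>c \<mapsto> hom(-, c)\<close>, restricted to the full subcategory of \<open>C\<close> on \<open>X\<close>.  As functors
  are only considered on the objects of their domain, the restriction is visible only in
  the natural transformations.
\<close>

definition restricted_yoneda ::
    "('o, 'm) category \<Rightarrow> 'o set \<Rightarrow>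
     ('o, 'm, ('o, 'm, 'm set, 'm \<Rightarrow> 'm) funct, 'o \<Rightarrow> 'm \<Rightarrow> 'm) funct" where
  "restricted_yoneda C X =
     \<lparr>fob = hom_into C,
      far = (\<lambda>c d g. \<lambda>a\<in>Ob (full_subcat C X). \<lambda>h\<in>Hom C a c. Cmp C a c d g h)\<rparr>"


section \<open>Omega-categories\<close>

datatype sign = Minus | Plus

text \<open>
  \<open>cmp C n x y\<close> is meaningful only if \<open>composable C n x y\<close>; its values elsewhere, like those of
  all the operations off the carrier, are irrelevant.
\<close>

record 'a omega_cat = "'a partial_object" +
  dd :: "sign \<Rightarrow> nat \<Rightarrow> 'a \<Rightarrow> 'a"
  cmp :: "nat \<Rightarrow> 'a \<Rightarrow> 'a \<Rightarrow> 'a"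

definition composable :: "'a omega_cat \<Rightarrow> nat \<Rightarrow> 'a \<Rightarrow> 'a \<Rightarrow> bool" where
  "composable C n x y \<longleftrightarrow> x \<in> carrier C \<and> y \<in> carrier C \<and> dd C Plus n x = dd C Minus n y"

definition is_omega_category :: "'a omega_cat \<Rightarrow> bool" where
  "is_omega_category C \<longleftrightarrow>
     (\<forall>s n. \<forall>x\<in>carrier C. dd C s n x \<in> carrier C) \<and>
     (\<forall>n x y. composable C n x y \<longrightarrow> cmp C n x y \<in> carrier C) \<and>
     (\<forall>x\<in>carrier C. \<exists>n. dd C Minus n x = x \<and> dd C Plus n x = x) \<and>
     (\<forall>s t m n. \<forall>x\<in>carrier C.
        dd C t m (dd C s n x) = (if m < n then dd C t m x else dd C s n x)) \<and>
     (\<forall>n. \<forall>x\<in>carrier C.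
        cmp C n (dd C Minus n x) x = x \<and> cmp C n x (dd C Plus n x) = x) \<and>
     (\<forall>n x y. composable C n x y \<longrightarrow>
        (\<forall>s m. m < n \<longrightarrow>
           dd C s m (cmp C n x y) = dd C s m x \<and>
           dd C s m x = dd C s m y \<and>
           composable C n (dd C s m x) (dd C s m y) \<and>
           dd C s m y = cmp C n (dd C s m x) (dd C s m y)) \<and>
        dd C Minus n (cmp C n x y) = dd C Minus n x \<and>
        dd C Plus n (cmp C n x y) = dd C Plus n y \<and>
        (\<forall>s m. n < m \<longrightarrow>
           composable C n (dd C s m x) (dd C s m y) \<and>
           dd C s m (cmp C n x y) = cmp C n (dd C s m x) (dd C s m y))) \<and>
     (\<forall>n x y z.
        (composable C n x y \<and> composable C n (cmp C n x y) z) \<or>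
        (composable C n y z \<and> composable C n x (cmp C n y z)) \<longrightarrow>
        cmp C n (cmp C n x y) z = cmp C n x (cmp C n y z)) \<and>
     (\<forall>m n x y x' y'.
        m < n \<and> composable C n x y \<and> composable C n x' y' \<and>
        composable C m (cmp C n x y) (cmp C n x' y') \<longrightarrow>
        cmp C m (cmp C n x y) (cmp C n x' y') = cmp C n (cmp C m x x') (cmp C m y y'))"

definition omega_hom :: "'a omega_cat \<Rightarrow> 'a omega_cat \<Rightarrow> ('a \<Rightarrow> 'a) set" where
  "omega_hom C D =
     {f \<in> carrier C \<rightarrow>\<^sub>E carrier D.
        (\<forall>s n. \<forall>x\<in>carrier C. f (dd C s n x) = dd D s n (f x)) \<and>
        (\<forall>n x y. composable C n x y \<longrightarrow> f (cmp C n x y) = cmp D n (f x) (f y))}"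

definition omega_Cat :: "('u omega_cat, 'u \<Rightarrow> 'u) category" where
  "omega_Cat =
     \<lparr>Ob = {C. is_omega_category C \<and> small TYPE('u) (carrier C)},
      Hom = omega_hom,
      Idn = (\<lambda>C. \<lambda>x\<in>carrier C. x),
      Cmp = (\<lambda>A B C g f. compose (carrier A) g f)\<rparr>"

definition cells :: "'a omega_cat \<Rightarrow> nat \<Rightarrow> 'a set" where
  "cells C n = {x \<in> carrier C. dd C Minus n x = x}"


section \<open>Augmented directed complexes\<close>

text \<open>\<open>bd K n\<close> is the boundary \<open>K\<^sub>n\<^sub>+\<^sub>1 \<rightarrow> K\<^sub>n\<close>.  The groups are written multiplicatively.\<close>

record 'k adc =
  grp :: "nat \<Rightarrow> 'k monoid"
  bd :: "nat \<Rightarrow> 'k \<Rightarrow> 'k"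
  aug :: "'k \<Rightarrow> int"
  pos :: "nat \<Rightarrow> 'k set"

definition submonoid_gen :: "('k, 'b) monoid_scheme \<Rightarrow> 'k set \<Rightarrow> 'k set" where
  "submonoid_gen G S = \<Inter>{H. submonoid H G \<and> S \<subseteq> H}"

definition lambda_rels :: "'a omega_cat \<Rightarrow> nat \<Rightarrow> ('a \<Rightarrow>\<^sub>0 int) set" where
  "lambda_rels C n =
     generate (free_Abelian_group (cells C n))
       {frag_of (cmp C m x y) - (frag_of x + frag_of y) | m x y.
          m < n \<and> x \<in> cells C n \<and> y \<in> cells C n \<and> composable C m x y}"

definition lambda_grp :: "'a omega_cat \<Rightarrow> nat \<Rightarrow> ('a \<Rightarrow>\<^sub>0 int) set monoid" where
  "lambda_grp C n = free_Abelian_group (cells C n) Mod lambda_rels C n"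

definition lambda_coset :: "'a omega_cat \<Rightarrow> nat \<Rightarrow> ('a \<Rightarrow>\<^sub>0 int) \<Rightarrow> ('a \<Rightarrow>\<^sub>0 int) set" where
  "lambda_coset C n c = lambda_rels C n #>\<^bsub>free_Abelian_group (cells C n)\<^esub> c"

definition lambda_cls :: "'a omega_cat \<Rightarrow> nat \<Rightarrow> 'a \<Rightarrow> ('a \<Rightarrow>\<^sub>0 int) set" where
  "lambda_cls C n x = lambda_coset C n (frag_of x)"

text \<open>
  The boundary and the augmentation are the homomorphisms on the quotient induced by
  \<open>x \<mapsto> d\<^sup>+\<^sub>n x - d\<^sup>-\<^sub>n x\<close> and by \<open>x \<mapsto> 1\<close> on the free abelian groups.
\<close>

definition lambda :: "'a omega_cat \<Rightarrow> ('a \<Rightarrow>\<^sub>0 int) set adc" where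
  "lambda C =
     \<lparr>grp = lambda_grp C,
      bd = (\<lambda>n X. the_elem
        ((\<lambda>c. lambda_coset C n
           (frag_extend (\<lambda>x. frag_of (dd C Plus n x) - frag_of (dd C Minus n x)) c)) ` X)),
      aug = (\<lambda>X. the_elem ((\<lambda>c. \<Sum>x\<in>Poly_Mapping.keys c. Poly_Mapping.lookup c x) ` X)),
      pos = (\<lambda>n. submonoid_gen (lambda_grp C n) (lambda_cls C n ` cells C n))\<rparr>"


section \<open>Bases\<close>

text \<open>\<open>G\<close> is free abelian with basis \<open>S\<close>: every element is a unique integral linear combination
  of elements of \<open>S\<close>.\<close>

definition free_abelian_on :: "('k, 'b) monoid_scheme \<Rightarrow> 'k set \<Rightarrow> bool" where
  "free_abelian_on G S \<longleftrightarrow>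
     comm_group G \<and> S \<subseteq> carrier G \<and>
     (\<lambda>c. finprod G (\<lambda>s. s [^]\<^bsub>G\<^esub> Poly_Mapping.lookup c s) (Poly_Mapping.keys c))
       \<in> iso (free_Abelian_group S) G"

text \<open>The pair \<open>(n, b)\<close> stands for the element \<open>b\<close> of the \<open>n\<close>-th summand of the disjoint union.\<close>

definition is_adc_basis :: "'k adc \<Rightarrow> (nat \<times> 'k) set \<Rightarrow> bool" where
  "is_adc_basis K B \<longleftrightarrow>
     (\<forall>n. free_abelian_on (grp K n) {b. (n, b) \<in> B} \<and>
          pos K n = submonoid_gen (grp K n) {b. (n, b) \<in> B})"

definition adc_order :: "'k adc \<Rightarrow> nat \<Rightarrow> 'k gorder" where
  "adc_order K n =
     \<lparr>carrier = carrier (grp K n), eq = (=),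
      le = (\<lambda>x y. y \<otimes>\<^bsub>grp K n\<^esub> inv\<^bsub>grp K n\<^esub> x \<in> pos K n)\<rparr>"

definition disjoint_elts :: "'k adc \<Rightarrow> nat \<Rightarrow> 'k \<Rightarrow> 'k \<Rightarrow> bool" where
  "disjoint_elts K n x y \<longleftrightarrow> x \<sqinter>\<^bsub>adc_order K n\<^esub> y = \<one>\<^bsub>grp K n\<^esub>"

definition bd_split :: "'k adc \<Rightarrow> nat \<Rightarrow> 'k \<Rightarrow> 'k \<Rightarrow> 'k \<Rightarrow> bool" where
  "bd_split K n x p q \<longleftrightarrow>
     p \<in> carrier (grp K n) \<and> q \<in> carrier (grp K n) \<and>
     bd K n x = p \<otimes>\<^bsub>grp K n\<^esub> inv\<^bsub>grp K n\<^esub> q \<and> disjoint_elts K n q p"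

definition bd_plus :: "'k adc \<Rightarrow> nat \<Rightarrow> 'k \<Rightarrow> 'k" where
  "bd_plus K n x = (THE p. \<exists>q. bd_split K n x p q)"

definition bd_minus :: "'k adc \<Rightarrow> nat \<Rightarrow> 'k \<Rightarrow> 'k" where
  "bd_minus K n x = (THE q. \<exists>p. bd_split K n x p q)"

definition strongly_loop_free :: "'k adc \<Rightarrow> (nat \<times> 'k) set \<Rightarrow> bool" where
  "strongly_loop_free K B \<longleftrightarrow>
     (\<exists>r. partial_order_on B r \<and>
        (\<forall>n a b. (n, a) \<in> B \<and> (Suc n, b) \<in> B \<and>
           a \<sqsubseteq>\<^bsub>adc_order K n\<^esub> bd_minus K n b \<longrightarrow> ((n, a), (Suc n, b)) \<in> r - Id) \<and>
        (\<forall>n a b. (Suc n, a) \<in> B \<and> (n, b) \<in> B \<and>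
           b \<sqsubseteq>\<^bsub>adc_order K n\<^esub> bd_plus K n a \<longrightarrow> ((Suc n, a), (n, b)) \<in> r - Id))"

inductive_set comp_closure :: "'a omega_cat \<Rightarrow> 'a set \<Rightarrow> 'a set" for C S where
  gen: "x \<in> S \<Longrightarrow> x \<in> comp_closure C S"
| comp: "\<lbrakk>x \<in> comp_closure C S; y \<in> comp_closure C S; composable C m x y\<rbrakk>
         \<Longrightarrow> cmp C m x y \<in> comp_closure C S"

definition composition_generated :: "'a omega_cat \<Rightarrow> 'a set \<Rightarrow> ('a \<Rightarrow> nat) \<Rightarrow> bool" where
  "composition_generated C E dim \<longleftrightarrow>
     E \<subseteq> carrier C \<and> (\<forall>n. cells C n = comp_closure C {e \<in> E. dim e \<le> n})"

definition is_omega_basis ::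
    "'a omega_cat \<Rightarrow> 'a set \<Rightarrow> ('a \<Rightarrow> nat) \<Rightarrow> (nat \<times> ('a \<Rightarrow>\<^sub>0 int) set) set \<Rightarrow> bool" where
  "is_omega_basis C E dim B \<longleftrightarrow>
     composition_generated C E dim \<and> is_adc_basis (lambda C) B \<and>
     bij_betw (\<lambda>e. (dim e, lambda_cls C (dim e) e)) E B"

definition is_atomic :: "'a omega_cat \<Rightarrow> 'a set \<Rightarrow> ('a \<Rightarrow> nat) \<Rightarrow> bool" where
  "is_atomic C E dim \<longleftrightarrow>
     (\<forall>e\<in>E. \<forall>n<dim e.
        disjoint_elts (lambda C) n
          (lambda_cls C n (dd C Minus n e)) (lambda_cls C n (dd C Plus n e)))"

definition has_slf_atomic_basis :: "'a omega_cat \<Rightarrow> bool" where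
  "has_slf_atomic_basis C \<longleftrightarrow>
     (\<exists>E dim B. is_omega_basis C E dim B \<and> is_atomic C E dim \<and> strongly_loop_free (lambda C) B)"

end

theory Submission
  imports Defs "HOL-Library.Countable"
begin


text \<open>A morphism from the \<open>n\<close>-globe to \<open>C\<close> is a cell of dimension at most \<open>n\<close>, and a morphism from the
  composite of two \<open>n\<close>-globes along dimension \<open>m < n\<close> is a composable pair of such cells.  Since
  morphisms of omega-categories are the maps preserving the \<open>d\<^sup>\<alpha>\<^sub>n\<close> and binary composites, these
  shapes are dense in omega-categories, which makes the restricted Yoneda functor fully faithful.

  Conversely let \<open>P\<close> take colimits to limits.  Its values on the \<open>n\<close>-globes are the sets of cells of
  an omega-category \<open>C\<close>; the composition is defined by the value of \<open>P\<close> on the composites of two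
  globes, and the axioms hold because three globes in a row and two-by-two grids of globes also have
  strongly loop-free atomic bases and are colimits of globes.  By density \<open>P\<close> is \<open>hom(-, C)\<close>.

  The shapes are constructed freely by generators and relations, so that their universal property
  comes for free.  A basis is found without listing their cells: the cells
  \<open>d\<^sup>\<alpha>\<^sub>j u\<close> of the generators \<open>u\<close> are composition-generators, and their multiplicities in a cell are
  given by a morphism to an omega-category of double sequences of chains.\<close>

section \<open>Small sets\<close>

text \<open>Two obstacles shape the details. The values of \<open>P\<close> are sets of functions,
  while an object of \<open>omega_Cat\<close> has its cells in \<open>'u\<close>; and a cell has no
  preferred dimension, being an identity in all dimensions above its own. Cells are therefore coded
  independently of the globe that represents them, and only then renamed by elements of
  \<open>'u\<close>, which smallness permits. The same freedom of dimension lets finitely many cells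
  be represented on globes of one common dimension, so that shapes whose generators all have the
  same dimension suffice for every axiom. A free construction gives maps out of a shape but no lower
  bound on its cells: linear independence has to come from a model. The model puts the basis cells
  at integer positions, and one position function yields both the multiplicities and the order for
  strong loop-freeness. A general object with a strongly loop-free atomic basis comes with no
  presentation by globes. It is the colimit of the dense shapes over it, a diagram of such objects
  again, so the hypothesis on \<open>P\<close> reaches it as well.\<close>

lemma small_lepoll: "small u T \<Longrightarrow> S \<lesssim> T \<Longrightarrow> small u S"
  unfolding small_def by (rule lesspoll_trans1)

lemma small_subset: "small u T \<Longrightarrow> S \<subseteq> T \<Longrightarrow> small u S"
  by (rule small_lepoll[OF _ subset_imp_lepoll])

lemma small_image: "small u S \<Longrightarrow> small u (f ` S)"
  by (rule small_lepoll[OF _ image_lepoll])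

lemma small_inj:
  fixes S :: "'s set"
  assumes "small TYPE('u) S"
  obtains f :: "'s \<Rightarrow> 'u" where "inj_on f S"
  using assms unfolding small_def lesspoll_def lepoll_def by auto

lemma small_Pow:
  fixes S :: "'s set"
  assumes "inaccessible TYPE('u)" "small TYPE('u) S"
  shows "small TYPE('u) (Pow S)"
proof -
  obtain f :: "'s \<Rightarrow> 'u" where f: "inj_on f S" using assms(2) by (rule small_inj)
  have "small TYPE('u) (Pow (f ` S))"
    using assms(1) small_image[OF assms(2)] unfolding inaccessible_def by blast
  moreover have "inj_on ((`) f) (Pow S)" using f by (simp add: inj_on_image_Pow)
  then have "Pow S \<lesssim> Pow (f ` S)" unfolding lepoll_def by blast
  ultimately show ?thesis by (rule small_lepoll)
qed

text \<open>Inaccessibility speaks only of unions of subsets of \<open>'u\<close>. The sum becomes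
  such a union when \<open>(i, x)\<close> is coded by a pairing function on \<open>'u\<close>, which
  exists because \<open>'u\<close> is infinite and keeps the fibres apart.\<close>

lemma small_Sigma:
  fixes I :: "'i set" and X :: "'i \<Rightarrow> 's set"
  assumes inacc: "inaccessible TYPE('u)" and I: "small TYPE('u) I"
    and X: "\<And>i. i \<in> I \<Longrightarrow> small TYPE('u) (X i)"
  shows "small TYPE('u) (Sigma I X)"
proof -
  have "uncountable (UNIV :: 'u set)" using inacc by (simp add: inaccessible_def)
  then have inf: "infinite (UNIV :: 'u set)" using countable_finite by blast
  have "|(UNIV :: 'u set) \<times> (UNIV :: 'u set)| \<le>o |UNIV :: 'u set|"
    using card_of_Times_same_infinite[OF inf] by (simp add: ordIso_iff_ordLeq)
  then obtain p :: "'u \<times> 'u \<Rightarrow> 'u" where p: "inj p"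
    unfolding card_of_ordLeq[symmetric] by auto
  obtain g :: "'i \<Rightarrow> 'u" where g: "inj_on g I" using I by (rule small_inj)
  have "\<forall>i\<in>I. \<exists>h :: 's \<Rightarrow> 'u. inj_on h (X i)" using X by (meson small_inj)
  then obtain h :: "'i \<Rightarrow> 's \<Rightarrow> 'u" where h: "\<And>i. i \<in> I \<Longrightarrow> inj_on (h i) (X i)" by metis
  define Y where "Y k = (\<lambda>x. p (k, h (inv_into I g k) x)) ` X (inv_into I g k)" for k
  have "small TYPE('u) (\<Union>k\<in>g ` I. Y k)"
  proof -
    have "small TYPE('u) (Y k)" if "k \<in> g ` I" for k
      unfolding Y_def using that by (intro small_image X) (rule inv_into_into)
    with inacc small_image[OF I, of g] show ?thesis
      unfolding inaccessible_def by blast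
  qed
  moreover have "Sigma I X \<lesssim> (\<Union>k\<in>g ` I. Y k)"
    unfolding lepoll_def
  proof (intro exI conjI)
    show "inj_on (\<lambda>(i, x). p (g i, h i x)) (Sigma I X)"
    proof (rule inj_onI)
      fix a b assume ab: "a \<in> Sigma I X" "b \<in> Sigma I X"
        and eq: "(\<lambda>(i, x). p (g i, h i x)) a = (\<lambda>(i, x). p (g i, h i x)) b"
      obtain i x j y where a: "a = (i, x)" and b: "b = (j, y)" by fastforce
      have "(g i, h i x) = (g j, h j y)" using injD[OF p, of "(g i, h i x)" "(g j, h j y)"] eq a b by simp
      then have "i = j" using ab a b g by (auto dest: inj_onD)
      with \<open>(g i, h i x) = (g j, h j y)\<close> have "x = y"
        using ab a b h[of i] by (auto dest: inj_onD)
      with \<open>i = j\<close> show "a = b" using a b by simp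
    qed
    show "(\<lambda>(i, x). p (g i, h i x)) ` Sigma I X \<subseteq> (\<Union>k\<in>g ` I. Y k)"
      using g by (auto simp: Y_def)
  qed
  ultimately show ?thesis by (rule small_lepoll)
qed

lemma small_countable:
  assumes "inaccessible TYPE('u)" "countable S"
  shows "small TYPE('u) S"
proof -
  have unc: "uncountable (UNIV :: 'u set)" using assms(1) unfolding inaccessible_def by blast
  then have "(UNIV :: nat set) \<lesssim> (UNIV :: 'u set)"
    using infinite_le_lepoll countable_finite by blast
  moreover have "S \<lesssim> (UNIV :: nat set)"
    using assms(2) unfolding countable_def lepoll_def by blast
  ultimately have "S \<lesssim> (UNIV :: 'u set)" by (rule lepoll_trans[rotated])
  moreover have "\<not> S \<approx> (UNIV :: 'u set)"
    using unc assms(2) countable_eqpoll eqpoll_sym by blast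
  ultimately show ?thesis by (simp add: small_def lesspoll_def)
qed

text \<open>An extensional function is determined by its graph, so the function set embeds in the
  power set of a small product.\<close>

lemma small_PiE:
  assumes "inaccessible TYPE('u)" "small TYPE('u) A" "small TYPE('u) B"
  shows "small TYPE('u) (A \<rightarrow>\<^sub>E B)"
proof -
  define gr where "gr f = (\<lambda>x. (x, f x)) ` A" for f :: "'a \<Rightarrow> 'b"
  have "inj_on gr (A \<rightarrow>\<^sub>E B)"
  proof (rule inj_onI)
    fix f g assume fg: "f \<in> A \<rightarrow>\<^sub>E B" "g \<in> A \<rightarrow>\<^sub>E B" "gr f = gr g"
    have "f x = g x" if "x \<in> A" for x
    proof -
      have "(x, f x) \<in> gr g" using that fg(3) unfolding gr_def by blast
      then show ?thesis by (auto simp: gr_def)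
    qed
    with fg(1,2) show "f = g" by (rule PiE_ext)
  qed
  moreover have "gr ` (A \<rightarrow>\<^sub>E B) \<subseteq> Pow (A \<times> B)" by (auto simp: gr_def)
  ultimately have "(A \<rightarrow>\<^sub>E B) \<lesssim> Pow (A \<times> B)" unfolding lepoll_def by blast
  then show ?thesis
    using small_lepoll[OF small_Pow[OF assms(1) small_Sigma[OF assms(1,2,3)]]] by blast
qed

lemma inaccessible_countable_inj:
  assumes "inaccessible TYPE('u)"
  obtains f :: "'a::countable \<Rightarrow> 'u" where "inj f"
  using small_inj[OF small_countable[OF assms, of "UNIV :: 'a set"]] by blast


section \<open>Categories\<close>

lemma category_idn: "is_category C \<Longrightarrow> a \<in> Ob C \<Longrightarrow> Idn C a \<in> Hom C a a"
  unfolding is_category_def by blast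

lemma category_cmp:
  "is_category C \<Longrightarrow> a \<in> Ob C \<Longrightarrow> b \<in> Ob C \<Longrightarrow> c \<in> Ob C \<Longrightarrow> f \<in> Hom C a b \<Longrightarrow>
   g \<in> Hom C b c \<Longrightarrow> Cmp C a b c g f \<in> Hom C a c"
  unfolding is_category_def by blast

lemma category_idr:
  "is_category C \<Longrightarrow> a \<in> Ob C \<Longrightarrow> b \<in> Ob C \<Longrightarrow> f \<in> Hom C a b \<Longrightarrow> Cmp C a a b f (Idn C a) = f"
  unfolding is_category_def by blast

lemma category_idl:
  "is_category C \<Longrightarrow> a \<in> Ob C \<Longrightarrow> b \<in> Ob C \<Longrightarrow> f \<in> Hom C a b \<Longrightarrow> Cmp C a b b (Idn C b) f = f"
  unfolding is_category_def by blast

lemma category_assoc: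
  "is_category C \<Longrightarrow> a \<in> Ob C \<Longrightarrow> b \<in> Ob C \<Longrightarrow> c \<in> Ob C \<Longrightarrow> d \<in> Ob C \<Longrightarrow> f \<in> Hom C a b \<Longrightarrow>
   g \<in> Hom C b c \<Longrightarrow> h \<in> Hom C c d \<Longrightarrow>
   Cmp C a c d h (Cmp C a b c g f) = Cmp C a b d (Cmp C b c d h g) f"
  unfolding is_category_def by blast

lemma is_categoryI:
  assumes "\<And>a. a \<in> Ob C \<Longrightarrow> Idn C a \<in> Hom C a a"
    and "\<And>a b c f g. a \<in> Ob C \<Longrightarrow> b \<in> Ob C \<Longrightarrow> c \<in> Ob C \<Longrightarrow> f \<in> Hom C a b \<Longrightarrow> g \<in> Hom C b c \<Longrightarrow>
      Cmp C a b c g f \<in> Hom C a c"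
    and "\<And>a b f. a \<in> Ob C \<Longrightarrow> b \<in> Ob C \<Longrightarrow> f \<in> Hom C a b \<Longrightarrow> Cmp C a a b f (Idn C a) = f"
    and "\<And>a b f. a \<in> Ob C \<Longrightarrow> b \<in> Ob C \<Longrightarrow> f \<in> Hom C a b \<Longrightarrow> Cmp C a b b (Idn C b) f = f"
    and "\<And>a b c d f g h. a \<in> Ob C \<Longrightarrow> b \<in> Ob C \<Longrightarrow> c \<in> Ob C \<Longrightarrow> d \<in> Ob C \<Longrightarrow> f \<in> Hom C a b \<Longrightarrow>
      g \<in> Hom C b c \<Longrightarrow> h \<in> Hom C c d \<Longrightarrow>
      Cmp C a c d h (Cmp C a b c g f) = Cmp C a b d (Cmp C b c d h g) f"
  shows "is_category C"
  unfolding is_category_def by (intro conjI ballI; (rule assms; assumption))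

lemma functor_ob: "is_functor C D F \<Longrightarrow> a \<in> Ob C \<Longrightarrow> fob F a \<in> Ob D"
  unfolding is_functor_def by blast

lemma functor_ar:
  "is_functor C D F \<Longrightarrow> a \<in> Ob C \<Longrightarrow> b \<in> Ob C \<Longrightarrow> f \<in> Hom C a b \<Longrightarrow>
   far F a b f \<in> Hom D (fob F a) (fob F b)"
  unfolding is_functor_def by blast

lemma functor_idn: "is_functor C D F \<Longrightarrow> a \<in> Ob C \<Longrightarrow> far F a a (Idn C a) = Idn D (fob F a)"
  unfolding is_functor_def by blast

lemma functor_cmp:
  "is_functor C D F \<Longrightarrow> a \<in> Ob C \<Longrightarrow> b \<in> Ob C \<Longrightarrow> c \<in> Ob C \<Longrightarrow> f \<in> Hom C a b \<Longrightarrow> g \<in> Hom C b c \<Longrightarrow>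
   far F a c (Cmp C a b c g f) = Cmp D (fob F a) (fob F b) (fob F c) (far F b c g) (far F a b f)"
  unfolding is_functor_def by blast

lemma functor_cats: "is_functor C D F \<Longrightarrow> is_category C \<and> is_category D"
  unfolding is_functor_def by blast

lemma is_functorI:
  assumes "is_category C" "is_category D" "\<And>a. a \<in> Ob C \<Longrightarrow> fob F a \<in> Ob D"
    and "\<And>a b f. a \<in> Ob C \<Longrightarrow> b \<in> Ob C \<Longrightarrow> f \<in> Hom C a b \<Longrightarrow> far F a b f \<in> Hom D (fob F a) (fob F b)"
    and "\<And>a. a \<in> Ob C \<Longrightarrow> far F a a (Idn C a) = Idn D (fob F a)"
    and "\<And>a b c f g. a \<in> Ob C \<Longrightarrow> b \<in> Ob C \<Longrightarrow> c \<in> Ob C \<Longrightarrow> f \<in> Hom C a b \<Longrightarrow> g \<in> Hom C b c \<Longrightarrow>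
      far F a c (Cmp C a b c g f) =
      Cmp D (fob F a) (fob F b) (fob F c) (far F b c g) (far F a b f)"
  shows "is_functor C D F"
  unfolding is_functor_def by (intro conjI ballI; (rule assms; assumption?))

lemma is_category_op: "is_category C \<Longrightarrow> is_category (op_cat C)"
  by (rule is_categoryI)
     (auto simp: op_cat_def category_idn category_cmp category_idl category_idr category_assoc)

lemma is_category_full_subcat: "is_category C \<Longrightarrow> is_category (full_subcat C X)"
  by (rule is_categoryI)
     (auto simp: full_subcat_def category_idn category_cmp category_idl category_idr category_assoc)

lemma is_category_set_cat: "is_category (set_cat u)"
  by (rule is_categoryI) (auto simp: set_cat_def compose_def PiE_def extensional_def fun_eq_iff)

lemma is_category_functor_cat:
  assumes "is_category C" "is_category D"
  shows "is_category (functor_cat C D)"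
proof (rule is_categoryI)
  fix F assume "F \<in> Ob (functor_cat C D)"
  then have F: "is_functor C D F" by (simp add: functor_cat_def)
  show "Idn (functor_cat C D) F \<in> Hom (functor_cat C D) F F"
    using assms functor_ob[OF F] functor_ar[OF F]
    by (auto simp: functor_cat_def is_nat_trans_def category_idn category_idl category_idr)
next
  fix F G H \<alpha> \<beta>
  assume "F \<in> Ob (functor_cat C D)" "G \<in> Ob (functor_cat C D)" "H \<in> Ob (functor_cat C D)"
    and "\<alpha> \<in> Hom (functor_cat C D) F G" "\<beta> \<in> Hom (functor_cat C D) G H"
  then have F: "is_functor C D F" and G: "is_functor C D G" and H: "is_functor C D H"
    and a: "is_nat_trans C D F G \<alpha>" and b: "is_nat_trans C D G H \<beta>"
    by (simp_all add: functor_cat_def)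
  have "Cmp D (fob F i) (fob F j) (fob H j)
         (Cmp D (fob F j) (fob G j) (fob H j) (\<beta> j) (\<alpha> j)) (far F i j f) =
        Cmp D (fob F i) (fob H i) (fob H j) (far H i j f)
         (Cmp D (fob F i) (fob G i) (fob H i) (\<beta> i) (\<alpha> i))" (is "?l = ?r")
    if i: "i \<in> Ob C" and j: "j \<in> Ob C" and f: "f \<in> Hom C i j" for i j f
  proof -
    note ob = functor_ob[OF F i] functor_ob[OF F j] functor_ob[OF G i] functor_ob[OF G j]
      functor_ob[OF H i] functor_ob[OF H j]
    have al: "\<alpha> i \<in> Hom D (fob F i) (fob G i)" "\<alpha> j \<in> Hom D (fob F j) (fob G j)"
      and be: "\<beta> i \<in> Hom D (fob G i) (fob H i)" "\<beta> j \<in> Hom D (fob G j) (fob H j)"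
      using a b i j unfolding is_nat_trans_def by blast+
    note ars = functor_ar[OF F i j f] functor_ar[OF G i j f] functor_ar[OF H i j f]
    have "?l = Cmp D (fob F i) (fob G j) (fob H j) (\<beta> j)
                (Cmp D (fob F i) (fob F j) (fob G j) (\<alpha> j) (far F i j f))"
      using assms(2) ob al be ars by (simp add: category_assoc)
    also have "\<dots> = Cmp D (fob F i) (fob G j) (fob H j) (\<beta> j)
                (Cmp D (fob F i) (fob G i) (fob G j) (far G i j f) (\<alpha> i))"
      using a i j f unfolding is_nat_trans_def by simp
    also have "\<dots> = Cmp D (fob F i) (fob G i) (fob H j)
                (Cmp D (fob G i) (fob G j) (fob H j) (\<beta> j) (far G i j f)) (\<alpha> i)"
      using assms(2) ob al be ars by (simp add: category_assoc)
    also have "\<dots> = Cmp D (fob F i) (fob G i) (fob H j)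
                (Cmp D (fob G i) (fob H i) (fob H j) (far H i j f) (\<beta> i)) (\<alpha> i)"
      using b i j f unfolding is_nat_trans_def by simp
    also have "\<dots> = ?r" using assms(2) ob al be ars by (simp add: category_assoc)
    finally show ?thesis .
  qed
  moreover have "Cmp D (fob F i) (fob G i) (fob H i) (\<beta> i) (\<alpha> i) \<in> Hom D (fob F i) (fob H i)"
    if i: "i \<in> Ob C" for i
    using category_cmp[OF assms(2) functor_ob[OF F i] functor_ob[OF G i] functor_ob[OF H i]]
      a b i unfolding is_nat_trans_def by blast
  ultimately show "Cmp (functor_cat C D) F G H \<beta> \<alpha> \<in> Hom (functor_cat C D) F H"
    by (auto simp: functor_cat_def is_nat_trans_def)
next
  fix F G \<alpha>
  assume "F \<in> Ob (functor_cat C D)" "G \<in> Ob (functor_cat C D)"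
    and "\<alpha> \<in> Hom (functor_cat C D) F G"
  then have F: "is_functor C D F" and G: "is_functor C D G"
    and a: "is_nat_trans C D F G \<alpha>" "\<alpha> \<in> extensional (Ob C)"
    by (simp_all add: functor_cat_def)
  have al: "\<alpha> i \<in> Hom D (fob F i) (fob G i)" if "i \<in> Ob C" for i
    using a that unfolding is_nat_trans_def by blast
  show "Cmp (functor_cat C D) F F G \<alpha> (Idn (functor_cat C D) F) = \<alpha>"
    and "Cmp (functor_cat C D) F G G (Idn (functor_cat C D) G) \<alpha> = \<alpha>"
    using a(2) category_idr[OF assms(2) functor_ob[OF F] functor_ob[OF G] al]
      category_idl[OF assms(2) functor_ob[OF F] functor_ob[OF G] al]
    by (auto simp: functor_cat_def extensional_def fun_eq_iff)
next
  fix F G H K \<alpha> \<beta> \<gamma>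
  assume "F \<in> Ob (functor_cat C D)" "G \<in> Ob (functor_cat C D)" "H \<in> Ob (functor_cat C D)"
    "K \<in> Ob (functor_cat C D)"
    and "\<alpha> \<in> Hom (functor_cat C D) F G" "\<beta> \<in> Hom (functor_cat C D) G H"
      "\<gamma> \<in> Hom (functor_cat C D) H K"
  then have ob: "fob F i \<in> Ob D" "fob G i \<in> Ob D" "fob H i \<in> Ob D" "fob K i \<in> Ob D"
    and ar: "\<alpha> i \<in> Hom D (fob F i) (fob G i)" "\<beta> i \<in> Hom D (fob G i) (fob H i)"
      "\<gamma> i \<in> Hom D (fob H i) (fob K i)" if "i \<in> Ob C" for i
    using that by (auto simp: functor_cat_def is_nat_trans_def functor_ob)
  show "Cmp (functor_cat C D) F H K \<gamma> (Cmp (functor_cat C D) F G H \<beta> \<alpha>) =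
        Cmp (functor_cat C D) F G K (Cmp (functor_cat C D) G H K \<gamma> \<beta>) \<alpha>"
    using category_assoc[OF assms(2) ob ar] by (auto simp: functor_cat_def)
qed

text \<open>The quasi-inverse is chosen objectwise. On arrows it conjugates with the chosen
  isomorphisms and lifts the result through \<open>F\<close>; faithfulness then reduces every
  equation between lifts to one in \<open>D\<close>.\<close>

theorem equivalence_if_fully_faithful_ess_surj:
  assumes F: "is_functor C D F"
    and faithful: "\<And>a b f g. a \<in> Ob C \<Longrightarrow> b \<in> Ob C \<Longrightarrow> f \<in> Hom C a b \<Longrightarrow> g \<in> Hom C a b \<Longrightarrow>
      far F a b f = far F a b g \<Longrightarrow> f = g"
    and full: "\<And>a b g. a \<in> Ob C \<Longrightarrow> b \<in> Ob C \<Longrightarrow> g \<in> Hom D (fob F a) (fob F b) \<Longrightarrow>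
      \<exists>f\<in>Hom C a b. far F a b f = g"
    and ess: "\<And>d. d \<in> Ob D \<Longrightarrow> \<exists>c\<in>Ob C. \<exists>\<phi>. is_iso_arrow D (fob F c) d \<phi>"
  shows "is_equivalence C D F"
proof -
  have C: "is_category C" and D: "is_category D" using functor_cats[OF F] by auto
  have "\<forall>d\<in>Ob D. \<exists>c \<phi> \<psi>. c \<in> Ob C \<and> \<phi> \<in> Hom D (fob F c) d \<and> \<psi> \<in> Hom D d (fob F c) \<and>
      Cmp D (fob F c) d (fob F c) \<psi> \<phi> = Idn D (fob F c) \<and> Cmp D d (fob F c) d \<phi> \<psi> = Idn D d"
    using ess unfolding is_iso_arrow_def by blast
  then obtain G \<phi> \<psi> where G: "\<And>d. d \<in> Ob D \<Longrightarrow> G d \<in> Ob C"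
    and \<phi>: "\<And>d. d \<in> Ob D \<Longrightarrow> \<phi> d \<in> Hom D (fob F (G d)) d"
    and \<psi>: "\<And>d. d \<in> Ob D \<Longrightarrow> \<psi> d \<in> Hom D d (fob F (G d))"
    and \<psi>\<phi>: "\<And>d. d \<in> Ob D \<Longrightarrow>
      Cmp D (fob F (G d)) d (fob F (G d)) (\<psi> d) (\<phi> d) = Idn D (fob F (G d))"
    and \<phi>\<psi>: "\<And>d. d \<in> Ob D \<Longrightarrow> Cmp D d (fob F (G d)) d (\<phi> d) (\<psi> d) = Idn D d"
    by metis
  define L where "L a b g = (SOME f. f \<in> Hom C a b \<and> far F a b f = g)" for a b g
  have L: "L a b g \<in> Hom C a b" and FL: "far F a b (L a b g) = g"
    if "a \<in> Ob C" "b \<in> Ob C" "g \<in> Hom D (fob F a) (fob F b)" for a b g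
    using someI_ex[of "\<lambda>f. f \<in> Hom C a b \<and> far F a b f = g"] full[OF that]
    unfolding L_def by blast+
  define conj where "conj d e g =
    Cmp D (fob F (G d)) d (fob F (G e)) (Cmp D d e (fob F (G e)) (\<psi> e) g) (\<phi> d)" for d e g
  note obF = functor_ob[OF F] and arF = functor_ar[OF F]
  note obs = G obF[OF G]
  have conj: "conj d e g \<in> Hom D (fob F (G d)) (fob F (G e))"
    if "d \<in> Ob D" "e \<in> Ob D" "g \<in> Hom D d e" for d e g
    unfolding conj_def using that obs \<phi> \<psi> by (intro category_cmp[OF D]) auto
  have conj_cmp: "conj d k (Cmp D d e k h g) =
      Cmp D (fob F (G d)) (fob F (G e)) (fob F (G k)) (conj e k h) (conj d e g)"
    if ob: "d \<in> Ob D" "e \<in> Ob D" "k \<in> Ob D" and g: "g \<in> Hom D d e" and h: "h \<in> Hom D e k"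
    for d e k g h
  proof -
    let ?d = "fob F (G d)" and ?e = "fob F (G e)" and ?k = "fob F (G k)"
    have ob': "?d \<in> Ob D" "?e \<in> Ob D" "?k \<in> Ob D" using obs ob by auto
    have pg: "Cmp D d e ?e (\<psi> e) g \<in> Hom D d ?e" and ph: "Cmp D e k ?k (\<psi> k) h \<in> Hom D e ?k"
      using ob ob' g h \<psi> by (auto intro: category_cmp[OF D])
    have "Cmp D ?d ?e ?k (conj e k h) (conj d e g) =
      Cmp D ?d d ?k (Cmp D d ?e ?k (conj e k h) (Cmp D d e ?e (\<psi> e) g)) (\<phi> d)"
      unfolding conj_def[of d e g]
      using category_assoc[OF D ob'(1) ob(1) ob'(2,3) \<phi>[OF ob(1)] pg conj[OF ob(2,3) h]] .
    also have "Cmp D d ?e ?k (conj e k h) (Cmp D d e ?e (\<psi> e) g) =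
      Cmp D d ?e ?k (Cmp D ?e e ?k (Cmp D e k ?k (\<psi> k) h) (\<phi> e)) (Cmp D d e ?e (\<psi> e) g)"
      by (simp add: conj_def)
    also have "\<dots> = Cmp D d e ?k (Cmp D e k ?k (\<psi> k) h) (Cmp D d ?e e (\<phi> e) (Cmp D d e ?e (\<psi> e) g))"
      using category_assoc[OF D ob(1) ob'(2) ob(2) ob'(3) pg \<phi>[OF ob(2)] ph] by simp
    \<comment> \<open>The adjacent \<open>\<psi> e\<close> and \<open>\<phi> e\<close> cancel; this
      is why conjugation respects composition.\<close>
    also have "Cmp D d ?e e (\<phi> e) (Cmp D d e ?e (\<psi> e) g) = g"
      using category_assoc[OF D ob(1,2) ob'(2) ob(2) g \<psi>[OF ob(2)] \<phi>[OF ob(2)]]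
        category_idl[OF D ob(1,2) g] \<phi>\<psi>[OF ob(2)] by simp
    also have "Cmp D d e ?k (Cmp D e k ?k (\<psi> k) h) g = Cmp D d k ?k (\<psi> k) (Cmp D d e k h g)"
      using category_assoc[OF D ob ob'(3) g h \<psi>[OF ob(3)]] by simp
    finally show ?thesis by (simp add: conj_def)
  qed
  define GG where "GG = \<lparr>fob = G, far = (\<lambda>d e g. L (G d) (G e) (conj d e g))\<rparr>"
  have GG: "is_functor D C GG"
  proof (rule is_functorI[OF D C])
    show "fob GG d \<in> Ob C" if "d \<in> Ob D" for d using G that by (simp add: GG_def)
    show "far GG d e g \<in> Hom C (fob GG d) (fob GG e)"
      if "d \<in> Ob D" "e \<in> Ob D" "g \<in> Hom D d e" for d e g
      using L[OF G G conj] that by (simp add: GG_def)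
    show "far GG d d (Idn D d) = Idn C (fob GG d)" if d: "d \<in> Ob D" for d
    proof -
      have "conj d d (Idn D d) = Idn D (fob F (G d))"
        unfolding conj_def using d category_idr[OF D d obs(2)[OF d] \<psi>[OF d]] \<psi>\<phi> by simp
      also have "\<dots> = far F (G d) (G d) (Idn C (G d))"
        using functor_idn[OF F G[OF d]] by simp
      finally have "far F (G d) (G d) (L (G d) (G d) (conj d d (Idn D d))) =
          far F (G d) (G d) (Idn C (G d))"
        using FL[OF G[OF d] G[OF d] conj[OF d d category_idn[OF D d]]] by simp
      then show ?thesis
        unfolding GG_def
        using faithful[OF G[OF d] G[OF d] L[OF G[OF d] G[OF d] conj[OF d d category_idn[OF D d]]]
            category_idn[OF C G[OF d]]] by simp
    qed
    show "far GG d k (Cmp D d e k h g) =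
        Cmp C (fob GG d) (fob GG e) (fob GG k) (far GG e k h) (far GG d e g)"
      if ob: "d \<in> Ob D" "e \<in> Ob D" "k \<in> Ob D" and g: "g \<in> Hom D d e" and h: "h \<in> Hom D e k"
      for d e k g h
    proof -
      note cg = conj[OF ob(1,2) g] and ch = conj[OF ob(2,3) h]
        and chg = conj[OF ob(1,3) category_cmp[OF D ob g h]]
      note Lg = L[OF G[OF ob(1)] G[OF ob(2)] cg] and Lh = L[OF G[OF ob(2)] G[OF ob(3)] ch]
      have "L (G d) (G k) (conj d k (Cmp D d e k h g)) =
          Cmp C (G d) (G e) (G k) (L (G e) (G k) (conj e k h)) (L (G d) (G e) (conj d e g))"
      proof (rule faithful[OF G[OF ob(1)] G[OF ob(3)] L[OF G[OF ob(1)] G[OF ob(3)] chg]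
            category_cmp[OF C G[OF ob(1)] G[OF ob(2)] G[OF ob(3)] Lg Lh]])
        show "far F (G d) (G k) (L (G d) (G k) (conj d k (Cmp D d e k h g))) =
          far F (G d) (G k)
            (Cmp C (G d) (G e) (G k) (L (G e) (G k) (conj e k h)) (L (G d) (G e) (conj d e g)))"
          unfolding functor_cmp[OF F G[OF ob(1)] G[OF ob(2)] G[OF ob(3)] Lg Lh]
          using FL[OF G[OF ob(1)] G[OF ob(3)] chg] FL[OF G[OF ob(1)] G[OF ob(2)] cg]
            FL[OF G[OF ob(2)] G[OF ob(3)] ch] conj_cmp[OF ob g h] by simp
      qed
      then show ?thesis by (simp add: GG_def)
    qed
  qed
  moreover have "nat_isomorphic C C id_functor (comp_functor GG F)"
    unfolding nat_isomorphic_def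
  proof (intro exI conjI ballI)
    \<comment> \<open>The unit at \<open>c\<close> is the lift of the inverse isomorphism at
      \<open>fob F c\<close>. Its own inverse, \<open>?\<theta>\<close> below, is the lift of
      \<open>\<phi>\<close>.\<close>
    let ?\<eta> = "\<lambda>c. L c (G (fob F c)) (\<psi> (fob F c))"
    have \<eta>: "?\<eta> c \<in> Hom C c (G (fob F c))" "far F c (G (fob F c)) (?\<eta> c) = \<psi> (fob F c)"
      if c: "c \<in> Ob C" for c
      using L[OF c G[OF obF[OF c]] \<psi>[OF obF[OF c]]] FL[OF c G[OF obF[OF c]] \<psi>[OF obF[OF c]]]
      by auto
    show "is_nat_trans C C id_functor (comp_functor GG F) ?\<eta>"
      unfolding is_nat_trans_def
    proof (intro conjI ballI)
      show "?\<eta> c \<in> Hom C (fob id_functor c) (fob (comp_functor GG F) c)" if "c \<in> Ob C" for c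
        using \<eta>(1)[OF that] by (simp add: id_functor_def comp_functor_def GG_def)
      fix a b f assume a: "a \<in> Ob C" and b: "b \<in> Ob C" and f: "f \<in> Hom C a b"
      let ?a = "fob F a" and ?b = "fob F b" and ?f = "far F a b f"
      note oa = obF[OF a] and ob = obF[OF b] and ff = arF[OF a b f]
      let ?h = "L (G ?a) (G ?b) (conj ?a ?b ?f)"
      have h: "?h \<in> Hom C (G ?a) (G ?b)" "far F (G ?a) (G ?b) ?h = conj ?a ?b ?f"
        using L[OF G[OF oa] G[OF ob] conj[OF oa ob ff]] FL[OF G[OF oa] G[OF ob] conj[OF oa ob ff]]
        by auto
      have "Cmp C a b (G ?b) (?\<eta> b) f = Cmp C a (G ?a) (G ?b) ?h (?\<eta> a)"
      proof (rule faithful[OF a G[OF ob] category_cmp[OF C a b G[OF ob] f \<eta>(1)[OF b]]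
            category_cmp[OF C a G[OF oa] G[OF ob] \<eta>(1)[OF a] h(1)]])
        let ?pf = "Cmp D ?a ?b (fob F (G ?b)) (\<psi> ?b) ?f"
        have pf: "?pf \<in> Hom D ?a (fob F (G ?b))"
          by (rule category_cmp[OF D oa ob obs(2)[OF ob] ff \<psi>[OF ob]])
        have "far F a (G ?b) (Cmp C a (G ?a) (G ?b) ?h (?\<eta> a)) =
          Cmp D ?a (fob F (G ?a)) (fob F (G ?b)) (conj ?a ?b ?f) (\<psi> ?a)"
          using functor_cmp[OF F a G[OF oa] G[OF ob] \<eta>(1)[OF a] h(1)] \<eta>(2)[OF a] h(2) by simp
        also have "\<dots> = Cmp D ?a ?a (fob F (G ?b)) ?pf
            (Cmp D ?a (fob F (G ?a)) ?a (\<phi> ?a) (\<psi> ?a))"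
          unfolding conj_def
          using category_assoc[OF D oa obs(2)[OF oa] oa obs(2)[OF ob] \<psi>[OF oa] \<phi>[OF oa] pf] by simp
        also have "\<dots> = ?pf"
          using \<phi>\<psi>[OF oa] category_idr[OF D oa obs(2)[OF ob] pf] by simp
        finally show "far F a (G ?b) (Cmp C a b (G ?b) (?\<eta> b) f) =
            far F a (G ?b) (Cmp C a (G ?a) (G ?b) ?h (?\<eta> a))"
          using functor_cmp[OF F a b G[OF ob] f \<eta>(1)[OF b]] \<eta>(2)[OF b] by simp
      qed
      then show "Cmp C (fob id_functor a) (fob id_functor b) (fob (comp_functor GG F) b) (?\<eta> b)
          (far id_functor a b f) =
        Cmp C (fob id_functor a) (fob (comp_functor GG F) a) (fob (comp_functor GG F) b)
          (far (comp_functor GG F) a b f) (?\<eta> a)"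
        by (simp add: id_functor_def comp_functor_def GG_def)
    qed
    fix c assume c: "c \<in> Ob C"
    let ?c = "fob F c"
    note oc = obF[OF c]
    let ?\<theta> = "L (G ?c) c (\<phi> ?c)"
    have \<theta>: "?\<theta> \<in> Hom C (G ?c) c" "far F (G ?c) c ?\<theta> = \<phi> ?c"
      using L[OF G[OF oc] c \<phi>[OF oc]] FL[OF G[OF oc] c \<phi>[OF oc]] by auto
    have "Cmp C c (G ?c) c ?\<theta> (?\<eta> c) = Idn C c"
      by (rule faithful[OF c c category_cmp[OF C c G[OF oc] c \<eta>(1)[OF c] \<theta>(1)] category_idn[OF C c]])
         (simp add: functor_cmp[OF F c G[OF oc] c \<eta>(1)[OF c] \<theta>(1)] \<theta>(2) \<eta>(2)[OF c] \<phi>\<psi>[OF oc]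
           functor_idn[OF F c])
    moreover have "Cmp C (G ?c) c (G ?c) (?\<eta> c) ?\<theta> = Idn C (G ?c)"
      by (rule faithful[OF G[OF oc] G[OF oc] category_cmp[OF C G[OF oc] c G[OF oc] \<theta>(1) \<eta>(1)[OF c]]
          category_idn[OF C G[OF oc]]])
         (simp add: functor_cmp[OF F G[OF oc] c G[OF oc] \<theta>(1) \<eta>(1)[OF c]] \<theta>(2) \<eta>(2)[OF c]
           \<psi>\<phi>[OF oc] functor_idn[OF F G[OF oc]])
    ultimately show "is_iso_arrow C (fob id_functor c) (fob (comp_functor GG F) c) (?\<eta> c)"
      unfolding is_iso_arrow_def using \<eta>(1)[OF c] \<theta>(1)
      by (auto simp: id_functor_def comp_functor_def GG_def)
  qed
  moreover have "nat_isomorphic D D (comp_functor F GG) id_functor"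
    unfolding nat_isomorphic_def
  proof (intro exI conjI ballI)
    show "is_nat_trans D D (comp_functor F GG) id_functor \<phi>"
      unfolding is_nat_trans_def
    proof (intro conjI ballI)
      show "\<phi> d \<in> Hom D (fob (comp_functor F GG) d) (fob id_functor d)" if "d \<in> Ob D" for d
        using \<phi>[OF that] by (simp add: id_functor_def comp_functor_def GG_def)
      fix a b g assume a: "a \<in> Ob D" and b: "b \<in> Ob D" and g: "g \<in> Hom D a b"
      let ?a = "fob F (G a)" and ?b = "fob F (G b)"
      let ?pg = "Cmp D a b ?b (\<psi> b) g"
      have pg: "?pg \<in> Hom D a ?b" by (rule category_cmp[OF D a b obs(2)[OF b] g \<psi>[OF b]])
      have "Cmp D ?a ?b b (\<phi> b) (conj a b g) = Cmp D ?a a b (Cmp D a ?b b (\<phi> b) ?pg) (\<phi> a)"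
        unfolding conj_def
        using category_assoc[OF D obs(2)[OF a] a obs(2)[OF b] b \<phi>[OF a] pg \<phi>[OF b]] .
      also have "Cmp D a ?b b (\<phi> b) ?pg = g"
        using category_assoc[OF D a b obs(2)[OF b] b g \<psi>[OF b] \<phi>[OF b]] \<phi>\<psi>[OF b]
          category_idl[OF D a b g] by simp
      finally show "Cmp D (fob (comp_functor F GG) a) (fob (comp_functor F GG) b) (fob id_functor b)
          (\<phi> b) (far (comp_functor F GG) a b g) =
        Cmp D (fob (comp_functor F GG) a) (fob id_functor a) (fob id_functor b)
          (far id_functor a b g) (\<phi> a)"
        using FL[OF G[OF a] G[OF b] conj[OF a b g]]
        by (simp add: id_functor_def comp_functor_def GG_def)
    qed
    show "is_iso_arrow D (fob (comp_functor F GG) d) (fob id_functor d) (\<phi> d)" if d: "d \<in> Ob D" for d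
      unfolding is_iso_arrow_def using \<phi>[OF d] \<psi>[OF d] \<phi>\<psi>[OF d] \<psi>\<phi>[OF d]
      by (auto simp: id_functor_def comp_functor_def GG_def)
  qed
  ultimately show ?thesis unfolding is_equivalence_def using F by blast
qed


section \<open>Limits of sets and the restricted Yoneda functor\<close>

lemma is_functor_comp:
  assumes F: "is_functor C D F" and G: "is_functor D E G"
  shows "is_functor C E (comp_functor G F)"
  by (rule is_functorI)
     (simp_all add: comp_functor_def functor_cats[OF F] functor_cats[OF G] functor_ob[OF F]
       functor_ob[OF G] functor_ar[OF F] functor_ar[OF G] functor_idn[OF F] functor_idn[OF G]
       functor_cmp[OF F] functor_cmp[OF G])

lemma is_functor_op:
  assumes F: "is_functor C D F"
  shows "is_functor (op_cat C) (op_cat D) (op_functor F)"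
proof (rule is_functorI)
  show "is_category (op_cat C)" "is_category (op_cat D)"
    using functor_cats[OF F] is_category_op by auto
qed (simp_all add: op_functor_def op_cat_def functor_ob[OF F] functor_ar[OF F]
       functor_idn[OF F] functor_cmp[OF F])

lemma full_subcat_simps [simp]:
  "Ob (full_subcat C X) = Ob C \<inter> X" "Hom (full_subcat C X) = Hom C"
  "Idn (full_subcat C X) = Idn C" "Cmp (full_subcat C X) = Cmp C"
  by (simp_all add: full_subcat_def)

lemma op_cat_simps [simp]:
  "Ob (op_cat C) = Ob C" "Hom (op_cat C) a b = Hom C b a"
  "Idn (op_cat C) = Idn C" "Cmp (op_cat C) a b c g f = Cmp C c b a f g"
  by (simp_all add: op_cat_def)

lemma set_cat_simps [simp]:
  "Ob (set_cat u) = {S. small u S}" "Hom (set_cat u) S T = S \<rightarrow>\<^sub>E T"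
  "Idn (set_cat u) S = (\<lambda>x\<in>S. x)" "Cmp (set_cat u) S T V g f = compose S g f"
  by (simp_all add: set_cat_def)

lemma functor_cat_simps [simp]:
  "Ob (functor_cat C D) = {F. is_functor C D F}"
  "Hom (functor_cat C D) F G = {\<eta> \<in> extensional (Ob C). is_nat_trans C D F G \<eta>}"
  "Idn (functor_cat C D) F = (\<lambda>a\<in>Ob C. Idn D (fob F a))"
  "Cmp (functor_cat C D) F G H \<beta> \<alpha> =
     (\<lambda>a\<in>Ob C. Cmp D (fob F a) (fob G a) (fob H a) (\<beta> a) (\<alpha> a))"
  by (simp_all add: functor_cat_def)

text \<open>An element of a limit is a map out of a one-point set, so uniqueness of mediating maps
  is uniqueness of elements. Taking \<open>x\<close> itself as the point makes the singleton small,
  as a subset of \<open>c\<close>.\<close>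

lemma set_limit_eq:
  assumes lim: "is_limit J (set_cat u) D c \<pi>" and x: "x \<in> c" and y: "y \<in> c"
    and eq: "\<And>j. j \<in> Ob J \<Longrightarrow> \<pi> j x = \<pi> j y"
  shows "x = y"
proof -
  have cone: "is_cone J (set_cat u) D c \<pi>" using lim unfolding is_limit_def by blast
  let ?p = "\<lambda>j. \<lambda>z\<in>{x}. \<pi> j x"
  have mem: "\<pi> j x \<in> fob D j" if "j \<in> Ob J" for j
    using cone x that unfolding is_cone_def by auto
  have "is_cone J (set_cat u) D {x} ?p"
    unfolding is_cone_def
  proof (intro conjI ballI)
    show "{x} \<in> Ob (set_cat u)"
      using cone small_subset[of u c "{x}"] x unfolding is_cone_def by auto
    show "?p j \<in> Hom (set_cat u) {x} (fob D j)" if "j \<in> Ob J" for j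
      using mem[OF that] by (auto simp: extensional_def)
    fix i j v assume ij: "i \<in> Ob J" "j \<in> Ob J" "v \<in> Hom J i j"
    then have "compose c (far D i j v) (\<pi> i) = \<pi> j" using cone unfolding is_cone_def by auto
    then have "far D i j v (\<pi> i x) = \<pi> j x" using x by (metis compose_eq)
    then show "Cmp (set_cat u) {x} (fob D i) (fob D j) (far D i j v) (?p i) = ?p j"
      by (auto simp: compose_def fun_eq_iff)
  qed
  then have ex1: "\<exists>!h. h \<in> Hom (set_cat u) {x} c \<and>
      (\<forall>j\<in>Ob J. Cmp (set_cat u) {x} c (fob D j) (\<pi> j) h = ?p j)"
    using lim unfolding is_limit_def by blast
  have "(\<lambda>z\<in>{x}. x) \<in> Hom (set_cat u) {x} c \<and>
      (\<forall>j\<in>Ob J. Cmp (set_cat u) {x} c (fob D j) (\<pi> j) (\<lambda>z\<in>{x}. x) = ?p j)"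
    using x by (auto simp: compose_def fun_eq_iff)
  moreover have "(\<lambda>z\<in>{x}. y) \<in> Hom (set_cat u) {x} c \<and>
      (\<forall>j\<in>Ob J. Cmp (set_cat u) {x} c (fob D j) (\<pi> j) (\<lambda>z\<in>{x}. y) = ?p j)"
    using y eq by (auto simp: compose_def fun_eq_iff)
  ultimately have "(\<lambda>z\<in>{x}. x) = (\<lambda>z\<in>{x}. y)" using ex1 by blast
  then show ?thesis by (metis restrict_apply' singletonI)
qed

text \<open>A compatible family is a cone from a one-point set. No element of \<open>c\<close> is at
  hand yet, so the point is an arbitrary element of the type, and its singleton is small by
  countability.\<close>

lemma set_limit_ex:
  fixes D :: "('j, 'k, 's set, 's \<Rightarrow> 's) funct"
  assumes inacc: "inaccessible TYPE('u)" and lim: "is_limit J (set_cat TYPE('u)) D c \<pi>"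
    and y: "\<And>j. j \<in> Ob J \<Longrightarrow> y j \<in> fob D j"
    and compat: "\<And>i j v. i \<in> Ob J \<Longrightarrow> j \<in> Ob J \<Longrightarrow> v \<in> Hom J i j \<Longrightarrow> far D i j v (y i) = y j"
  shows "\<exists>x\<in>c. \<forall>j\<in>Ob J. \<pi> j x = y j"
proof -
  let ?s = "undefined :: 's"
  let ?p = "\<lambda>j. \<lambda>z\<in>{?s}. y j"
  have "is_cone J (set_cat TYPE('u)) D {?s} ?p"
    unfolding is_cone_def
  proof (intro conjI ballI)
    show "{?s} \<in> Ob (set_cat TYPE('u))" using small_countable[OF inacc, of "{?s}"] by simp
  qed (use y compat in \<open>auto simp: compose_def fun_eq_iff extensional_def\<close>)
  then obtain h where h: "h \<in> {?s} \<rightarrow>\<^sub>E c"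
      "\<forall>j\<in>Ob J. compose {?s} (\<pi> j) h = ?p j"
    using lim unfolding is_limit_def by (auto dest!: spec)
  have "\<pi> j (h ?s) = y j" if "j \<in> Ob J" for j
    using h(2) that by (metis compose_eq restrict_apply' singletonI)
  then show ?thesis using h(1) by auto
qed

text \<open>Preservation of colimits is stated for index categories over the type of the universe only;
  transporting along injections extends it to all small index categories.\<close>

lemma takes_colimits_to_limits_transport:
  fixes J :: "('j, 'k) category" and C :: "('o, 'm) category"
    and P :: "('o, 'm, 's set, 's \<Rightarrow> 's) funct"
  assumes P: "takes_colimits_to_limits TYPE('u) C X P"
    and J: "small_category TYPE('u) J" and D: "is_functor J (full_subcat C X) D"
    and c: "c \<in> Ob (full_subcat C X)" and colim: "is_colimit J C D c \<iota>"
  obtains J' :: "('u, 'u) category" and go fo :: "_" and D'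
  where "is_limit (op_cat J') (set_cat TYPE('u)) (comp_functor P (op_functor D'))
          (fob P c) (\<lambda>j. far P c (fob D' j) (\<iota> (go j)))"
    and "Ob J' = fo ` Ob J" "\<And>j. j \<in> Ob J \<Longrightarrow> go (fo j) = j"
    and "\<And>j. fob D' j = fob D (go j)"
    and "\<And>i j v. i \<in> Ob J' \<Longrightarrow> j \<in> Ob J' \<Longrightarrow> v \<in> Hom J' i j \<Longrightarrow>
           \<exists>w\<in>Hom J (go i) (go j). far D' i j v = far D (go i) (go j) w"
proof -
  have catJ: "is_category J" using J unfolding small_category_def by blast
  obtain fo :: "'j \<Rightarrow> 'u" where fo: "inj_on fo (Ob J)"
    using J small_inj unfolding small_category_def by blast
  have "\<forall>a b. \<exists>f :: 'k \<Rightarrow> 'u. a \<in> Ob J \<longrightarrow> b \<in> Ob J \<longrightarrow> inj_on f (Hom J a b)"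
    using J small_inj unfolding small_category_def by metis
  \<comment> \<open>Arrows are coded separately for each pair of objects: hom-sets may overlap, and
    a code is only ever decoded relative to its source and target.\<close>
  then obtain fa :: "'j \<Rightarrow> 'j \<Rightarrow> 'k \<Rightarrow> 'u"
    where fa: "\<And>a b. a \<in> Ob J \<Longrightarrow> b \<in> Ob J \<Longrightarrow> inj_on (fa a b) (Hom J a b)" by metis
  define go where "go = inv_into (Ob J) fo"
  define ga where "ga a b = inv_into (Hom J a b) (fa a b)" for a b
  have go: "go (fo j) = j" if "j \<in> Ob J" for j
    unfolding go_def using fo that by (rule inv_into_f_f)
  have ga: "ga a b (fa a b v) = v" if "a \<in> Ob J" "b \<in> Ob J" "v \<in> Hom J a b" for a b v
    unfolding ga_def using fa[OF that(1,2)] that(3) by (rule inv_into_f_f)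
  define J' where "J' = \<lparr>Ob = fo ` Ob J, Hom = (\<lambda>a b. fa (go a) (go b) ` Hom J (go a) (go b)),
    Idn = (\<lambda>a. fa (go a) (go a) (Idn J (go a))),
    Cmp = (\<lambda>a b c g f. fa (go a) (go c)
      (Cmp J (go a) (go b) (go c) (ga (go b) (go c) g) (ga (go a) (go b) f)))\<rparr>"
  have obJ': "go a \<in> Ob J" if "a \<in> Ob J'" for a using that go by (auto simp: J'_def)
  define D' :: "('u, 'u, 'o, 'm) funct" where
    "D' = \<lparr>fob = (\<lambda>a. fob D (go a)), far = (\<lambda>a b f. far D (go a) (go b) (ga (go a) (go b) f))\<rparr>"
  have catJ': "is_category J'"
    by (rule is_categoryI)
       (auto simp: J'_def go ga category_idn[OF catJ] category_cmp[OF catJ] category_idl[OF catJ]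
         category_idr[OF catJ] category_assoc[OF catJ])
  have "small_category TYPE('u) J'"
    unfolding small_category_def
  proof (intro conjI ballI)
    show "small TYPE('u) (Ob J')"
      using J unfolding small_category_def by (simp add: J'_def small_image)
    show "small TYPE('u) (Hom J' a b)" if "a \<in> Ob J'" "b \<in> Ob J'" for a b
      using J obJ'[OF that(1)] obJ'[OF that(2)] unfolding small_category_def
      by (simp add: J'_def small_image)
  qed (rule catJ')
  moreover have D': "is_functor J' E D'" if E: "is_functor J E D" for E
  proof (rule is_functorI[OF catJ'])
    show "is_category E" using E functor_cats by blast
  qed (auto simp: J'_def D'_def go ga category_idn[OF catJ] category_cmp[OF catJ] functor_ob[OF E]
        functor_ar[OF E] functor_idn[OF E] functor_cmp[OF E])
  moreover have "is_colimit J' C D' c (\<lambda>j. \<iota> (go j))"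
    unfolding is_colimit_def
  proof (intro conjI allI impI)
    show "is_functor J' C D'" using D' colim unfolding is_colimit_def by blast
    show "is_cocone J' C D' c (\<lambda>j. \<iota> (go j))"
      using colim unfolding is_colimit_def is_cocone_def
      by (auto simp: J'_def D'_def go ga)
    fix c' \<iota>' assume cc: "is_cocone J' C D' c' \<iota>'"
    have "is_cocone J C D c' (\<lambda>j. \<iota>' (fo j))"
      unfolding is_cocone_def
    proof (intro conjI ballI)
      show "c' \<in> Ob C" using cc unfolding is_cocone_def by blast
      show "\<iota>' (fo j) \<in> Hom C (fob D j) c'" if "j \<in> Ob J" for j
        using cc that unfolding is_cocone_def by (auto simp: J'_def D'_def go)
      fix i j v assume ij: "i \<in> Ob J" "j \<in> Ob J" and v: "v \<in> Hom J i j"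
      have "fa i j v \<in> Hom J' (fo i) (fo j)" "fo i \<in> Ob J'" "fo j \<in> Ob J'"
        using ij v by (auto simp: J'_def go)
      then have "Cmp C (fob D' (fo i)) (fob D' (fo j)) c' (\<iota>' (fo j))
          (far D' (fo i) (fo j) (fa i j v)) = \<iota>' (fo i)"
        using cc unfolding is_cocone_def by blast
      then show "Cmp C (fob D i) (fob D j) c' (\<iota>' (fo j)) (far D i j v) = \<iota>' (fo i)"
        using ij v by (simp add: D'_def go ga)
    qed
    then have "\<exists>!h. h \<in> Hom C c c' \<and> (\<forall>j\<in>Ob J. Cmp C (fob D j) c c' h (\<iota> j) = \<iota>' (fo j))"
      using colim unfolding is_colimit_def by blast
    moreover have "(\<forall>j\<in>Ob J'. Cmp C (fob D' j) c c' h (\<iota> (go j)) = \<iota>' j) \<longleftrightarrow>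
        (\<forall>j\<in>Ob J. Cmp C (fob D j) c c' h (\<iota> j) = \<iota>' (fo j))" for h
      by (auto simp: J'_def D'_def go)
    ultimately show "\<exists>!h. h \<in> Hom C c c' \<and>
        (\<forall>j\<in>Ob J'. Cmp C (fob D' j) c c' h (\<iota> (go j)) = \<iota>' j)"
      by simp
  qed
  ultimately have "is_limit (op_cat J') (set_cat TYPE('u)) (comp_functor P (op_functor D'))
          (fob P c) (\<lambda>j. far P c (fob D' j) (\<iota> (go j)))"
    using P D c unfolding takes_colimits_to_limits_def by blast
  moreover have "\<exists>w\<in>Hom J (go i) (go j). far D' i j v = far D (go i) (go j) w"
    if "i \<in> Ob J'" "j \<in> Ob J'" "v \<in> Hom J' i j" for i j v
    using that by (auto simp: J'_def D'_def go ga)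
  ultimately show thesis
    using that[of J' D' go fo] go by (simp add: J'_def D'_def)
qed

text \<open>This and the next lemma are the form in which preservation of colimits is used: the
  elements of \<open>P c\<close> correspond to the compatible families on the diagram.\<close>

lemma colimit_elements_eq:
  fixes J :: "('j, 'k) category"
  assumes P: "takes_colimits_to_limits TYPE('u) C X P"
    and J: "small_category TYPE('u) J" "is_functor J (full_subcat C X) D"
      "c \<in> Ob (full_subcat C X)" "is_colimit J C D c \<iota>"
    and x: "x \<in> fob P c" and y: "y \<in> fob P c"
    and eq: "\<And>j. j \<in> Ob J \<Longrightarrow> far P c (fob D j) (\<iota> j) x = far P c (fob D j) (\<iota> j) y"
  shows "x = y"
proof -
  obtain J' :: "('u, 'u) category" and go fo D'
    where lim: "is_limit (op_cat J') (set_cat TYPE('u)) (comp_functor P (op_functor D'))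
          (fob P c) (\<lambda>j. far P c (fob D' j) (\<iota> (go j)))"
    and o: "Ob J' = fo ` Ob J" "\<And>j. j \<in> Ob J \<Longrightarrow> go (fo j) = j" "\<And>j. fob D' j = fob D (go j)"
    by (rule takes_colimits_to_limits_transport[OF P J]) blast
  show ?thesis by (rule set_limit_eq[OF lim x y]) (use o eq in auto)
qed

lemma colimit_elements_ex:
  fixes J :: "('j, 'k) category"
  assumes inacc: "inaccessible TYPE('u)" and P: "takes_colimits_to_limits TYPE('u) C X P"
    and J: "small_category TYPE('u) J" "is_functor J (full_subcat C X) D"
      "c \<in> Ob (full_subcat C X)" "is_colimit J C D c \<iota>"
    and y: "\<And>j. j \<in> Ob J \<Longrightarrow> y j \<in> fob P (fob D j)"
    and compat: "\<And>i j v. i \<in> Ob J \<Longrightarrow> j \<in> Ob J \<Longrightarrow> v \<in> Hom J i j \<Longrightarrow>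
      far P (fob D j) (fob D i) (far D i j v) (y j) = y i"
  shows "\<exists>x\<in>fob P c. \<forall>j\<in>Ob J. far P c (fob D j) (\<iota> j) x = y j"
proof -
  obtain J' :: "('u, 'u) category" and go fo D'
    where lim: "is_limit (op_cat J') (set_cat TYPE('u)) (comp_functor P (op_functor D'))
          (fob P c) (\<lambda>j. far P c (fob D' j) (\<iota> (go j)))"
    and o: "Ob J' = fo ` Ob J" "\<And>j. j \<in> Ob J \<Longrightarrow> go (fo j) = j" "\<And>j. fob D' j = fob D (go j)"
    and w: "\<And>i j v. i \<in> Ob J' \<Longrightarrow> j \<in> Ob J' \<Longrightarrow> v \<in> Hom J' i j \<Longrightarrow>
           \<exists>w\<in>Hom J (go i) (go j). far D' i j v = far D (go i) (go j) w"
    by (rule takes_colimits_to_limits_transport[OF P J]) blast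
  have go: "go j \<in> Ob J" if "j \<in> Ob J'" for j using that o by auto
  have "\<exists>x\<in>fob P c. \<forall>j\<in>Ob (op_cat J'). far P c (fob D' j) (\<iota> (go j)) x = y (go j)"
  proof (rule set_limit_ex[OF inacc lim])
    show "y (go j) \<in> fob (comp_functor P (op_functor D')) j" if "j \<in> Ob (op_cat J')" for j
      using y[OF go] that by (simp add: comp_functor_def op_functor_def o(3))
    fix i j v assume ij: "i \<in> Ob (op_cat J')" "j \<in> Ob (op_cat J')" "v \<in> Hom (op_cat J') i j"
    then obtain w where "w \<in> Hom J (go j) (go i)" "far D' j i v = far D (go j) (go i) w"
      using w[of j i v] by auto
    then show "far (comp_functor P (op_functor D')) i j v (y (go i)) = y (go j)"
      using compat[OF go go] ij by (simp add: comp_functor_def op_functor_def o(3))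
  qed
  then show ?thesis using o by force
qed

section \<open>Representable functors and the restricted Yoneda functor\<close>

context
  fixes C :: "('o, 'm) category" and X :: "'o set"
  assumes cat: "is_category C"
    and locally_small: "\<And>a b. a \<in> Ob C \<Longrightarrow> b \<in> Ob C \<Longrightarrow> small TYPE('u) (Hom C a b)"
begin

lemma is_functor_hom_into:
  assumes c: "c \<in> Ob C"
  shows "is_functor (op_cat (full_subcat C X)) (set_cat TYPE('u)) (hom_into C c)"
proof (rule is_functorI)
  show "is_category (op_cat (full_subcat C X))"
    by (intro is_category_op is_category_full_subcat cat)
qed (auto simp: is_category_set_cat hom_into_def locally_small c compose_def fun_eq_iff
      category_cmp[OF cat] category_idr[OF cat] category_assoc[OF cat])

text \<open>Evaluated at a point \<open>s\<close>, a cone over the sets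
  \<open>Hom C (fob D j) c\<close> is a cocone from \<open>D\<close> to \<open>c\<close>. The
  mediating map is therefore obtained point by point from the universal property of the colimit
  \<open>k\<close>.\<close>

lemma takes_colimits_to_limits_hom_into:
  assumes c: "c \<in> Ob C"
  shows "takes_colimits_to_limits TYPE('u) C X (hom_into C c)"
  unfolding takes_colimits_to_limits_def
proof (intro allI impI, elim conjE)
  fix J :: "('u, 'u) category" and D k \<iota>
  assume D: "is_functor J (full_subcat C X) D" and k: "k \<in> Ob (full_subcat C X)"
    and colim: "is_colimit J C D k \<iota>"
  have cocone: "is_cocone J C D k \<iota>" using colim unfolding is_colimit_def by blast
  have obD: "fob D j \<in> Ob C" if "j \<in> Ob J" for j using functor_ob[OF D that] by simp
  have arD: "far D i j v \<in> Hom C (fob D i) (fob D j)" if "i \<in> Ob J" "j \<in> Ob J" "v \<in> Hom J i j" for i j v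
    using functor_ar[OF D that] by simp
  have \<iota>: "\<iota> j \<in> Hom C (fob D j) k" if "j \<in> Ob J" for j
    using cocone that unfolding is_cocone_def by blast
  let ?T = "comp_functor (hom_into C c) (op_functor D)"
  let ?p = "\<lambda>j. far (hom_into C c) k (fob D j) (\<iota> j)"
  show "is_limit (op_cat J) (set_cat TYPE('u)) ?T (fob (hom_into C c) k) ?p"
    unfolding is_limit_def
  proof (intro conjI allI impI)
    show "is_functor (op_cat J) (set_cat TYPE('u)) ?T"
      by (rule is_functor_comp[OF is_functor_op[OF D] is_functor_hom_into[OF c]])
    have "compose (Hom C k c) (\<lambda>g\<in>Hom C (fob D j) c. Cmp C (fob D i) (fob D j) c g (far D i j v))
        (\<lambda>g\<in>Hom C k c. Cmp C (fob D j) k c g (\<iota> j)) =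
        (\<lambda>g\<in>Hom C k c. Cmp C (fob D i) k c g (\<iota> i))"
      if ij: "i \<in> Ob J" "j \<in> Ob J" and v: "v \<in> Hom J i j" for i j v
    proof -
      have "Cmp C (fob D i) (fob D j) c (Cmp C (fob D j) k c g (\<iota> j)) (far D i j v) =
          Cmp C (fob D i) k c g (\<iota> i)" if g: "g \<in> Hom C k c" for g
        using category_assoc[OF cat obD[OF ij(1)] obD[OF ij(2)] _ c arD[OF ij v] \<iota>[OF ij(2)] g] k
          cocone ij v unfolding is_cocone_def by simp
      then show ?thesis
        using category_cmp[OF cat obD[OF ij(2)] _ c \<iota>[OF ij(2)]] k
        by (auto simp: compose_def fun_eq_iff)
    qed
    then show "is_cone (op_cat J) (set_cat TYPE('u)) ?T (fob (hom_into C c) k) ?p"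
      using k c unfolding is_cone_def
      by (auto simp: locally_small hom_into_def comp_functor_def op_functor_def
          intro: category_cmp[OF cat obD _ c \<iota>])
    fix S \<pi> assume cone: "is_cone (op_cat J) (set_cat TYPE('u)) ?T S \<pi>"
    then have \<pi>: "\<pi> j \<in> S \<rightarrow>\<^sub>E Hom C (fob D j) c" if "j \<in> Ob J" for j
      using that unfolding is_cone_def by (auto simp: hom_into_def comp_functor_def op_functor_def)
    have cc: "is_cocone J C D c (\<lambda>j. \<pi> j s)" if s: "s \<in> S" for s
      unfolding is_cocone_def
    proof (intro conjI ballI)
      show "\<pi> j s \<in> Hom C (fob D j) c" if "j \<in> Ob J" for j using \<pi>[OF that] s by auto
      fix i j v assume ij: "i \<in> Ob J" "j \<in> Ob J" "v \<in> Hom J i j"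
      then have "compose S (far ?T j i v) (\<pi> j) = \<pi> i" using cone unfolding is_cone_def by simp
      then have "far ?T j i v (\<pi> j s) = \<pi> i s" using s by (metis compose_eq)
      then show "Cmp C (fob D i) (fob D j) c (\<pi> j s) (far D i j v) = \<pi> i s"
        using PiE_mem[OF \<pi>[OF ij(2)] s] by (simp add: hom_into_def comp_functor_def op_functor_def)
    qed (rule c)
    have ex1: "\<exists>!h. h \<in> Hom C k c \<and> (\<forall>j\<in>Ob J. Cmp C (fob D j) k c h (\<iota> j) = \<pi> j s)"
      if s: "s \<in> S" for s
      using colim cc[OF s] unfolding is_colimit_def by blast
    define H where "H = (\<lambda>s\<in>S. THE h. h \<in> Hom C k c \<and> (\<forall>j\<in>Ob J. Cmp C (fob D j) k c h (\<iota> j) = \<pi> j s))"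
    have H: "H s \<in> Hom C k c" "\<And>j. j \<in> Ob J \<Longrightarrow> Cmp C (fob D j) k c (H s) (\<iota> j) = \<pi> j s"
      if s: "s \<in> S" for s
      using theI'[OF ex1[OF s]] s unfolding H_def by auto
    show "\<exists>!h. h \<in> Hom (set_cat TYPE('u)) S (fob (hom_into C c) k) \<and>
        (\<forall>j\<in>Ob (op_cat J). Cmp (set_cat TYPE('u)) S (fob (hom_into C c) k) (fob ?T j) (?p j) h = \<pi> j)"
    proof (rule ex1I[of _ H])
      have "compose S (?p j) H = \<pi> j" if j: "j \<in> Ob J" for j
      proof
        fix s show "compose S (?p j) H s = \<pi> j s"
          using H(1)[of s] H(2)[of s j] \<pi>[OF j] j
          by (cases "s \<in> S") (auto simp: compose_def hom_into_def PiE_def extensional_def)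
      qed
      then show "H \<in> Hom (set_cat TYPE('u)) S (fob (hom_into C c) k) \<and>
        (\<forall>j\<in>Ob (op_cat J). Cmp (set_cat TYPE('u)) S (fob (hom_into C c) k) (fob ?T j) (?p j) H = \<pi> j)"
        using H(1) by (auto simp: hom_into_def H_def)
      fix h assume h: "h \<in> Hom (set_cat TYPE('u)) S (fob (hom_into C c) k) \<and>
        (\<forall>j\<in>Ob (op_cat J). Cmp (set_cat TYPE('u)) S (fob (hom_into C c) k) (fob ?T j) (?p j) h = \<pi> j)"
      have hS: "h \<in> S \<rightarrow>\<^sub>E Hom C k c" using h by (simp add: hom_into_def)
      show "h = H"
      proof (rule PiE_ext[OF hS])
        show "H \<in> S \<rightarrow>\<^sub>E Hom C k c" using H(1) by (auto simp: H_def)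
        fix s assume s: "s \<in> S"
        have hs: "h s \<in> Hom C k c" using hS s by auto
        have "Cmp C (fob D j) k c (h s) (\<iota> j) = \<pi> j s" if "j \<in> Ob J" for j
        proof -
          have "compose S (?p j) h = \<pi> j" using h that by simp
          then have "?p j (h s) = \<pi> j s" using s by (metis compose_eq)
          then show ?thesis using hs by (simp add: hom_into_def)
        qed
        then show "h s = H s" using ex1[OF s] H[OF s] hs by blast
      qed
    qed
  qed
qed

lemma is_functor_restricted_yoneda:
  "is_functor C (colimit_to_limit_functors TYPE('u) C X) (restricted_yoneda C X)"
proof (rule is_functorI[OF cat])
  have F: "is_category (functor_cat (op_cat (full_subcat C X)) (set_cat TYPE('u)))"
    by (intro is_category_functor_cat is_category_op is_category_full_subcat cat is_category_set_cat)
  then show "is_category (colimit_to_limit_functors TYPE('u) C X)"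
    unfolding colimit_to_limit_functors_def by (rule is_category_full_subcat)
  show "fob (restricted_yoneda C X) a \<in> Ob (colimit_to_limit_functors TYPE('u) C X)"
    if "a \<in> Ob C" for a
    using that is_functor_hom_into takes_colimits_to_limits_hom_into
    by (simp add: restricted_yoneda_def colimit_to_limit_functors_def)
qed (auto simp: restricted_yoneda_def colimit_to_limit_functors_def is_nat_trans_def hom_into_def
      compose_def fun_eq_iff category_cmp[OF cat] category_idl[OF cat] category_assoc[OF cat]
      category_idn[OF cat])

end


section \<open>Omega-categories\<close>

text \<open>The clauses of the definition are derived from this list: composable cells have equal
  boundaries below \<open>n\<close> because these are boundaries of the common
  \<open>n\<close>-boundary, and composability of the nested composites in associativity and
  interchange reduces to that of their factors.\<close>

lemma is_omega_categoryI:
  fixes C :: "'a omega_cat"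
  assumes dd_closed: "\<And>s n x. x \<in> carrier C \<Longrightarrow> dd C s n x \<in> carrier C"
    and cmp_closed: "\<And>n x y. composable C n x y \<Longrightarrow> cmp C n x y \<in> carrier C"
    and ex_dim: "\<And>x. x \<in> carrier C \<Longrightarrow> \<exists>n. dd C Minus n x = x"
    and dd_less: "\<And>s t m n x. x \<in> carrier C \<Longrightarrow> m < n \<Longrightarrow> dd C t m (dd C s n x) = dd C t m x"
    and dd_ge: "\<And>s t m n x. x \<in> carrier C \<Longrightarrow> n \<le> m \<Longrightarrow> dd C t m (dd C s n x) = dd C s n x"
    and idl: "\<And>n x. x \<in> carrier C \<Longrightarrow> cmp C n (dd C Minus n x) x = x"
    and idr: "\<And>n x. x \<in> carrier C \<Longrightarrow> cmp C n x (dd C Plus n x) = x"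
    and cmp_less: "\<And>s m n x y. composable C n x y \<Longrightarrow> m < n \<Longrightarrow> dd C s m (cmp C n x y) = dd C s m x"
    and cmp_minus: "\<And>n x y. composable C n x y \<Longrightarrow> dd C Minus n (cmp C n x y) = dd C Minus n x"
    and cmp_plus: "\<And>n x y. composable C n x y \<Longrightarrow> dd C Plus n (cmp C n x y) = dd C Plus n y"
    and cmp_greater: "\<And>s m n x y. composable C n x y \<Longrightarrow> n < m \<Longrightarrow>
      dd C s m (cmp C n x y) = cmp C n (dd C s m x) (dd C s m y)"
    and assoc: "\<And>n x y z. composable C n x y \<Longrightarrow> composable C n y z \<Longrightarrow>
      cmp C n (cmp C n x y) z = cmp C n x (cmp C n y z)"
    and interchange: "\<And>m n x y x' y'. m < n \<Longrightarrow> composable C n x y \<Longrightarrow> composable C n x' y' \<Longrightarrow>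
      composable C m x x' \<Longrightarrow>
      cmp C m (cmp C n x y) (cmp C n x' y') = cmp C n (cmp C m x x') (cmp C m y y')"
  shows "is_omega_category C"
proof -
  have mem: "x \<in> carrier C" "y \<in> carrier C" "dd C Plus n x = dd C Minus n y"
    if "composable C n x y" for n x y
    using that unfolding composable_def by auto
  have eqd: "dd C s m x = dd C s m y" if c: "composable C n x y" and "m < n" for s m n x y
    using dd_less[OF mem(1)[OF c] \<open>m < n\<close>] dd_less[OF mem(2)[OF c] \<open>m < n\<close>] mem(3)[OF c] by metis
  have "dd C Plus n x = x" if "x \<in> carrier C" "dd C Minus n x = x" for n x
    using dd_ge[OF that(1), of n n Plus Minus] that(2) by simp
  then have dim: "\<forall>x\<in>carrier C. \<exists>n. dd C Minus n x = x \<and> dd C Plus n x = x"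
    using ex_dim by blast
  have less: "dd C s m (cmp C n x y) = dd C s m x \<and> dd C s m x = dd C s m y \<and>
      composable C n (dd C s m x) (dd C s m y) \<and>
      dd C s m y = cmp C n (dd C s m x) (dd C s m y)"
    if c: "composable C n x y" and m: "m < n" for s m n x y
  proof -
    have e: "dd C t n (dd C s m x) = dd C s m x" for t
      using dd_ge[OF mem(1)[OF c]] m by simp
    have "cmp C n (dd C s m x) (dd C s m x) = dd C s m x"
      using idl[OF dd_closed[OF mem(1)[OF c]], of n s m] e by simp
    then show ?thesis
      using cmp_less[OF c m] eqd[OF c m, of s] e dd_closed mem[OF c] by (simp add: composable_def)
  qed
  have greater: "composable C n (dd C s m x) (dd C s m y) \<and>
      dd C s m (cmp C n x y) = cmp C n (dd C s m x) (dd C s m y)"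
    if c: "composable C n x y" and m: "n < m" for s m n x y
    using cmp_greater[OF c m] dd_less[OF mem(1)[OF c] m] dd_less[OF mem(2)[OF c] m] mem[OF c] dd_closed
    by (simp add: composable_def)
  have assoc': "cmp C n (cmp C n x y) z = cmp C n x (cmp C n y z)"
    if "(composable C n x y \<and> composable C n (cmp C n x y) z) \<or>
        (composable C n y z \<and> composable C n x (cmp C n y z))" for n x y z
  proof -
    have "composable C n x y \<and> composable C n y z"
      using that cmp_plus[of n x y] cmp_minus[of n y z] by (auto simp: composable_def)
    then show ?thesis using assoc by blast
  qed
  have interchange': "cmp C m (cmp C n x y) (cmp C n x' y') = cmp C n (cmp C m x x') (cmp C m y y')"
    if "m < n" "composable C n x y" "composable C n x' y'"
      "composable C m (cmp C n x y) (cmp C n x' y')" for m n x y x' y'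
  proof (rule interchange[OF that(1-3)])
    show "composable C m x x'"
      using that(4) cmp_less[OF that(2,1)] cmp_less[OF that(3,1)] mem[OF that(2)] mem[OF that(3)]
      by (simp add: composable_def)
  qed
  have comps: "(\<forall>s m. m < n \<longrightarrow>
           dd C s m (cmp C n x y) = dd C s m x \<and> dd C s m x = dd C s m y \<and>
           composable C n (dd C s m x) (dd C s m y) \<and>
           dd C s m y = cmp C n (dd C s m x) (dd C s m y)) \<and>
        dd C Minus n (cmp C n x y) = dd C Minus n x \<and>
        dd C Plus n (cmp C n x y) = dd C Plus n y \<and>
        (\<forall>s m. n < m \<longrightarrow>
           composable C n (dd C s m x) (dd C s m y) \<and>
           dd C s m (cmp C n x y) = cmp C n (dd C s m x) (dd C s m y))"
    if c: "composable C n x y" for n x y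
  proof (intro conjI)
    show "dd C Minus n (cmp C n x y) = dd C Minus n x" "dd C Plus n (cmp C n x y) = dd C Plus n y"
      by (rule cmp_minus[OF c], rule cmp_plus[OF c])
  qed (intro allI impI, rule less[OF c], assumption, intro allI impI, rule greater[OF c], assumption)
  have dd_dd: "dd C t m (dd C s n x) = (if m < n then dd C t m x else dd C s n x)"
    if "x \<in> carrier C" for s t m n x
    using dd_less[OF that] dd_ge[OF that] by simp
  show ?thesis
    unfolding is_omega_category_def
  proof (intro conjI)
    show "\<forall>s n. \<forall>x\<in>carrier C. dd C s n x \<in> carrier C" using dd_closed by simp
    show "\<forall>n x y. composable C n x y \<longrightarrow> cmp C n x y \<in> carrier C" using cmp_closed by simp
    show "\<forall>s t m n. \<forall>x\<in>carrier C. dd C t m (dd C s n x) =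
        (if m < n then dd C t m x else dd C s n x)" using dd_dd by simp
    show "\<forall>n. \<forall>x\<in>carrier C. cmp C n (dd C Minus n x) x = x \<and> cmp C n x (dd C Plus n x) = x"
      using idl idr by simp
  qed (rule dim, (intro allI impI, rule comps, assumption),
    (intro allI impI, rule assoc', assumption), (intro allI impI, elim conjE, rule interchange', assumption+))
qed

lemma is_omega_categoryD:
  assumes "is_omega_category C"
  shows "\<forall>s n. \<forall>x\<in>carrier C. dd C s n x \<in> carrier C"
    "\<forall>n x y. composable C n x y \<longrightarrow> cmp C n x y \<in> carrier C"
    "\<forall>x\<in>carrier C. \<exists>n. dd C Minus n x = x \<and> dd C Plus n x = x"
    "\<forall>s t m n. \<forall>x\<in>carrier C.
        dd C t m (dd C s n x) = (if m < n then dd C t m x else dd C s n x)"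
    "\<forall>n. \<forall>x\<in>carrier C.
        cmp C n (dd C Minus n x) x = x \<and> cmp C n x (dd C Plus n x) = x"
    "\<forall>n x y. composable C n x y \<longrightarrow>
        (\<forall>s m. m < n \<longrightarrow>
           dd C s m (cmp C n x y) = dd C s m x \<and>
           dd C s m x = dd C s m y \<and>
           composable C n (dd C s m x) (dd C s m y) \<and>
           dd C s m y = cmp C n (dd C s m x) (dd C s m y)) \<and>
        dd C Minus n (cmp C n x y) = dd C Minus n x \<and>
        dd C Plus n (cmp C n x y) = dd C Plus n y \<and>
        (\<forall>s m. n < m \<longrightarrow>
           composable C n (dd C s m x) (dd C s m y) \<and>
           dd C s m (cmp C n x y) = cmp C n (dd C s m x) (dd C s m y))"
    "\<forall>n x y z.
        (composable C n x y \<and> composable C n (cmp C n x y) z) \<or>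
        (composable C n y z \<and> composable C n x (cmp C n y z)) \<longrightarrow>
        cmp C n (cmp C n x y) z = cmp C n x (cmp C n y z)"
    "\<forall>m n x y x' y'.
        m < n \<and> composable C n x y \<and> composable C n x' y' \<and>
        composable C m (cmp C n x y) (cmp C n x' y') \<longrightarrow>
        cmp C m (cmp C n x y) (cmp C n x' y') = cmp C n (cmp C m x x') (cmp C m y y')"
  by (insert assms[unfolded is_omega_category_def], elim conjE, assumption)+

locale omega_category =
  fixes C :: "'a omega_cat"
  assumes omega: "is_omega_category C"
begin

lemma dd_closed [simp]: "x \<in> carrier C \<Longrightarrow> dd C s n x \<in> carrier C"
  using is_omega_categoryD(1)[OF omega] by blast

lemma cmp_closed: "composable C n x y \<Longrightarrow> cmp C n x y \<in> carrier C"
  using is_omega_categoryD(2)[OF omega] by blast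

lemma ex_dim: "x \<in> carrier C \<Longrightarrow> \<exists>n. dd C Minus n x = x"
  using is_omega_categoryD(3)[OF omega] by blast

lemma dd_dd: "x \<in> carrier C \<Longrightarrow> dd C t m (dd C s n x) = (if m < n then dd C t m x else dd C s n x)"
  using is_omega_categoryD(4)[OF omega] by blast

lemma dd_less: "x \<in> carrier C \<Longrightarrow> m < n \<Longrightarrow> dd C t m (dd C s n x) = dd C t m x"
  by (simp add: dd_dd)

lemma dd_ge: "x \<in> carrier C \<Longrightarrow> n \<le> m \<Longrightarrow> dd C t m (dd C s n x) = dd C s n x"
  by (simp add: dd_dd)

lemma idl: "x \<in> carrier C \<Longrightarrow> cmp C n (dd C Minus n x) x = x"
  using is_omega_categoryD(5)[OF omega] by blast

lemma idr: "x \<in> carrier C \<Longrightarrow> cmp C n x (dd C Plus n x) = x"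
  using is_omega_categoryD(5)[OF omega] by blast

lemma cmp_less: "composable C n x y \<Longrightarrow> m < n \<Longrightarrow> dd C s m (cmp C n x y) = dd C s m x"
  using is_omega_categoryD(6)[OF omega] by blast

lemma dd_less_eq: "composable C n x y \<Longrightarrow> m < n \<Longrightarrow> dd C s m x = dd C s m y"
  using is_omega_categoryD(6)[OF omega] by blast

lemma cmp_minus: "composable C n x y \<Longrightarrow> dd C Minus n (cmp C n x y) = dd C Minus n x"
  using is_omega_categoryD(6)[OF omega] by blast

lemma cmp_plus: "composable C n x y \<Longrightarrow> dd C Plus n (cmp C n x y) = dd C Plus n y"
  using is_omega_categoryD(6)[OF omega] by blast

lemma cmp_greater: "composable C n x y \<Longrightarrow> n < m \<Longrightarrow>
    dd C s m (cmp C n x y) = cmp C n (dd C s m x) (dd C s m y)"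
  using is_omega_categoryD(6)[OF omega] by blast

lemma composable_dd: "composable C n x y \<Longrightarrow> n < m \<Longrightarrow> composable C n (dd C s m x) (dd C s m y)"
  using is_omega_categoryD(6)[OF omega] by blast

lemma composable_in: "composable C n x y \<Longrightarrow> x \<in> carrier C \<and> y \<in> carrier C"
  unfolding composable_def by blast

lemma assoc:
  assumes "composable C n x y" "composable C n y z"
  shows "cmp C n (cmp C n x y) z = cmp C n x (cmp C n y z)"
proof -
  have "composable C n (cmp C n x y) z"
    using assms cmp_plus[OF assms(1)] cmp_closed[OF assms(1)] unfolding composable_def by simp
  then show ?thesis using assms is_omega_categoryD(7)[OF omega] by blast
qed

lemma interchange:
  assumes "m < n" "composable C n x y" "composable C n x' y'" "composable C m x x'"
  shows "cmp C m (cmp C n x y) (cmp C n x' y') = cmp C n (cmp C m x x') (cmp C m y y')"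
proof -
  have "composable C m (cmp C n x y) (cmp C n x' y')"
    using assms(4) cmp_less[OF assms(2,1)] cmp_less[OF assms(3,1)]
      cmp_closed[OF assms(2)] cmp_closed[OF assms(3)] unfolding composable_def by simp
  then show ?thesis using assms is_omega_categoryD(8)[OF omega] by blast
qed

lemma cells_carrier: "x \<in> cells C n \<Longrightarrow> x \<in> carrier C"
  unfolding cells_def by blast

lemma cells_dd: "x \<in> cells C n \<Longrightarrow> n \<le> m \<Longrightarrow> dd C s m x = x"
  using dd_ge[of x n m s Minus] unfolding cells_def by auto

lemma cellsI: "x \<in> carrier C \<Longrightarrow> dd C s n x = x \<Longrightarrow> x \<in> cells C n"
  using dd_ge[of x n n Minus s] unfolding cells_def by auto

lemma cells_mono: "n \<le> m \<Longrightarrow> x \<in> cells C n \<Longrightarrow> x \<in> cells C m"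
  using cells_dd[of x n m Minus] unfolding cells_def by auto

lemma dd_cells: "x \<in> carrier C \<Longrightarrow> dd C s n x \<in> cells C n"
  by (rule cellsI[of _ Minus]) (simp_all add: dd_ge)

lemma dd_cells': "x \<in> cells C m \<Longrightarrow> dd C s n x \<in> cells C m"
proof (cases "m \<le> n")
  case True then show "x \<in> cells C m \<Longrightarrow> dd C s n x \<in> cells C m" using cells_dd by simp
next
  case False then show "x \<in> cells C m \<Longrightarrow> dd C s n x \<in> cells C m"
    using cells_mono[OF _ dd_cells] cells_carrier by simp
qed

lemma ex_cells: "x \<in> carrier C \<Longrightarrow> \<exists>n. x \<in> cells C n"
  using ex_dim unfolding cells_def by blast

text \<open>A cell of dimension at most \<open>m\<close> is its own source and target in dimension
  \<open>m\<close>. Composition along \<open>m\<close> then only composes such a cell with itself,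
  which is why proper composites are those with \<open>m < n\<close>.\<close>

lemma cmp_cells_trivial:
  assumes "composable C m x y" "x \<in> cells C n" "y \<in> cells C n" "n \<le> m"
  shows "y = x" "cmp C m x y = x"
proof -
  show "y = x" using assms cells_dd[of x n m Plus] cells_dd[of y n m Minus]
    by (simp add: composable_def)
  then show "cmp C m x y = x"
    using idr[of x m] cells_dd[OF assms(2,4)] cells_carrier[OF assms(2)] by simp
qed

lemma cmp_cells:
  assumes "composable C m x y" "x \<in> cells C n" "y \<in> cells C n"
  shows "cmp C m x y \<in> cells C n"
proof (cases "n \<le> m")
  case True then show ?thesis using cmp_cells_trivial[OF assms] assms(2) by simp
next
  case False
  then have "dd C Minus n (cmp C m x y) = cmp C m x y"
    using cmp_greater[OF assms(1), of n Minus] assms(2,3) by (simp add: cells_def)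
  then show ?thesis using cmp_closed[OF assms(1)] by (simp add: cells_def)
qed

end

lemma omega_homD:
  assumes "f \<in> omega_hom C D"
  shows "f \<in> carrier C \<rightarrow>\<^sub>E carrier D" "x \<in> carrier C \<Longrightarrow> f x \<in> carrier D"
    "x \<in> carrier C \<Longrightarrow> f (dd C s n x) = dd D s n (f x)"
    "composable C n x y \<Longrightarrow> f (cmp C n x y) = cmp D n (f x) (f y)"
    "composable C n x y \<Longrightarrow> composable D n (f x) (f y)"
    "x \<in> cells C n \<Longrightarrow> f x \<in> cells D n"
proof -
  show PE: "f \<in> carrier C \<rightarrow>\<^sub>E carrier D" using assms unfolding omega_hom_def by blast
  then show m: "f x \<in> carrier D" if "x \<in> carrier C" for x using that by auto
  show d: "f (dd C s n x) = dd D s n (f x)" if "x \<in> carrier C" for s n x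
    using assms that unfolding omega_hom_def by blast
  show "composable C n x y \<Longrightarrow> f (cmp C n x y) = cmp D n (f x) (f y)"
    using assms unfolding omega_hom_def by blast
  show "composable D n (f x) (f y)" if "composable C n x y"
  proof -
    have "dd C Plus n x = dd C Minus n y" "x \<in> carrier C" "y \<in> carrier C"
      using that unfolding composable_def by auto
    then show ?thesis using d[of x Plus n] d[of y Minus n] m unfolding composable_def by metis
  qed
  show "x \<in> cells C n \<Longrightarrow> f x \<in> cells D n"
    using d[of x Minus n] m[of x] unfolding cells_def by auto
qed

lemma omega_homI:
  assumes "f \<in> extensional (carrier C)" "\<And>x. x \<in> carrier C \<Longrightarrow> f x \<in> carrier D"
    "\<And>s n x. x \<in> carrier C \<Longrightarrow> f (dd C s n x) = dd D s n (f x)"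
    "\<And>n x y. composable C n x y \<Longrightarrow> f (cmp C n x y) = cmp D n (f x) (f y)"
  shows "f \<in> omega_hom C D"
  using assms unfolding omega_hom_def by (auto simp: PiE_def)

lemma omega_hom_compose:
  assumes f: "f \<in> omega_hom A B" and g: "g \<in> omega_hom B C" and A: "is_omega_category A"
  shows "compose (carrier A) g f \<in> omega_hom A C"
proof -
  interpret omega_category A using A by unfold_locales
  show ?thesis
    by (rule omega_homI)
       (auto simp: compose_eq omega_homD[OF f] omega_homD[OF g] cmp_closed dest: composable_in)
qed

lemma omega_hom_id: "is_omega_category A \<Longrightarrow> (\<lambda>x\<in>carrier A. x) \<in> omega_hom A A"
proof -
  assume "is_omega_category A"
  then interpret omega_category A by unfold_locales
  show ?thesis by (rule omega_homI) (auto simp: cmp_closed dest: composable_in)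
qed

lemma omega_Cat_simps [simp]:
  "Ob (omega_Cat :: ('u omega_cat, 'u \<Rightarrow> 'u) category) =
     {C. is_omega_category C \<and> small TYPE('u) (carrier C)}"
  "Hom omega_Cat A B = omega_hom A B" "Idn omega_Cat A = (\<lambda>x\<in>carrier A. x)"
  "Cmp omega_Cat A B C g f = compose (carrier A) g f"
  by (simp_all add: omega_Cat_def)

lemma is_category_omega_Cat: "is_category (omega_Cat :: ('u omega_cat, 'u \<Rightarrow> 'u) category)"
proof (rule is_categoryI)
  fix a b f assume "f \<in> Hom (omega_Cat :: ('u omega_cat, 'u \<Rightarrow> 'u) category) a b"
  then have f: "f \<in> carrier a \<rightarrow>\<^sub>E carrier b" using omega_homD(1) by simp
  show "Cmp omega_Cat a a b f (Idn omega_Cat a) = f" "Cmp omega_Cat a b b (Idn omega_Cat b) f = f"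
    using f by (auto simp: compose_def fun_eq_iff PiE_def extensional_def)
next
  fix a b c d f g h
  assume "f \<in> Hom (omega_Cat :: ('u omega_cat, 'u \<Rightarrow> 'u) category) a b"
  then have f: "f \<in> carrier a \<rightarrow>\<^sub>E carrier b" using omega_homD(1) by simp
  then show "Cmp omega_Cat a c d h (Cmp omega_Cat a b c g f) =
      Cmp omega_Cat a b d (Cmp omega_Cat b c d h g) f"
    by (auto simp: compose_def fun_eq_iff)
qed (auto simp: omega_hom_id omega_hom_compose)

lemma small_omega_hom:
  assumes "inaccessible TYPE('u)" "small TYPE('u) (carrier A)" "small TYPE('u) (carrier B)"
  shows "small TYPE('u) (omega_hom A B)"
  by (rule small_subset[OF small_PiE[OF assms]]) (auto simp: omega_hom_def)


section \<open>Presented omega-categories\<close>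

text \<open>Terms over generators of dimension at most \<open>n\<close>, subject to relations
  \<open>(i, m, j)\<close> standing for \<open>d\<^sup>+\<^sub>m u\<^sub>i = d\<^sup>-\<^sub>m u\<^sub>j\<close>.  A term is well formed if it is related to itself.\<close>

datatype trm = Gen nat | Dt sign nat trm | Ct nat trm trm

instance sign :: countable by countable_datatype
instance trm :: countable by countable_datatype

type_synonym relations = "(nat \<times> nat \<times> nat) set"

text \<open>Whether a composite is defined depends on equality of boundaries, so definedness and
  equality are generated together as one partial equivalence relation. The dimension bound
  \<open>n\<close> enters through \<open>gen_dd\<close> only.\<close>

inductive teq :: "nat \<Rightarrow> nat \<Rightarrow> relations \<Rightarrow> trm \<Rightarrow> trm \<Rightarrow> bool" for n k R where
  gen: "i < k \<Longrightarrow> teq n k R (Gen i) (Gen i)"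
| gen_dd: "i < k \<Longrightarrow> teq n k R (Dt s n (Gen i)) (Gen i)"
| rel: "(i, m, j) \<in> R \<Longrightarrow> i < k \<Longrightarrow> j < k \<Longrightarrow> teq n k R (Dt Plus m (Gen i)) (Dt Minus m (Gen j))"
| symm: "teq n k R t u \<Longrightarrow> teq n k R u t"
| tran: "teq n k R t u \<Longrightarrow> teq n k R u v \<Longrightarrow> teq n k R t v"
| dd: "teq n k R t u \<Longrightarrow> teq n k R (Dt s m t) (Dt s m u)"
| cp: "teq n k R t t' \<Longrightarrow> teq n k R u u' \<Longrightarrow> teq n k R (Dt Plus m t) (Dt Minus m u) \<Longrightarrow>
    teq n k R (Ct m t u) (Ct m t' u')"
| dd_less: "teq n k R t t \<Longrightarrow> m < l \<Longrightarrow> teq n k R (Dt r m (Dt s l t)) (Dt r m t)"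
| dd_ge: "teq n k R t t \<Longrightarrow> l \<le> m \<Longrightarrow> teq n k R (Dt r m (Dt s l t)) (Dt s l t)"
| idl: "teq n k R t t \<Longrightarrow> teq n k R (Ct m (Dt Minus m t) t) t"
| idr: "teq n k R t t \<Longrightarrow> teq n k R (Ct m t (Dt Plus m t)) t"
| cp_less: "teq n k R t t \<Longrightarrow> teq n k R u u \<Longrightarrow> teq n k R (Dt Plus l t) (Dt Minus l u) \<Longrightarrow> m < l \<Longrightarrow>
    teq n k R (Dt s m (Ct l t u)) (Dt s m t)"
| cp_minus: "teq n k R t t \<Longrightarrow> teq n k R u u \<Longrightarrow> teq n k R (Dt Plus l t) (Dt Minus l u) \<Longrightarrow>
    teq n k R (Dt Minus l (Ct l t u)) (Dt Minus l t)"
| cp_plus: "teq n k R t t \<Longrightarrow> teq n k R u u \<Longrightarrow> teq n k R (Dt Plus l t) (Dt Minus l u) \<Longrightarrow>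
    teq n k R (Dt Plus l (Ct l t u)) (Dt Plus l u)"
| cp_greater: "teq n k R t t \<Longrightarrow> teq n k R u u \<Longrightarrow> teq n k R (Dt Plus l t) (Dt Minus l u) \<Longrightarrow> l < m \<Longrightarrow>
    teq n k R (Dt s m (Ct l t u)) (Ct l (Dt s m t) (Dt s m u))"
| assoc: "teq n k R t t \<Longrightarrow> teq n k R u u \<Longrightarrow> teq n k R v v \<Longrightarrow>
    teq n k R (Dt Plus l t) (Dt Minus l u) \<Longrightarrow> teq n k R (Dt Plus l u) (Dt Minus l v) \<Longrightarrow>
    teq n k R (Ct l (Ct l t u) v) (Ct l t (Ct l u v))"
| interchange: "teq n k R t t \<Longrightarrow> teq n k R u u \<Longrightarrow> teq n k R t' t' \<Longrightarrow> teq n k R u' u' \<Longrightarrow> m < l \<Longrightarrow>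
    teq n k R (Dt Plus l t) (Dt Minus l u) \<Longrightarrow> teq n k R (Dt Plus l t') (Dt Minus l u') \<Longrightarrow>
    teq n k R (Dt Plus m t) (Dt Minus m t') \<Longrightarrow>
    teq n k R (Ct m (Ct l t u) (Ct l t' u')) (Ct l (Ct m t t') (Ct m u u'))"

primrec wf_trm :: "nat \<Rightarrow> nat \<Rightarrow> relations \<Rightarrow> trm \<Rightarrow> bool" where
  "wf_trm n k R (Gen i) \<longleftrightarrow> i < k"
| "wf_trm n k R (Dt s m t) \<longleftrightarrow> wf_trm n k R t"
| "wf_trm n k R (Ct m t u) \<longleftrightarrow> wf_trm n k R t \<and> wf_trm n k R u \<and>
     teq n k R (Dt Plus m t) (Dt Minus m u)"

lemma wf_trm_refl: "wf_trm n k R t \<Longrightarrow> teq n k R t t"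
  by (induction t) (auto intro: teq.gen teq.dd teq.cp)

text \<open>The rules assume composability of the factors only. Recovering that of the nested
  composites on both sides makes self-relatedness the same as the recursive check
  \<open>wf_trm\<close>, which permits induction on terms.\<close>

lemma teq_wf: "teq n k R t u \<Longrightarrow> wf_trm n k R t \<and> wf_trm n k R u"
proof (induction rule: teq.induct)
  case (cp t t' u u' m)
  then show ?case
    using teq.tran[OF teq.symm[OF teq.dd[OF cp.hyps(1)]] teq.tran[OF cp.hyps(3) teq.dd[OF cp.hyps(2)]]]
    by simp
next
  case (idl t m)
  then show ?case by (auto intro: teq.dd_ge)
next
  case (idr t m)
  then show ?case by (auto intro: teq.dd_ge teq.symm)
next
  case (cp_greater t u l m s)
  have "teq n k R (Dt Plus l (Dt s m t)) (Dt Minus l (Dt s m u))"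
    using teq.dd_less[OF cp_greater(1) cp_greater(4)] teq.dd_less[OF cp_greater(2) cp_greater(4)]
      cp_greater(3) teq.tran teq.symm by metis
  then show ?case using cp_greater by simp
next
  case (assoc t u v l)
  then show ?case
    using teq.tran[OF teq.cp_plus[OF assoc(1,2,4)] assoc(5)]
      teq.tran[OF assoc(4) teq.symm[OF teq.cp_minus[OF assoc(2,3,5)]]] assoc by simp
next
  case (interchange t u t' u' m l)
  note tu = interchange(6) and tu' = interchange(7) and tt' = interchange(8) and ml = interchange(5)
  have 1: "teq n k R (Dt Plus m (Ct l t u)) (Dt Minus m (Ct l t' u'))"
    by (rule teq.tran[OF teq.cp_less[OF interchange(1,2) tu ml]
          teq.tran[OF tt' teq.symm[OF teq.cp_less[OF interchange(3,4) tu' ml]]]])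
  \<comment> \<open>Since \<open>m < l\<close>, both sides are boundaries of the common
    \<open>l\<close>-boundary of \<open>t\<close> and \<open>u\<close>.\<close>
  have e: "teq n k R (Dt s m t) (Dt s m u)" for s
    by (rule teq.tran[OF teq.symm[OF teq.dd_less[OF interchange(1) ml]]
          teq.tran[OF teq.dd[OF tu] teq.dd_less[OF interchange(2) ml]]])
  have e': "teq n k R (Dt s m t') (Dt s m u')" for s
    by (rule teq.tran[OF teq.symm[OF teq.dd_less[OF interchange(3) ml]]
          teq.tran[OF teq.dd[OF tu'] teq.dd_less[OF interchange(4) ml]]])
  have uu': "teq n k R (Dt Plus m u) (Dt Minus m u')"
    by (rule teq.tran[OF teq.symm[OF e] teq.tran[OF tt' e']])
  have "teq n k R (Dt Plus m (Dt Plus l t)) (Dt Minus m (Dt Plus l t'))"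
    by (rule teq.tran[OF teq.dd_less[OF interchange(1) ml]
          teq.tran[OF tt' teq.symm[OF teq.dd_less[OF interchange(3) ml]]]])
  from teq.cp[OF tu tu' this]
  have "teq n k R (Dt Plus l (Ct m t t')) (Dt Minus l (Ct m u u'))"
    by (rule teq.tran[OF teq.cp_greater[OF interchange(1,3) tt' ml]
          teq.tran[OF _ teq.symm[OF teq.cp_greater[OF interchange(2,4) uu' ml]]]])
  with 1 uu' interchange show ?case by simp
qed auto

lemma teq_refl: "teq n k R t u \<Longrightarrow> teq n k R t t" "teq n k R t u \<Longrightarrow> teq n k R u u"
  using teq_wf wf_trm_refl by blast+

primrec ev :: "'a omega_cat \<Rightarrow> (nat \<Rightarrow> 'a) \<Rightarrow> trm \<Rightarrow> 'a" where
  "ev C x (Gen i) = x i"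
| "ev C x (Dt s m t) = dd C s m (ev C x t)"
| "ev C x (Ct m t u) = cmp C m (ev C x t) (ev C x u)"

definition satisfies :: "nat \<Rightarrow> nat \<Rightarrow> relations \<Rightarrow> 'a omega_cat \<Rightarrow> (nat \<Rightarrow> 'a) \<Rightarrow> bool" where
  "satisfies n k R C x \<longleftrightarrow> (\<forall>i<k. x i \<in> cells C n) \<and>
     (\<forall>(i, m, j)\<in>R. i < k \<longrightarrow> j < k \<longrightarrow> dd C Plus m (x i) = dd C Minus m (x j))"

text \<open>Soundness. Membership in the carrier has to be carried along with equality, because the
  laws of \<open>C\<close> hold for its cells and its composable pairs only.\<close>

lemma ev_teq:
  assumes C: "is_omega_category C" and x: "satisfies n k R C x"
  shows "teq n k R t u \<Longrightarrow> ev C x t \<in> carrier C \<and> ev C x u \<in> carrier C \<and> ev C x t = ev C x u"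
proof -
  interpret omega_category C using C by unfold_locales
  note laws = dd_less dd_ge idl idr assoc interchange
  show "teq n k R t u \<Longrightarrow> ev C x t \<in> carrier C \<and> ev C x u \<in> carrier C \<and> ev C x t = ev C x u"
  proof (induction rule: teq.induct)
    case (gen i) then show ?case using x cells_carrier by (auto simp: satisfies_def)
  next
    case (gen_dd i s)
    then have "x i \<in> cells C n" using x by (auto simp: satisfies_def)
    then show ?case using cells_carrier cells_dd[of "x i" n n s] by simp
  next
    case (rel i m j) then show ?case using x cells_carrier by (fastforce simp: satisfies_def)
  next
    case (cp t t' u u' m)
    then show ?case using cmp_closed[of m "ev C x t" "ev C x u"] by (simp add: composable_def)
  next
    case (dd_less t m l r s) then show ?case using laws(1) by simp
  next
    case (dd_ge t l m r s) then show ?case using laws(2) by simp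
  next
    case (idl t m) then show ?case using laws(3) by simp
  next
    case (idr t m) then show ?case using laws(4) by simp
  next
    case (cp_less t u l m s)
    then have "composable C l (ev C x t) (ev C x u)" by (simp add: composable_def)
    then show ?case using cmp_closed cmp_less[OF _ cp_less(4)] cp_less by simp
  next
    case (cp_minus t u l)
    then have "composable C l (ev C x t) (ev C x u)" by (simp add: composable_def)
    then show ?case using cmp_closed cmp_minus cp_minus by simp
  next
    case (cp_plus t u l)
    then have "composable C l (ev C x t) (ev C x u)" by (simp add: composable_def)
    then show ?case using cmp_closed cmp_plus cp_plus by simp
  next
    case (cp_greater t u l m s)
    then have c: "composable C l (ev C x t) (ev C x u)" by (simp add: composable_def)
    then show ?case using cmp_closed[OF c] cmp_greater[OF c cp_greater(4), of s]
      dd_closed[OF cmp_closed[OF c], of s m] by simp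
  next
    case (assoc t u v l)
    then have c: "composable C l (ev C x t) (ev C x u)" "composable C l (ev C x u) (ev C x v)"
      by (simp_all add: composable_def)
    have "composable C l (cmp C l (ev C x t) (ev C x u)) (ev C x v)"
      using c cmp_plus[OF c(1)] cmp_closed[OF c(1)] by (simp add: composable_def)
    then show ?case using cmp_closed laws(5)[OF c] by simp metis
  next
    case (interchange t u t' u' m l)
    then have c: "composable C l (ev C x t) (ev C x u)" "composable C l (ev C x t') (ev C x u')"
      "composable C m (ev C x t) (ev C x t')"
      by (simp_all add: composable_def)
    have "composable C m (cmp C l (ev C x t) (ev C x u)) (cmp C l (ev C x t') (ev C x u'))"
      using c cmp_less[OF c(1) interchange(5)] cmp_less[OF c(2) interchange(5)]
        cmp_closed[OF c(1)] cmp_closed[OF c(2)] by (simp add: composable_def)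
    then show ?case using cmp_closed laws(6)[OF interchange(5) c] by simp metis
  qed auto
qed


text \<open>Terms are countable and the universe is infinite, so some injection exists; any of them
  will do.\<close>

definition trm_code :: "trm \<Rightarrow> 'u" where
  "trm_code = (SOME f. inj f)"

definition trm_of :: "'u \<Rightarrow> trm" where
  "trm_of = inv_into UNIV trm_code"

text \<open>A class is named by the code of a chosen member instead of being a set of terms, so that
  the carrier lies in \<open>'u\<close>. Related terms have the same relatives, hence the same
  chosen member.\<close>

definition trm_class :: "nat \<Rightarrow> nat \<Rightarrow> relations \<Rightarrow> trm \<Rightarrow> 'u" where
  "trm_class n k R t = trm_code (SOME u. teq n k R t u)"

definition presented :: "nat \<Rightarrow> nat \<Rightarrow> relations \<Rightarrow> 'u omega_cat" where
  "presented n k R =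
     \<lparr>carrier = trm_class n k R ` {t. teq n k R t t},
      dd = (\<lambda>s m x. trm_class n k R (Dt s m (trm_of x))),
      cmp = (\<lambda>m x y. trm_class n k R (Ct m (trm_of x) (trm_of y)))\<rparr>"

definition generator :: "nat \<Rightarrow> nat \<Rightarrow> relations \<Rightarrow> nat \<Rightarrow> 'u" where
  "generator n k R i = trm_class n k R (Gen i)"

definition classify :: "nat \<Rightarrow> nat \<Rightarrow> relations \<Rightarrow> 'a omega_cat \<Rightarrow> (nat \<Rightarrow> 'a) \<Rightarrow> 'u \<Rightarrow> 'a" where
  "classify n k R C x = (\<lambda>z\<in>carrier (presented n k R). ev C x (trm_of z))"

section \<open>The presented omega-category and its universal property\<close>

text \<open>Unlike \<^const>\<open>omega_hom\<close>, the facts on \<^const>\<open>classify\<close> below also cover maps to an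
  omega-category over a different type.\<close>

context
  assumes inacc: "inaccessible TYPE('u)"
begin

lemma trm_of_code [simp]: "trm_of (trm_code t :: 'u) = t"
proof -
  obtain f :: "trm \<Rightarrow> 'u" where "inj f" using inaccessible_countable_inj[OF inacc] by blast
  then have "inj (trm_code :: trm \<Rightarrow> 'u)" unfolding trm_code_def by (rule someI[of inj])
  then show ?thesis unfolding trm_of_def by simp
qed

lemma teq_trm_of_class:
  assumes "teq n k R t t"
  shows "teq n k R t (trm_of (trm_class n k R t :: 'u))"
  unfolding trm_class_def trm_of_code using assms by (rule someI)

lemma trm_class_eq_iff:
  assumes "teq n k R t t" "teq n k R u u"
  shows "trm_class n k R t = (trm_class n k R u :: 'u) \<longleftrightarrow> teq n k R t u"
proof
  assume "trm_class n k R t = (trm_class n k R u :: 'u)"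
  then show "teq n k R t u"
    using teq_trm_of_class[OF assms(1)] teq_trm_of_class[OF assms(2)] teq.tran teq.symm by metis
next
  assume "teq n k R t u"
  then have "teq n k R t = teq n k R u" using teq.tran teq.symm by blast
  then show "trm_class n k R t = (trm_class n k R u :: 'u)" by (simp add: trm_class_def)
qed

lemma presented_carrier: "carrier (presented n k R :: 'u omega_cat) = trm_class n k R ` {t. teq n k R t t}"
  by (simp add: presented_def)

lemma presented_dd:
  assumes "teq n k R t t"
  shows "dd (presented n k R :: 'u omega_cat) s m (trm_class n k R t) = trm_class n k R (Dt s m t)"
proof -
  have e: "teq n k R (Dt s m (trm_of (trm_class n k R t :: 'u))) (Dt s m t)"
    by (rule teq.dd[OF teq.symm[OF teq_trm_of_class[OF assms]]])
  then show ?thesis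
    using trm_class_eq_iff[OF teq_refl[OF e]] e by (simp add: presented_def)
qed

lemma presented_composable:
  assumes "teq n k R t t" "teq n k R u u"
  shows "composable (presented n k R :: 'u omega_cat) m (trm_class n k R t) (trm_class n k R u) \<longleftrightarrow>
    teq n k R (Dt Plus m t) (Dt Minus m u)"
  using assms trm_class_eq_iff[OF teq.dd[OF assms(1)] teq.dd[OF assms(2)], of Plus m Minus m]
  by (auto simp: composable_def presented_dd presented_carrier)

lemma presented_cmp:
  assumes "teq n k R t t" "teq n k R u u" "teq n k R (Dt Plus m t) (Dt Minus m u)"
  shows "cmp (presented n k R :: 'u omega_cat) m (trm_class n k R t) (trm_class n k R u) =
    trm_class n k R (Ct m t u)"
proof -
  note c = teq_trm_of_class[OF assms(1)] teq_trm_of_class[OF assms(2)]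
  have e: "teq n k R (Ct m t u) (Ct m (trm_of (trm_class n k R t :: 'u)) (trm_of (trm_class n k R u :: 'u)))"
    by (rule teq.cp[OF c assms(3)])
  show ?thesis using trm_class_eq_iff[OF teq_refl[OF e]] e by (simp add: presented_def)
qed

text \<open>Each axiom is a rule of \<open>teq\<close> read on representatives, except that every
  cell has a finite dimension. That one is not a rule and is proved by induction on terms.\<close>

lemma is_omega_category_presented: "is_omega_category (presented n k R :: 'u omega_cat)"
proof -
  let ?C = "presented n k R :: 'u omega_cat" and ?q = "trm_class n k R :: trm \<Rightarrow> 'u"
  have car: "\<exists>t. teq n k R t t \<and> x = ?q t" if "x \<in> carrier ?C" for x
    using that by (auto simp: presented_carrier)
  have comp: "\<exists>t u. teq n k R t t \<and> teq n k R u u \<and> teq n k R (Dt Plus m t) (Dt Minus m u) \<and>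
      x = ?q t \<and> y = ?q u" if "composable ?C m x y" for m x y
  proof -
    have "x \<in> carrier ?C" "y \<in> carrier ?C" using that by (auto simp: composable_def)
    then obtain t u where "teq n k R t t" "teq n k R u u" "x = ?q t" "y = ?q u" using car by blast
    then show ?thesis using presented_composable that by blast
  qed
  have eqI: "?q t = ?q u" if "teq n k R t u" for t u
    using trm_class_eq_iff[OF teq_refl[OF that]] that by blast
  have ex: "\<exists>m. teq n k R (Dt Minus m t) t" if "wf_trm n k R t" for t
    using that
  proof (induction t)
    case (Gen i) then show ?case by (auto intro: teq.gen_dd)
  next
    case (Dt s m t) then show ?case by (auto intro: teq.dd_ge wf_trm_refl)
  next
    case (Ct l t u)
    then obtain a b where ab: "teq n k R (Dt Minus a t) t" "teq n k R (Dt Minus b u) u" by auto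
    \<comment> \<open>The dimension is taken strictly above \<open>l\<close> so that
      \<open>cp_greater\<close> distributes the boundary over the composite.\<close>
    define m where "m = Suc (max l (max a b))"
    have up: "teq n k R (Dt Minus m v) v" if "teq n k R (Dt Minus c v) v" "c \<le> m" for v c
    proof -
      have vv: "teq n k R v v" using teq_refl(2)[OF that(1)] .
      show ?thesis
        by (rule teq.tran[OF teq.dd[OF teq.symm[OF that(1)]] teq.tran[OF teq.dd_ge[OF vv that(2)] that(1)]])
    qed
    have m: "teq n k R (Dt Minus m t) t" "teq n k R (Dt Minus m u) u" "l < m"
      using up[OF ab(1)] up[OF ab(2)] unfolding m_def by auto
    have tu: "teq n k R t t" "teq n k R u u" "teq n k R (Dt Plus l t) (Dt Minus l u)"
      using Ct.prems wf_trm_refl by auto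
    have "teq n k R (Ct l t u) (Ct l (Dt Minus m t) (Dt Minus m u))"
      by (rule teq.cp[OF teq.symm[OF m(1)] teq.symm[OF m(2)] tu(3)])
    then have "teq n k R (Dt Minus m (Ct l t u)) (Ct l t u)"
      using teq.tran[OF teq.cp_greater[OF tu m(3)]] teq.symm by blast
    then show ?case by blast
  qed
  show ?thesis
  proof (rule is_omega_categoryI)
    fix s n' x assume "x \<in> carrier ?C"
    then obtain t where t: "teq n k R t t" "x = ?q t" using car by blast
    then show "dd ?C s n' x \<in> carrier ?C"
      by (auto simp: presented_dd) (auto simp: presented_carrier intro: teq.dd)
  next
    fix m x y assume "composable ?C m x y"
    then obtain t u where t: "teq n k R t t" "teq n k R u u"
      "teq n k R (Dt Plus m t) (Dt Minus m u)" "x = ?q t" "y = ?q u" using comp by blast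
    then show "cmp ?C m x y \<in> carrier ?C"
      using teq.cp[OF t(1-3)] by (auto simp: presented_cmp) (auto simp: presented_carrier)
  next
    fix x assume "x \<in> carrier ?C"
    then obtain t where t: "teq n k R t t" "x = ?q t" using car by blast
    have "wf_trm n k R t" using teq_wf[OF t(1)] by simp
    from ex[OF this] obtain m where m: "teq n k R (Dt Minus m t) t" ..
    have "dd ?C Minus m x = x" using t eqI[OF m] by (simp add: presented_dd)
    then show "\<exists>n. dd ?C Minus n x = x" by blast
  next
    fix s r m l x assume "x \<in> carrier ?C" and ml: "m < (l :: nat)"
    then obtain t where t: "teq n k R t t" "x = ?q t" using car by blast
    then show "dd ?C r m (dd ?C s l x) = dd ?C r m x"
      using eqI[OF teq.dd_less[OF t(1) ml]] by (simp add: presented_dd teq.dd)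
  next
    fix s r m l x assume "x \<in> carrier ?C" and ml: "l \<le> (m :: nat)"
    then obtain t where t: "teq n k R t t" "x = ?q t" using car by blast
    then show "dd ?C r m (dd ?C s l x) = dd ?C s l x"
      using eqI[OF teq.dd_ge[OF t(1) ml]] by (simp add: presented_dd teq.dd)
  next
    fix m x assume "x \<in> carrier ?C"
    then obtain t where t: "teq n k R t t" "x = ?q t" using car by blast
    show "cmp ?C m (dd ?C Minus m x) x = x"
      using t teq.dd_ge[OF t(1), of m m] presented_cmp[OF teq.dd[OF t(1)] t(1)] eqI[OF teq.idl[OF t(1)]]
      by (simp add: presented_dd)
    show "cmp ?C m x (dd ?C Plus m x) = x"
      using t teq.symm[OF teq.dd_ge[OF t(1), of m m]] presented_cmp[OF t(1) teq.dd[OF t(1)]]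
        eqI[OF teq.idr[OF t(1)]]
      by (simp add: presented_dd)
  next
    fix s m l x y assume "composable ?C l x y" and ml: "m < (l :: nat)"
    then obtain t u where t: "teq n k R t t" "teq n k R u u"
      "teq n k R (Dt Plus l t) (Dt Minus l u)" "x = ?q t" "y = ?q u" using comp by blast
    then show "dd ?C s m (cmp ?C l x y) = dd ?C s m x"
      using teq_refl[OF teq.cp[OF t(1-3)]] eqI[OF teq.cp_less[OF t(1-3) ml]]
      by (simp add: presented_dd presented_cmp)
  next
    fix l x y assume "composable ?C l x y"
    then obtain t u where t: "teq n k R t t" "teq n k R u u"
      "teq n k R (Dt Plus l t) (Dt Minus l u)" "x = ?q t" "y = ?q u" using comp by blast
    show "dd ?C Minus l (cmp ?C l x y) = dd ?C Minus l x"
      using t teq_refl[OF teq.cp[OF t(1-3)]] eqI[OF teq.cp_minus[OF t(1-3)]]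
      by (simp add: presented_dd presented_cmp)
    show "dd ?C Plus l (cmp ?C l x y) = dd ?C Plus l y"
      using t teq_refl[OF teq.cp[OF t(1-3)]] eqI[OF teq.cp_plus[OF t(1-3)]]
      by (simp add: presented_dd presented_cmp)
  next
    fix s m l x y assume "composable ?C l x y" and lm: "l < (m :: nat)"
    then obtain t u where t: "teq n k R t t" "teq n k R u u"
      "teq n k R (Dt Plus l t) (Dt Minus l u)" "x = ?q t" "y = ?q u" using comp by blast
    note g = teq.cp_greater[OF t(1-3) lm, of s]
    have "teq n k R (Dt Plus l (Dt s m t)) (Dt Minus l (Dt s m u))"
      using teq_wf[OF g] by simp
    then show "dd ?C s m (cmp ?C l x y) = cmp ?C l (dd ?C s m x) (dd ?C s m y)"
      using t teq_refl[OF teq.cp[OF t(1-3)]] eqI[OF g]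
      by (simp add: presented_dd presented_cmp teq.dd)
  next
    fix l x y z assume "composable ?C l x y" and yz: "composable ?C l y z"
    then obtain t u where t: "teq n k R t t" "teq n k R u u"
      "teq n k R (Dt Plus l t) (Dt Minus l u)" "x = ?q t" "y = ?q u" using comp by blast
    have "z \<in> carrier ?C" using yz by (simp add: composable_def)
    then obtain v where v: "teq n k R v v" "z = ?q v" using car by blast
    have uv: "teq n k R (Dt Plus l u) (Dt Minus l v)"
      using yz t(5) v presented_composable[OF t(2) v(1)] by simp
    note g = teq.assoc[OF t(1,2) v(1) t(3) uv]
    have w: "teq n k R (Dt Plus l (Ct l t u)) (Dt Minus l v)"
      "teq n k R (Dt Plus l t) (Dt Minus l (Ct l u v))"
      using teq_wf[OF g] by simp_all
    show "cmp ?C l (cmp ?C l x y) z = cmp ?C l x (cmp ?C l y z)"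
      using eqI[OF g] w t v(1) uv unfolding t(4,5) v(2)
      by (simp add: presented_cmp teq_refl[OF teq.cp[OF t(1-3)]] teq_refl[OF teq.cp[OF t(2) v(1) uv]])
  next
    fix m l x y x' y'
    assume ml: "m < (l :: nat)" and "composable ?C l x y" "composable ?C l x' y'"
      and xx': "composable ?C m x x'"
    then obtain t u t' u' where t: "teq n k R t t" "teq n k R u u"
      "teq n k R (Dt Plus l t) (Dt Minus l u)" "x = ?q t" "y = ?q u"
      and t': "teq n k R t' t'" "teq n k R u' u'"
      "teq n k R (Dt Plus l t') (Dt Minus l u')" "x' = ?q t'" "y' = ?q u'"
      using comp[of l x y] comp[of l x' y'] by blast
    have tt': "teq n k R (Dt Plus m t) (Dt Minus m t')"
      using xx' t t' presented_composable[OF t(1) t'(1)] by simp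
    note g = teq.interchange[OF t(1,2) t'(1,2) ml t(3) t'(3) tt']
    have w: "teq n k R (Dt Plus m (Ct l t u)) (Dt Minus m (Ct l t' u'))"
      "teq n k R (Dt Plus l (Ct m t t')) (Dt Minus l (Ct m u u'))"
      "teq n k R (Dt Plus m u) (Dt Minus m u')"
      using teq_wf[OF g] by simp_all
    show "cmp ?C m (cmp ?C l x y) (cmp ?C l x' y') = cmp ?C l (cmp ?C m x x') (cmp ?C m y y')"
      using eqI[OF g] w t t' tt' unfolding t(4,5) t'(4,5)
      by (simp add: presented_cmp teq_refl[OF teq.cp[OF t(1-3)]] teq_refl[OF teq.cp[OF t'(1-3)]]
          teq_refl[OF teq.cp[OF t(1) t'(1) tt']] teq_refl[OF teq.cp[OF t(2) t'(2) w(3)]])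
  qed
qed

lemma presented_in_omega_Cat: "(presented n k R :: 'u omega_cat) \<in> Ob omega_Cat"
proof -
  have "carrier (presented n k R :: 'u omega_cat) \<subseteq> range trm_code"
    by (auto simp: presented_carrier trm_class_def)
  then have "countable (carrier (presented n k R :: 'u omega_cat))"
    by (rule countable_subset) simp
  then show ?thesis
    using is_omega_category_presented small_countable[OF inacc] by simp
qed

lemma generator_cells: "i < k \<Longrightarrow> (generator n k R i :: 'u) \<in> cells (presented n k R) n"
  using trm_class_eq_iff[OF teq.dd[OF teq.gen] teq.gen] teq.gen_dd[of i k n R Minus]
  by (auto simp: cells_def generator_def presented_dd teq.gen) (auto simp: presented_carrier teq.gen)

lemma satisfies_generator: "satisfies n k R (presented n k R :: 'u omega_cat) (generator n k R)"
  unfolding satisfies_def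
proof (intro conjI allI impI ballI, goal_cases)
  case (2 r)
  obtain i m j where [simp]: "r = (i, m, j)" using prod_cases3 by blast
  show ?case
  proof (clarsimp)
    assume ij: "i < k" "j < k"
    then have "teq n k R (Dt Plus m (Gen i)) (Dt Minus m (Gen j))" using 2 by (simp add: teq.rel)
    then show "dd (presented n k R :: 'u omega_cat) Plus m (generator n k R i) =
        dd (presented n k R) Minus m (generator n k R j)"
      using trm_class_eq_iff[OF teq_refl] ij by (simp add: generator_def presented_dd teq.gen)
  qed
qed (rule generator_cells)

lemma presented_induct [consumes 1, case_names gen dd cmp]:
  assumes x: "x \<in> carrier (presented n k R :: 'u omega_cat)"
    and gen: "\<And>i. i < k \<Longrightarrow> Q (generator n k R i)"
    and dd: "\<And>s m x. x \<in> carrier (presented n k R) \<Longrightarrow> Q x \<Longrightarrow> Q (dd (presented n k R) s m x)"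
    and cmp: "\<And>m x y. composable (presented n k R) m x y \<Longrightarrow> Q x \<Longrightarrow> Q y \<Longrightarrow>
      Q (cmp (presented n k R) m x y)"
  shows "Q x"
proof -
  have "Q (trm_class n k R t)" if "wf_trm n k R t" for t
    using that
  proof (induction t)
    case (Gen i) then show ?case using gen by (simp add: generator_def)
  next
    case (Dt s m t)
    then have "teq n k R t t" "Q (trm_class n k R t)" using wf_trm_refl by auto
    then show ?case using dd[of "trm_class n k R t" s m] by (auto simp: presented_dd presented_carrier)
  next
    case (Ct m t u)
    then have "teq n k R t t" "Q (trm_class n k R t)" "teq n k R u u" "Q (trm_class n k R u)"
      "teq n k R (Dt Plus m t) (Dt Minus m u)" using wf_trm_refl by auto
    then show ?case using cmp[of m "trm_class n k R t" "trm_class n k R u"]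
      by (simp add: presented_cmp presented_composable)
  qed
  then show ?thesis using x teq_wf by (auto simp: presented_carrier)
qed

lemma presented_hom_eq:
  assumes f: "f \<in> omega_hom (presented n k R :: 'u omega_cat) C"
    and g: "g \<in> omega_hom (presented n k R) C"
    and eq: "\<And>i. i < k \<Longrightarrow> f (generator n k R i) = g (generator n k R i)"
  shows "f = g"
proof (rule PiE_ext[OF omega_homD(1)[OF f] omega_homD(1)[OF g]])
  fix x assume "x \<in> carrier (presented n k R :: 'u omega_cat)"
  then show "f x = g x"
    by (induction rule: presented_induct) (simp_all add: eq omega_homD[OF f] omega_homD[OF g])
qed

lemma ev_trm_of_class:
  assumes "is_omega_category C" "satisfies n k R C x" "teq n k R t t"
  shows "ev C x (trm_of (trm_class n k R t :: 'u)) = ev C x t"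
  using ev_teq[OF assms(1,2) teq_trm_of_class[OF assms(3)]] by simp

lemma
  assumes C: "is_omega_category C" and x: "satisfies n k R C x"
  shows classify_closed: "z \<in> carrier (presented n k R :: 'u omega_cat) \<Longrightarrow>
      classify n k R C x z \<in> carrier C"
    and classify_dd: "z \<in> carrier (presented n k R :: 'u omega_cat) \<Longrightarrow>
      classify n k R C x (dd (presented n k R) s m z) = dd C s m (classify n k R C x z)"
    and classify_cmp: "composable (presented n k R :: 'u omega_cat) m z w \<Longrightarrow>
      classify n k R C x (cmp (presented n k R) m z w) =
      cmp C m (classify n k R C x z) (classify n k R C x w)"
proof -
  interpret P: omega_category "presented n k R :: 'u omega_cat"
    using is_omega_category_presented by unfold_locales
  note ev_class = ev_trm_of_class[OF C x]
  {
    assume "z \<in> carrier (presented n k R :: 'u omega_cat)"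
    then obtain t where t: "teq n k R t t" "z = trm_class n k R t" by (auto simp: presented_carrier)
    then show "classify n k R C x z \<in> carrier C"
      "classify n k R C x (dd (presented n k R) s m z) = dd C s m (classify n k R C x z)"
      using ev_teq[OF C x t(1)] P.dd_closed[of z s m]
      by (auto simp: classify_def ev_class presented_dd teq.dd presented_carrier)
  next
    assume c: "composable (presented n k R :: 'u omega_cat) m z w"
    then obtain t u where t: "teq n k R t t" "teq n k R u u" "z = trm_class n k R t" "w = trm_class n k R u"
      by (auto simp: presented_carrier composable_def)
    then have tu: "teq n k R (Dt Plus m t) (Dt Minus m u)" using c presented_composable by simp
    show "classify n k R C x (cmp (presented n k R) m z w) =
        cmp C m (classify n k R C x z) (classify n k R C x w)"
      using P.cmp_closed[OF c] P.composable_in[OF c] t tu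
      by (simp add: classify_def ev_class presented_cmp teq_refl[OF teq.cp[OF t(1,2) tu]])
  }
qed

lemma classify_hom:
  assumes "is_omega_category C" "satisfies n k R C x"
  shows "classify n k R C x \<in> omega_hom (presented n k R :: 'u omega_cat) C"
  by (rule omega_homI)
     (simp_all add: classify_closed[OF assms] classify_dd[OF assms] classify_cmp[OF assms], simp add: classify_def)

lemma classify_generator:
  assumes C: "is_omega_category C" and x: "satisfies n k R C x" and i: "i < k"
  shows "classify n k R C x (generator n k R i :: 'u) = x i"
  using ev_trm_of_class[OF C x teq.gen[OF i]] teq.gen[OF i]
  by (auto simp: classify_def generator_def presented_carrier)

lemma hom_satisfies:
  assumes f: "f \<in> omega_hom (presented n k R :: 'u omega_cat) C"
  shows "satisfies n k R C (\<lambda>i. f (generator n k R i))"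
proof -
  interpret P: omega_category "presented n k R :: 'u omega_cat"
    using is_omega_category_presented by unfold_locales
  have "dd C Plus m (f (generator n k R i)) = dd C Minus m (f (generator n k R j))"
    if "(i, m, j) \<in> R" "i < k" "j < k" for i m j
  proof -
    have "(generator n k R i :: 'u) \<in> carrier (presented n k R)"
      "(generator n k R j :: 'u) \<in> carrier (presented n k R)"
      by (rule P.cells_carrier[OF generator_cells[OF that(2)]])
        (rule P.cells_carrier[OF generator_cells[OF that(3)]])
    moreover have "dd (presented n k R) Plus m (generator n k R i :: 'u) =
        dd (presented n k R) Minus m (generator n k R j)"
      using satisfies_generator that unfolding satisfies_def by fastforce
    ultimately show ?thesis using omega_homD(3)[OF f] by metis
  qed
  then show ?thesis
    unfolding satisfies_def using omega_homD(6)[OF f generator_cells] by fastforce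
qed

end


section \<open>A criterion for strongly loop-free atomic bases\<close>

lemma submonoid_gen_least: "submonoid H G \<Longrightarrow> S \<subseteq> H \<Longrightarrow> submonoid_gen G S \<subseteq> H"
  unfolding submonoid_gen_def by blast

lemma submonoid_gen_incl: "S \<subseteq> submonoid_gen G S"
  unfolding submonoid_gen_def by blast

lemma (in monoid) submonoid_submonoid_gen:
  assumes "S \<subseteq> carrier G"
  shows "submonoid (submonoid_gen G S) G"
proof -
  have "submonoid (carrier G) G" by (simp add: submonoid.intro)
  then have "submonoid_gen G S \<subseteq> carrier G" using assms submonoid_gen_least by blast
  then show ?thesis
    by (intro submonoid.intro)
       (auto simp: submonoid_gen_def submonoid.m_closed submonoid.one_closed)
qed

section \<open>The groups of \<open>lambda C\<close> in terms of chains and cosets\<close>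

context omega_category
begin

abbreviation "chain_grp n \<equiv> free_Abelian_group (cells C n)"

lemma lambda_rels_subgroup: "subgroup (lambda_rels C n) (chain_grp n)"
proof -
  interpret group "chain_grp n" by simp
  show ?thesis
    unfolding lambda_rels_def
  proof (rule generate_is_subgroup, clarsimp)
    fix m x y a
    assume "m < n" "x \<in> cells C n" "y \<in> cells C n" and c: "composable C m x y"
      and a: "a \<in> Poly_Mapping.keys (frag_of (cmp C m x y) - (frag_of x + frag_of y))"
    then have "a \<in> {cmp C m x y} \<union> ({x} \<union> {y})"
      using keys_diff[of "frag_of (cmp C m x y)" "frag_of x + frag_of y"]
        Poly_Mapping.keys_add[of "frag_of x" "frag_of y"] by auto
    then show "a \<in> cells C n"
      using cmp_cells[OF c] \<open>x \<in> cells C n\<close> \<open>y \<in> cells C n\<close> by auto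
  qed
qed

lemma lambda_rels_normal: "lambda_rels C n \<lhd> chain_grp n"
  using comm_group.subgroup_imp_normal[OF abelian_free_Abelian_group lambda_rels_subgroup] .

lemma lambda_rels_keys: "c \<in> lambda_rels C n \<Longrightarrow> Poly_Mapping.keys c \<subseteq> cells C n"
  using subgroup.subset[OF lambda_rels_subgroup] by fastforce

lemma lambda_rels_0: "0 \<in> lambda_rels C n"
  using subgroup.one_closed[OF lambda_rels_subgroup[of n]] by simp

lemma lambda_rels_add:
  "a \<in> lambda_rels C n \<Longrightarrow> b \<in> lambda_rels C n \<Longrightarrow> a + b \<in> lambda_rels C n"
  using subgroup.m_closed[OF lambda_rels_subgroup[of n]] by simp

lemma lambda_rels_minus: "a \<in> lambda_rels C n \<Longrightarrow> - a \<in> lambda_rels C n"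
  using subgroup.m_inv_closed[OF lambda_rels_subgroup[of n], of a] lambda_rels_keys[of a n] by simp

lemma lambda_rels_diff:
  "a \<in> lambda_rels C n \<Longrightarrow> b \<in> lambda_rels C n \<Longrightarrow> a - b \<in> lambda_rels C n"
  using lambda_rels_add[OF _ lambda_rels_minus, of a n b] by simp

lemma lambda_rels_cmp:
  "m < n \<Longrightarrow> x \<in> cells C n \<Longrightarrow> y \<in> cells C n \<Longrightarrow> composable C m x y \<Longrightarrow>
   frag_of (cmp C m x y) - (frag_of x + frag_of y) \<in> lambda_rels C n"
  unfolding lambda_rels_def by (rule generate.incl) blast

text \<open>Composing \<open>x\<close> with itself along dimension \<open>m\<close> gives
  \<open>x\<close> again, so its class \<open>c\<close> satisfies \<open>c = c + c\<close>.\<close>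

lemma lambda_rels_identity:
  assumes "x \<in> cells C m" "m < n"
  shows "frag_of x \<in> lambda_rels C n"
proof -
  have "composable C m x x"
    using assms cells_carrier cells_dd by (simp add: composable_def)
  then have "- frag_of x \<in> lambda_rels C n"
    using lambda_rels_cmp[of m n x x] cells_mono[of m n x] cmp_cells_trivial(2)[of m x x m] assms by simp
  then show ?thesis using lambda_rels_minus by fastforce
qed

lemma lambda_coset_eq_iff:
  assumes "Poly_Mapping.keys a \<subseteq> cells C n" "Poly_Mapping.keys b \<subseteq> cells C n"
  shows "lambda_coset C n a = lambda_coset C n b \<longleftrightarrow> a - b \<in> lambda_rels C n"
proof -
  interpret group "chain_grp n" by simp
  have mem: "c \<in> lambda_coset C n b \<longleftrightarrow> c - b \<in> lambda_rels C n" for c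
  proof
    assume "c \<in> lambda_coset C n b"
    then show "c - b \<in> lambda_rels C n" by (auto simp: lambda_coset_def r_coset_def)
  next
    assume "c - b \<in> lambda_rels C n"
    moreover have "c = (c - b) \<otimes>\<^bsub>chain_grp n\<^esub> b" by simp
    ultimately show "c \<in> lambda_coset C n b" unfolding lambda_coset_def r_coset_def by blast
  qed
  show ?thesis
  proof
    assume "lambda_coset C n a = lambda_coset C n b"
    moreover have "a \<in> lambda_coset C n a"
      unfolding lambda_coset_def using rcos_self[OF _ lambda_rels_subgroup] assms(1) by simp
    ultimately show "a - b \<in> lambda_rels C n" using mem by simp
  next
    assume "a - b \<in> lambda_rels C n"
    then have "a \<in> lambda_rels C n #>\<^bsub>chain_grp n\<^esub> b" using mem by (simp add: lambda_coset_def)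
    then show "lambda_coset C n a = lambda_coset C n b"
      unfolding lambda_coset_def
      using repr_independence[OF _ _ lambda_rels_subgroup] assms(2) by simp
  qed
qed

lemma comm_group_lambda_grp: "comm_group (lambda_grp C n)"
  unfolding lambda_grp_def
  by (rule comm_group.abelian_FactGroup[OF abelian_free_Abelian_group lambda_rels_subgroup])

lemma carrier_lambda_grp:
  "carrier (lambda_grp C n) = lambda_coset C n ` {c. Poly_Mapping.keys c \<subseteq> cells C n}"
  unfolding lambda_grp_def carrier_FactGroup lambda_coset_def by (simp add: free_Abelian_group_def)

lemma lambda_coset_carrier:
  "Poly_Mapping.keys c \<subseteq> cells C n \<Longrightarrow> lambda_coset C n c \<in> carrier (lambda_grp C n)"
  by (simp add: carrier_lambda_grp)

lemma lambda_coset_add: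
  assumes "Poly_Mapping.keys a \<subseteq> cells C n" "Poly_Mapping.keys b \<subseteq> cells C n"
  shows "lambda_coset C n a \<otimes>\<^bsub>lambda_grp C n\<^esub> lambda_coset C n b = lambda_coset C n (a + b)"
  using normal.rcos_sum[OF lambda_rels_normal, of a n b] assms
  by (simp add: lambda_grp_def lambda_coset_def)

lemma lambda_coset_zero: "lambda_coset C n 0 = \<one>\<^bsub>lambda_grp C n\<^esub>"
proof -
  have "lambda_coset C n 0 = lambda_rels C n" by (auto simp: lambda_coset_def r_coset_def)
  then show ?thesis by (simp add: lambda_grp_def)
qed

lemma lambda_coset_inv:
  assumes "Poly_Mapping.keys a \<subseteq> cells C n"
  shows "inv\<^bsub>lambda_grp C n\<^esub> lambda_coset C n a = lambda_coset C n (- a)"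
proof -
  interpret comm_group "lambda_grp C n" by (rule comm_group_lambda_grp)
  show ?thesis
    by (rule inv_equality)
       (use assms in \<open>simp_all add: lambda_coset_add lambda_coset_carrier lambda_coset_zero\<close>)
qed

lemma lambda_coset_int_pow:
  assumes "Poly_Mapping.keys a \<subseteq> cells C n"
  shows "lambda_coset C n a [^]\<^bsub>lambda_grp C n\<^esub> (k :: int) = lambda_coset C n (frag_cmul k a)"
  using normal.FactGroup_int_pow[OF lambda_rels_normal, of a n k] assms
  by (simp add: lambda_grp_def lambda_coset_def)

lemma keys_frag_extend_subset:
  "(\<And>x. x \<in> Poly_Mapping.keys c \<Longrightarrow> Poly_Mapping.keys (f x) \<subseteq> A) \<Longrightarrow>
   Poly_Mapping.keys (frag_extend f c) \<subseteq> A"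
  using keys_frag_extend by fastforce

lemma keys_sum_subset:
  "(\<And>x. x \<in> A \<Longrightarrow> Poly_Mapping.keys (f x) \<subseteq> B) \<Longrightarrow> Poly_Mapping.keys (sum f A) \<subseteq> B"
  using Poly_Mapping.keys_sum[of f A] by blast

lemma lambda_coset_sum:
  assumes "finite A" "\<And>s. s \<in> A \<Longrightarrow> Poly_Mapping.keys (f s) \<subseteq> cells C n"
  shows "finprod (lambda_grp C n) (\<lambda>s. lambda_coset C n (f s)) A = lambda_coset C n (sum f A)"
proof -
  interpret comm_group "lambda_grp C n" by (rule comm_group_lambda_grp)
  show ?thesis
    using assms
  proof (induction A rule: finite_induct)
    case empty then show ?case by (simp add: lambda_coset_zero)
  next
    case (insert s A)
    have "finprod (lambda_grp C n) (\<lambda>s. lambda_coset C n (f s)) (insert s A) =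
        lambda_coset C n (f s) \<otimes>\<^bsub>lambda_grp C n\<^esub> lambda_coset C n (sum f A)"
      using insert by (subst finprod_insert) (auto simp: lambda_coset_carrier)
    also have "\<dots> = lambda_coset C n (f s + sum f A)"
      using insert by (intro lambda_coset_add keys_sum_subset) auto
    finally show ?case using insert by simp
  qed
qed

abbreviation "boundary n \<equiv> frag_extend (\<lambda>x. frag_of (dd C Plus n x) - frag_of (dd C Minus n x))"

lemma keys_boundary:
  assumes "Poly_Mapping.keys c \<subseteq> cells C m"
  shows "Poly_Mapping.keys (boundary n c) \<subseteq> cells C n"
proof (rule keys_frag_extend_subset)
  fix x assume "x \<in> Poly_Mapping.keys c"
  then have "x \<in> carrier C" using assms cells_carrier by blast
  then show "Poly_Mapping.keys (frag_of (dd C Plus n x) - frag_of (dd C Minus n x)) \<subseteq> cells C n"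
    using keys_diff[of "frag_of (dd C Plus n x)" "frag_of (dd C Minus n x)"]
      dd_cells[of x Plus n] dd_cells[of x Minus n] by auto
qed

text \<open>This makes the boundary well defined on the quotient. For the relation of a composite
  along \<open>m < n\<close>, both boundaries of the composite are again composites along
  \<open>m\<close>. For \<open>m = n\<close> the shared inner boundary cancels and only the outer
  ones remain.\<close>

lemma boundary_rels: "c \<in> lambda_rels C (Suc n) \<Longrightarrow> boundary n c \<in> lambda_rels C n"
proof -
  interpret group "chain_grp (Suc n)" by simp
  let ?H = "{c. Poly_Mapping.keys c \<subseteq> cells C (Suc n) \<and> boundary n c \<in> lambda_rels C n}"
  have H: "subgroup ?H (chain_grp (Suc n))"
  proof (rule subgroupI)
    show "?H \<noteq> {}" using lambda_rels_0 by (intro ex_in_conv[THEN iffD1] exI[of _ 0]) simp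
    show "inv\<^bsub>chain_grp (Suc n)\<^esub> a \<in> ?H" if "a \<in> ?H" for a
      using that lambda_rels_minus by (simp add: frag_extend_minus)
    show "a \<otimes>\<^bsub>chain_grp (Suc n)\<^esub> b \<in> ?H" if "a \<in> ?H" "b \<in> ?H" for a b
      using that lambda_rels_add Poly_Mapping.keys_add[of a b] by (auto simp: frag_extend_add)
  qed auto
  have "lambda_rels C (Suc n) \<subseteq> ?H"
    unfolding lambda_rels_def[of C "Suc n"]
  proof (rule generate_subgroup_incl[OF _ H], clarify, intro CollectI conjI)
    fix m x y assume m: "m < Suc n" and x: "x \<in> cells C (Suc n)" and y: "y \<in> cells C (Suc n)"
      and c: "composable C m x y"
    show "Poly_Mapping.keys (frag_of (cmp C m x y) - (frag_of x + frag_of y)) \<subseteq> cells C (Suc n)"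
      by (rule lambda_rels_keys[OF lambda_rels_cmp[OF m x y c]])
    have xy: "x \<in> carrier C" "y \<in> carrier C" using x y cells_carrier by auto
    let ?r = "\<lambda>s. frag_of (dd C s n (cmp C m x y)) - (frag_of (dd C s n x) + frag_of (dd C s n y))"
    have e: "boundary n (frag_of (cmp C m x y) - (frag_of x + frag_of y)) = ?r Plus - ?r Minus"
      by (simp add: frag_extend_diff frag_extend_add)
    show "boundary n (frag_of (cmp C m x y) - (frag_of x + frag_of y)) \<in> lambda_rels C n"
    proof (cases "m < n")
      case True
      have r: "?r s \<in> lambda_rels C n" for s
        unfolding cmp_greater[OF c True]
        by (rule lambda_rels_cmp[OF True dd_cells[OF xy(1)] dd_cells[OF xy(2)] composable_dd[OF c True]])
      show ?thesis unfolding e by (rule lambda_rels_diff[OF r r])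
    next
      case False
      then have "m = n" using m by simp
      then have "?r Plus - ?r Minus = 0"
        using c cmp_plus[OF c] cmp_minus[OF c] by (simp add: composable_def)
      then show ?thesis unfolding e using lambda_rels_0 by simp
    qed
  qed
  then show "c \<in> lambda_rels C (Suc n) \<Longrightarrow> boundary n c \<in> lambda_rels C n" by blast
qed

text \<open>In \<open>lambda\<close> the boundary is the single value taken on all representatives
  of a coset; \<open>boundary_rels\<close> shows that there is just one such value.\<close>

lemma bd_lambda:
  assumes c: "Poly_Mapping.keys c \<subseteq> cells C (Suc n)"
  shows "bd (lambda C) n (lambda_coset C (Suc n) c) = lambda_coset C n (boundary n c)"
proof -
  interpret group "chain_grp (Suc n)" by simp
  have self: "c \<in> lambda_coset C (Suc n) c"
    unfolding lambda_coset_def using rcos_self[OF _ lambda_rels_subgroup] c by simp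
  have "lambda_coset C n (boundary n a) = lambda_coset C n (boundary n c)"
    if a: "a \<in> lambda_coset C (Suc n) c" for a
  proof -
    obtain h where h: "h \<in> lambda_rels C (Suc n)" "a = h + c"
      using a by (auto simp: lambda_coset_def r_coset_def)
    then have ka: "Poly_Mapping.keys a \<subseteq> cells C (Suc n)"
      using c lambda_rels_keys[OF h(1)] Poly_Mapping.keys_add[of h c] by auto
    show ?thesis
      using boundary_rels[OF h(1)] h(2)
      by (subst lambda_coset_eq_iff[OF keys_boundary[OF ka] keys_boundary[OF c]])
         (simp add: frag_extend_add)
  qed
  then have im: "(\<lambda>a. lambda_coset C n (boundary n a)) ` lambda_coset C (Suc n) c =
      {lambda_coset C n (boundary n c)}"
    using self by blast
  show ?thesis unfolding lambda_def adc.simps im the_elem_eq ..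
qed

lemma lambda_simps [simp]: "grp (lambda C) n = lambda_grp C n"
  "pos (lambda C) n = submonoid_gen (lambda_grp C n) (lambda_cls C n ` cells C n)"
  by (simp_all add: lambda_def)

end


section \<open>Generators with multiplicities and a height function\<close>

lemma partial_order_on_rank:
  fixes \<rho> :: "'a \<Rightarrow> 'b :: order"
  shows "partial_order_on B {(x, y) \<in> B \<times> B. x = y \<or> \<rho> x < \<rho> y}"
  unfolding partial_order_on_def preorder_on_def
  by (auto simp: refl_on_def trans_def antisym_def)

text \<open>\<open>coef n x e\<close> is the multiplicity of \<open>e\<close> in the cell
  \<open>x\<close>. Additivity makes it a functional on chains that kills the relations, and in each
  dimension these functionals are dual to the generators, which gives linear independence. By
  \<open>dd_gen\<close> the boundaries of a generator are single generators, as happens for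
  composites of globes; atomicity is then the disjointness of two distinct basis elements.
  \<open>rank\<close> is a height that increases from the source of a generator to the generator and
  on to its target.\<close>

locale atomic_generators = omega_category C for C :: "'a omega_cat" +
  fixes E :: "'a set" and dim :: "'a \<Rightarrow> nat" and coef :: "nat \<Rightarrow> 'a \<Rightarrow> 'a \<Rightarrow> int"
    and rank :: "'a \<Rightarrow> int"
  assumes generated: "composition_generated C E dim"
    and coef_cmp: "m < n \<Longrightarrow> x \<in> cells C n \<Longrightarrow> y \<in> cells C n \<Longrightarrow> composable C m x y \<Longrightarrow>
      coef n (cmp C m x y) e = coef n x e + coef n y e"
    and coef_gen: "e \<in> E \<Longrightarrow> e' \<in> E \<Longrightarrow> dim e = n \<Longrightarrow> dim e' = n \<Longrightarrow>
      coef n e e' = (if e = e' then 1 else 0)"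
    and dd_gen: "e \<in> E \<Longrightarrow> n < dim e \<Longrightarrow> dd C s n e \<in> E \<and> dim (dd C s n e) = n"
    and dd_gen_neq: "e \<in> E \<Longrightarrow> n < dim e \<Longrightarrow> dd C Minus n e \<noteq> dd C Plus n e"
    and rank_dd: "e \<in> E \<Longrightarrow> dim e = Suc n \<Longrightarrow>
      rank (dd C Minus n e) < rank e \<and> rank e < rank (dd C Plus n e)"
begin

abbreviation "gens n \<equiv> {e \<in> E. dim e = n}"

lemma gens_cells: "e \<in> gens n \<Longrightarrow> e \<in> cells C n"
  using generated unfolding composition_generated_def by (auto intro: comp_closure.gen)

lemma keys_gens: "Poly_Mapping.keys b \<subseteq> gens n \<Longrightarrow> Poly_Mapping.keys b \<subseteq> cells C n"
  using gens_cells by blast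

text \<open>A composite along a dimension \<open>m \<ge> n\<close> is one of its factors, so
  composites with \<open>m < n\<close> are the only ones left to consider. Generators of dimension
  below \<open>n\<close> fall under \<open>lower\<close>.\<close>

lemma cells_induct [consumes 1, case_names gen lower cmp trivial]:
  assumes x: "x \<in> cells C n"
    and "\<And>e. e \<in> gens n \<Longrightarrow> Q e"
    and "\<And>m x. m < n \<Longrightarrow> x \<in> cells C m \<Longrightarrow> Q x"
    and "\<And>m x y. m < n \<Longrightarrow> x \<in> cells C n \<Longrightarrow> y \<in> cells C n \<Longrightarrow> composable C m x y \<Longrightarrow>
      Q x \<Longrightarrow> Q y \<Longrightarrow> Q (cmp C m x y)"
  shows "Q x"
proof -
  have eq: "cells C k = comp_closure C {e \<in> E. dim e \<le> k}" for k
    using generated unfolding composition_generated_def by blast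
  have "x \<in> comp_closure C {e \<in> E. dim e \<le> n}" using x eq by simp
  then show "Q x"
  proof (induction rule: comp_closure.induct)
    case (gen e)
    then show ?case
      using assms(2)[of e] assms(3)[of "dim e" e] gens_cells[of e "dim e"] by (cases "dim e = n") auto
  next
    case (comp x y m)
    then have xy: "x \<in> cells C n" "y \<in> cells C n" using eq by auto
    show ?case
    proof (cases "m < n")
      case True then show ?thesis using assms(4) xy comp by blast
    next
      case False then show ?thesis using cmp_cells_trivial[OF comp(3) xy] comp by simp
    qed
  qed
qed

text \<open>The integers are modelled by the chains on the one-point type, so that
  \<open>frag_extend\<close> supplies the linear extension of \<open>coef\<close>.\<close>

definition cf :: "nat \<Rightarrow> 'a \<Rightarrow> ('a \<Rightarrow>\<^sub>0 int) \<Rightarrow> int" where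
  "cf n e c = Poly_Mapping.lookup (frag_extend (\<lambda>x. frag_cmul (coef n x e) (frag_of ())) c) ()"

lemma cf_simps [simp]:
  "cf n e 0 = 0" "cf n e (frag_of x) = coef n x e" "cf n e (a + b) = cf n e a + cf n e b"
  "cf n e (a - b) = cf n e a - cf n e b" "cf n e (- a) = - cf n e a"
  by (simp_all add: cf_def frag_extend_add frag_extend_diff frag_extend_minus lookup_add lookup_minus)

lemma cf_rels: "c \<in> lambda_rels C n \<Longrightarrow> cf n e c = 0"
proof -
  interpret group "chain_grp n" by simp
  have H: "subgroup {c. Poly_Mapping.keys c \<subseteq> cells C n \<and> cf n e c = 0} (chain_grp n)" (is "subgroup ?H _")
  proof (rule subgroupI)
    show "?H \<noteq> {}" by (intro ex_in_conv[THEN iffD1] exI[of _ 0]) simp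
    show "a \<otimes>\<^bsub>chain_grp n\<^esub> b \<in> ?H" if "a \<in> ?H" "b \<in> ?H" for a b
      using that Poly_Mapping.keys_add[of a b] by auto
  qed auto
  have "lambda_rels C n \<subseteq> ?H"
    unfolding lambda_rels_def
  proof (rule generate_subgroup_incl[OF _ H], clarify, intro CollectI conjI)
    fix m x y assume m: "m < n" "x \<in> cells C n" "y \<in> cells C n" "composable C m x y"
    show "Poly_Mapping.keys (frag_of (cmp C m x y) - (frag_of x + frag_of y)) \<subseteq> cells C n"
      by (rule lambda_rels_keys[OF lambda_rels_cmp[OF m]])
    show "cf n e (frag_of (cmp C m x y) - (frag_of x + frag_of y)) = 0"
      using coef_cmp[OF m] by simp
  qed
  then show "c \<in> lambda_rels C n \<Longrightarrow> cf n e c = 0" by blast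
qed

lemma cf_gens:
  assumes "Poly_Mapping.keys b \<subseteq> gens n" "e \<in> gens n"
  shows "cf n e b = Poly_Mapping.lookup b e"
  using assms(1)
proof (induction b rule: frag_induction)
  case (one x)
  then show ?case using coef_gen[of x e n] assms(2) by (auto simp: lookup_single)
qed (auto simp: lookup_minus)

text \<open>Modulo the relations a composite is a sum and a cell of lower dimension vanishes, so the
  generators of dimension \<open>n\<close> span.\<close>

lemma normal_form:
  assumes "Poly_Mapping.keys c \<subseteq> cells C n"
  shows "\<exists>b. Poly_Mapping.keys b \<subseteq> gens n \<and> c - b \<in> lambda_rels C n"
  using assms
proof (induction c rule: frag_induction)
  case zero
  then show ?case using lambda_rels_0 by (intro exI[of _ 0]) simp
next
  case (one x)
  then show ?case
  proof (induction rule: cells_induct)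
    case (gen e) then show ?case using lambda_rels_0 by (intro exI[of _ "frag_of e"]) simp
  next
    case (lower m x)
    then show ?case using lambda_rels_identity by (intro exI[of _ 0]) simp
  next
    case (cmp m x y)
    then obtain a b where ab: "Poly_Mapping.keys a \<subseteq> gens n" "frag_of x - a \<in> lambda_rels C n"
      "Poly_Mapping.keys b \<subseteq> gens n" "frag_of y - b \<in> lambda_rels C n" by blast
    have "frag_of (cmp C m x y) - (frag_of x + frag_of y) + ((frag_of x - a) + (frag_of y - b))
        \<in> lambda_rels C n"
      by (intro lambda_rels_add lambda_rels_cmp cmp ab)
    moreover have "frag_of (cmp C m x y) - (frag_of x + frag_of y) + ((frag_of x - a) + (frag_of y - b)) =
        frag_of (cmp C m x y) - (a + b)" by simp
    moreover have "Poly_Mapping.keys (a + b) \<subseteq> gens n" using Poly_Mapping.keys_add[of a b] ab by blast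
    ultimately show ?case by metis
  qed
next
  case (diff c d)
  then obtain a b where ab: "Poly_Mapping.keys a \<subseteq> gens n" "c - a \<in> lambda_rels C n"
      "Poly_Mapping.keys b \<subseteq> gens n" "d - b \<in> lambda_rels C n" by blast
  have "(c - a) - (d - b) \<in> lambda_rels C n" by (intro lambda_rels_diff ab)
  moreover have "(c - a) - (d - b) = (c - d) - (a - b)" by simp
  moreover have "Poly_Mapping.keys (a - b) \<subseteq> gens n" using Poly_Mapping.keys_diff[of a b] ab by blast
  ultimately show ?case by metis
qed

lemma cf_coset_cong:
  assumes "Poly_Mapping.keys a \<subseteq> cells C n" "Poly_Mapping.keys b \<subseteq> cells C n"
    "lambda_coset C n a = lambda_coset C n b"
  shows "cf n e a = cf n e b"
  using cf_rels[of "a - b" n e] lambda_coset_eq_iff[OF assms(1,2)] assms(3) by simp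

text \<open>Coordinates on the quotient, read from a chosen representative; since \<open>cf\<close>
  vanishes on the relations, the choice does not matter.\<close>

definition co :: "nat \<Rightarrow> ('a \<Rightarrow>\<^sub>0 int) set \<Rightarrow> 'a \<Rightarrow> int" where
  "co n X e = cf n e (SOME c. Poly_Mapping.keys c \<subseteq> cells C n \<and> lambda_coset C n c = X)"

lemma co_coset:
  assumes "Poly_Mapping.keys c \<subseteq> cells C n"
  shows "co n (lambda_coset C n c) e = cf n e c"
proof -
  have "Poly_Mapping.keys (SOME d. Poly_Mapping.keys d \<subseteq> cells C n \<and> lambda_coset C n d = lambda_coset C n c)
      \<subseteq> cells C n \<and>
    lambda_coset C n (SOME d. Poly_Mapping.keys d \<subseteq> cells C n \<and> lambda_coset C n d = lambda_coset C n c) =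
      lambda_coset C n c"
    by (rule someI[of "\<lambda>d. Poly_Mapping.keys d \<subseteq> cells C n \<and> lambda_coset C n d = lambda_coset C n c"])
       (use assms in simp)
  then show ?thesis unfolding co_def using cf_coset_cong assms by blast
qed

lemma carrier_rep:
  assumes "X \<in> carrier (lambda_grp C n)"
  obtains b where "Poly_Mapping.keys b \<subseteq> gens n" "X = lambda_coset C n b"
    "\<And>e. e \<in> gens n \<Longrightarrow> co n X e = Poly_Mapping.lookup b e"
proof -
  obtain c where c: "Poly_Mapping.keys c \<subseteq> cells C n" "X = lambda_coset C n c"
    using assms by (auto simp: carrier_lambda_grp)
  obtain b where b: "Poly_Mapping.keys b \<subseteq> gens n" "c - b \<in> lambda_rels C n"
    using normal_form[OF c(1)] by blast
  have "X = lambda_coset C n b"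
    using lambda_coset_eq_iff[OF c(1) keys_gens[OF b(1)]] b(2) c(2) by simp
  then show thesis
    using that[of b] b(1) cf_gens[OF b(1)] co_coset[OF keys_gens[OF b(1)]] by simp
qed

lemma co_eqI:
  assumes "X \<in> carrier (lambda_grp C n)" "Y \<in> carrier (lambda_grp C n)"
    "\<And>e. e \<in> gens n \<Longrightarrow> co n X e = co n Y e"
  shows "X = Y"
proof -
  obtain a where a: "Poly_Mapping.keys a \<subseteq> gens n" "X = lambda_coset C n a"
    "\<And>e. e \<in> gens n \<Longrightarrow> co n X e = Poly_Mapping.lookup a e"
    using carrier_rep[OF assms(1)] by blast
  obtain b where b: "Poly_Mapping.keys b \<subseteq> gens n" "Y = lambda_coset C n b"
    "\<And>e. e \<in> gens n \<Longrightarrow> co n Y e = Poly_Mapping.lookup b e"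
    using carrier_rep[OF assms(2)] by blast
  have "a = b"
  proof (rule poly_mapping_eqI)
    fix e show "Poly_Mapping.lookup a e = Poly_Mapping.lookup b e"
    proof (cases "e \<in> gens n")
      case True then show ?thesis using a(3) b(3) assms(3) by metis
    next
      case False then show ?thesis using a(1) b(1) by (metis in_keys_iff subsetD)
    qed
  qed
  then show ?thesis using a b by simp
qed

lemma co_mult:
  assumes "X \<in> carrier (lambda_grp C n)" "Y \<in> carrier (lambda_grp C n)"
  shows "co n (X \<otimes>\<^bsub>lambda_grp C n\<^esub> Y) e = co n X e + co n Y e"
proof -
  obtain a b where "Poly_Mapping.keys a \<subseteq> cells C n" "X = lambda_coset C n a"
    "Poly_Mapping.keys b \<subseteq> cells C n" "Y = lambda_coset C n b"
    using assms by (auto simp: carrier_lambda_grp)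
  moreover then have "Poly_Mapping.keys (a + b) \<subseteq> cells C n"
    using Poly_Mapping.keys_add[of a b] by blast
  ultimately show ?thesis by (simp add: lambda_coset_add co_coset)
qed

lemma co_inv:
  assumes "X \<in> carrier (lambda_grp C n)"
  shows "co n (inv\<^bsub>lambda_grp C n\<^esub> X) e = - co n X e"
  using assms by (auto simp: carrier_lambda_grp lambda_coset_inv co_coset)

lemma co_one: "co n \<one>\<^bsub>lambda_grp C n\<^esub> e = 0"
  using co_coset[of 0 n e] by (simp add: lambda_coset_zero)

lemma cls_carrier: "x \<in> cells C n \<Longrightarrow> lambda_cls C n x \<in> carrier (lambda_grp C n)"
  unfolding lambda_cls_def by (rule lambda_coset_carrier) simp

lemma co_cls: "x \<in> cells C n \<Longrightarrow> co n (lambda_cls C n x) e = coef n x e"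
  unfolding lambda_cls_def by (subst co_coset) auto

lemma co_cls_gen: "e \<in> gens n \<Longrightarrow> e' \<in> gens n \<Longrightarrow> co n (lambda_cls C n e) e' = (if e = e' then 1 else 0)"
  using co_cls[OF gens_cells, of e n e'] coef_gen[of e e' n] by simp

lemma inj_cls: "inj_on (lambda_cls C n) (gens n)"
proof (rule inj_onI)
  fix e e' assume e: "e \<in> gens n" and e': "e' \<in> gens n" and eq: "lambda_cls C n e = lambda_cls C n e'"
  have "(if e = e then 1 else 0) = (if e' = e then 1 else (0 :: int))"
    by (rule trans[OF sym[OF co_cls_gen[OF e e, unfolded eq]] co_cls_gen[OF e' e]])
  then show "e = e'" by (simp split: if_split_asm)
qed

abbreviation "P n \<equiv> submonoid_gen (lambda_grp C n) (lambda_cls C n ` gens n)"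

lemma monoid_lambda_grp: "monoid (lambda_grp C n)"
  using comm_group_lambda_grp by (simp add: comm_group_def group_def)

lemma submonoid_P: "submonoid (P n) (lambda_grp C n)"
  by (rule monoid.submonoid_submonoid_gen[OF monoid_lambda_grp]) (use cls_carrier gens_cells in blast)

lemma pos_eq_P: "submonoid_gen (lambda_grp C n) (lambda_cls C n ` cells C n) = P n"
proof
  have "lambda_cls C n x \<in> P n" if "x \<in> cells C n" for x
    using that
  proof (induction rule: cells_induct)
    case (gen e) then show ?case by (intro subsetD[OF submonoid_gen_incl] imageI)
  next
    case (lower m x)
    then have "lambda_cls C n x = \<one>\<^bsub>lambda_grp C n\<^esub>"
      unfolding lambda_cls_def lambda_coset_zero[symmetric]
      using lambda_rels_identity cells_mono[of m n x] by (subst lambda_coset_eq_iff) auto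
    then show ?case using submonoid.one_closed[OF submonoid_P] by simp
  next
    case (cmp m x y)
    have k: "Poly_Mapping.keys (frag_of x + frag_of y) \<subseteq> cells C n"
      using Poly_Mapping.keys_add[of "frag_of x" "frag_of y"] cmp(2,3) by auto
    have "lambda_cls C n (cmp C m x y) = lambda_coset C n (frag_of x + frag_of y)"
      unfolding lambda_cls_def
      by (subst lambda_coset_eq_iff) (use cmp lambda_rels_cmp cmp_cells k in auto)
    also have "\<dots> = lambda_cls C n x \<otimes>\<^bsub>lambda_grp C n\<^esub> lambda_cls C n y"
      unfolding lambda_cls_def by (rule lambda_coset_add[symmetric]) (use cmp in auto)
    finally show ?case using submonoid.m_closed[OF submonoid_P] cmp by simp
  qed
  then show "submonoid_gen (lambda_grp C n) (lambda_cls C n ` cells C n) \<subseteq> P n"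
    by (intro submonoid_gen_least[OF submonoid_P]) blast
  have "submonoid (submonoid_gen (lambda_grp C n) (lambda_cls C n ` cells C n)) (lambda_grp C n)"
    by (rule monoid.submonoid_submonoid_gen[OF monoid_lambda_grp]) (use cls_carrier in blast)
  then show "P n \<subseteq> submonoid_gen (lambda_grp C n) (lambda_cls C n ` cells C n)"
    by (rule submonoid_gen_least[OF _ order_trans[OF image_mono submonoid_gen_incl]])
       (use gens_cells in blast)
qed

text \<open>Coordinates identify the positive submonoid with the elements having no negative
  coordinate. Consequently the order of the complex is the coordinatewise one, which makes meets
  computable.\<close>

lemma P_iff:
  assumes "X \<in> carrier (lambda_grp C n)"
  shows "X \<in> P n \<longleftrightarrow> (\<forall>e\<in>gens n. 0 \<le> co n X e)"
proof
  let ?H = "{X \<in> carrier (lambda_grp C n). \<forall>e\<in>gens n. 0 \<le> co n X e}"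
  have "submonoid ?H (lambda_grp C n)"
  proof (rule submonoid.intro)
    interpret monoid "lambda_grp C n" by (rule monoid_lambda_grp)
    show "?H \<subseteq> carrier (lambda_grp C n)" by blast
    show "x \<otimes>\<^bsub>lambda_grp C n\<^esub> y \<in> ?H" if "x \<in> ?H" "y \<in> ?H" for x y
      using that by (simp add: co_mult)
    show "\<one>\<^bsub>lambda_grp C n\<^esub> \<in> ?H" by (simp add: co_one)
  qed
  then have "P n \<subseteq> ?H"
    by (rule submonoid_gen_least) (use cls_carrier gens_cells co_cls_gen in auto)
  then show "X \<in> P n \<Longrightarrow> \<forall>e\<in>gens n. 0 \<le> co n X e" by blast
next
  assume nonneg: "\<forall>e\<in>gens n. 0 \<le> co n X e"
  obtain b where b: "Poly_Mapping.keys b \<subseteq> gens n" "X = lambda_coset C n b"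
    "\<And>e. e \<in> gens n \<Longrightarrow> co n X e = Poly_Mapping.lookup b e"
    using carrier_rep[OF assms] by blast
  have one: "lambda_coset C n (frag_cmul (int k) (frag_of e)) \<in> P n" if e: "e \<in> gens n" for e k
  proof (induction k)
    case 0
    then show ?case using submonoid.one_closed[OF submonoid_P] by (simp add: lambda_coset_zero)
  next
    case (Suc k)
    have k: "Poly_Mapping.keys (frag_of e) \<subseteq> cells C n"
        "Poly_Mapping.keys (frag_cmul (int k) (frag_of e)) \<subseteq> cells C n"
      using gens_cells[OF e] by auto
    have "lambda_coset C n (frag_cmul (int (Suc k)) (frag_of e)) =
        lambda_cls C n e \<otimes>\<^bsub>lambda_grp C n\<^esub> lambda_coset C n (frag_cmul (int k) (frag_of e))"
      unfolding lambda_cls_def lambda_coset_add[OF k] by (simp add: frag_cmul_distrib)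
    then show ?case
      using submonoid.m_closed[OF submonoid_P subsetD[OF submonoid_gen_incl imageI[OF e]] Suc] by simp
  qed
  have "lambda_coset C n (sum (\<lambda>e. frag_cmul (Poly_Mapping.lookup b e) (frag_of e)) A) \<in> P n"
    if "finite A" "A \<subseteq> gens n" for A
    using that
  proof (induction A rule: finite_induct)
    case empty
    then show ?case using submonoid.one_closed[OF submonoid_P] by (simp add: lambda_coset_zero)
  next
    case (insert e A)
    then have e: "e \<in> gens n" and A: "A \<subseteq> gens n" by auto
    have "lambda_coset C n (frag_cmul (Poly_Mapping.lookup b e) (frag_of e)) \<in> P n"
      using one[OF e, of "nat (Poly_Mapping.lookup b e)"] nonneg b(3)[OF e] e by fastforce
    moreover have "lambda_coset C n (sum (\<lambda>e. frag_cmul (Poly_Mapping.lookup b e) (frag_of e)) (insert e A)) =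
      lambda_coset C n (frag_cmul (Poly_Mapping.lookup b e) (frag_of e)) \<otimes>\<^bsub>lambda_grp C n\<^esub>
      lambda_coset C n (sum (\<lambda>e. frag_cmul (Poly_Mapping.lookup b e) (frag_of e)) A)"
    proof (subst lambda_coset_add)
      show "Poly_Mapping.keys (frag_cmul (Poly_Mapping.lookup b e) (frag_of e)) \<subseteq> cells C n"
        using gens_cells[OF e] by auto
      show "Poly_Mapping.keys (sum (\<lambda>e. frag_cmul (Poly_Mapping.lookup b e) (frag_of e)) A) \<subseteq> cells C n"
        by (rule keys_sum_subset) (use gens_cells A in auto)
    qed (use insert in simp)
    ultimately show ?case using submonoid.m_closed[OF submonoid_P] insert.IH[OF A] by simp
  qed
  from this[OF finite_keys b(1)] show "X \<in> P n"
    unfolding b(2) using frag_expansion[of b] by (simp add: frag_extend_def)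
qed

text \<open>Injectivity is the duality of coordinates and generators, surjectivity the existence of
  normal forms. The work lies in passing, along the inverse \<open>g\<close> of the class map,
  between chains on the generators and chains on their classes.\<close>

lemma free_abelian_on_gens: "free_abelian_on (lambda_grp C n) (lambda_cls C n ` gens n)"
proof -
  interpret G: comm_group "lambda_grp C n" by (rule comm_group_lambda_grp)
  let ?S = "lambda_cls C n ` gens n"
  define g where "g = inv_into (gens n) (lambda_cls C n)"
  have g: "g s \<in> gens n" "lambda_cls C n (g s) = s" if "s \<in> ?S" for s
    unfolding g_def using inv_into_into[OF that] f_inv_into_f[OF that] by auto
  have gc: "g (lambda_cls C n e) = e" if "e \<in> gens n" for e
    unfolding g_def by (rule inv_into_f_f[OF inj_cls that])
  let ?f = "\<lambda>c. frag_extend (\<lambda>s. frag_of (g s)) c"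
  let ?F = "\<lambda>c. finprod (lambda_grp C n) (\<lambda>s. s [^]\<^bsub>lambda_grp C n\<^esub> Poly_Mapping.lookup c s)
      (Poly_Mapping.keys c)"
  have kf: "Poly_Mapping.keys (?f c) \<subseteq> gens n" if "Poly_Mapping.keys c \<subseteq> ?S" for c
    by (rule keys_frag_extend_subset) (use g that in auto)
  have F: "?F c = lambda_coset C n (?f c)" if c: "Poly_Mapping.keys c \<subseteq> ?S" for c
  proof -
    have k: "Poly_Mapping.keys (frag_of (g s)) \<subseteq> cells C n" if "s \<in> Poly_Mapping.keys c" for s
      using g(1)[of s] gens_cells[of "g s" n] that c by auto
    have "?F c = finprod (lambda_grp C n)
        (\<lambda>s. lambda_coset C n (frag_cmul (Poly_Mapping.lookup c s) (frag_of (g s)))) (Poly_Mapping.keys c)"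
    proof (rule G.finprod_cong')
      show "(\<lambda>s. lambda_coset C n (frag_cmul (Poly_Mapping.lookup c s) (frag_of (g s))))
          \<in> Poly_Mapping.keys c \<rightarrow> carrier (lambda_grp C n)"
      proof
        fix s assume "s \<in> Poly_Mapping.keys c"
        then show "lambda_coset C n (frag_cmul (Poly_Mapping.lookup c s) (frag_of (g s)))
            \<in> carrier (lambda_grp C n)"
          using k[of s] keys_cmul[of "Poly_Mapping.lookup c s" "frag_of (g s)"]
          by (intro lambda_coset_carrier) blast
      qed
      fix s assume s: "s \<in> Poly_Mapping.keys c"
      then have "s = lambda_coset C n (frag_of (g s))"
        using g(2)[of s] c unfolding lambda_cls_def by auto
      then show "s [^]\<^bsub>lambda_grp C n\<^esub> Poly_Mapping.lookup c s =
          lambda_coset C n (frag_cmul (Poly_Mapping.lookup c s) (frag_of (g s)))"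
        using lambda_coset_int_pow[OF k[OF s], of "Poly_Mapping.lookup c s"] by metis
    qed simp
    also have "\<dots> = lambda_coset C n (?f c)"
      unfolding frag_extend_def
    proof (rule lambda_coset_sum)
      fix s assume "s \<in> Poly_Mapping.keys c"
      then show "Poly_Mapping.keys (frag_cmul (Poly_Mapping.lookup c s) (frag_of (g s))) \<subseteq> cells C n"
        using k[of s] keys_cmul[of "Poly_Mapping.lookup c s" "frag_of (g s)"] by blast
    qed simp
    finally show ?thesis .
  qed
  have lookup_f: "Poly_Mapping.lookup (?f c) e = Poly_Mapping.lookup c (lambda_cls C n e)"
    if "Poly_Mapping.keys c \<subseteq> ?S" "e \<in> gens n" for c e
    using that(1)
  proof (induction c rule: frag_induction)
    case (one s)
    then show ?case using g[of s] gc[of e] that(2) by (auto simp: lookup_single when_def)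
  qed (auto simp: frag_extend_diff lookup_minus)
  have hom: "?F \<in> hom (free_Abelian_group ?S) (lambda_grp C n)"
  proof (rule homI)
    fix c d assume "c \<in> carrier (free_Abelian_group ?S)" "d \<in> carrier (free_Abelian_group ?S)"
    then have c: "Poly_Mapping.keys c \<subseteq> ?S" and d: "Poly_Mapping.keys d \<subseteq> ?S" by auto
    show "?F c \<in> carrier (lambda_grp C n)"
      unfolding F[OF c] by (rule lambda_coset_carrier[OF keys_gens[OF kf[OF c]]])
    have cd: "Poly_Mapping.keys (c + d) \<subseteq> ?S" using Poly_Mapping.keys_add[of c d] c d by blast
    have "?F (c + d) = ?F c \<otimes>\<^bsub>lambda_grp C n\<^esub> ?F d"
      unfolding F[OF c] F[OF d] F[OF cd]
      by (simp add: lambda_coset_add keys_gens[OF kf[OF c]] keys_gens[OF kf[OF d]] frag_extend_add)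
    then show "?F (c \<otimes>\<^bsub>free_Abelian_group ?S\<^esub> d) = ?F c \<otimes>\<^bsub>lambda_grp C n\<^esub> ?F d" by simp
  qed
  have "inj_on ?F (carrier (free_Abelian_group ?S))"
  proof (rule inj_onI)
    fix c d assume "c \<in> carrier (free_Abelian_group ?S)" "d \<in> carrier (free_Abelian_group ?S)"
      and eq: "?F c = ?F d"
    then have c: "Poly_Mapping.keys c \<subseteq> ?S" and d: "Poly_Mapping.keys d \<subseteq> ?S" by auto
    show "c = d"
    proof (rule poly_mapping_eqI)
      fix s show "Poly_Mapping.lookup c s = Poly_Mapping.lookup d s"
      proof (cases "s \<in> ?S")
        case True
        then obtain e where e: "e \<in> gens n" "s = lambda_cls C n e" by blast
        have "cf n e (?f c) = cf n e (?f d)"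
          using cf_coset_cong[OF keys_gens[OF kf[OF c]] keys_gens[OF kf[OF d]]] eq F[OF c] F[OF d] by simp
        then show ?thesis
          using cf_gens[OF kf[OF c] e(1)] cf_gens[OF kf[OF d] e(1)] lookup_f[OF c e(1)] lookup_f[OF d e(1)] e(2)
          by simp
      next
        case False then show ?thesis using c d by (metis in_keys_iff subsetD)
      qed
    qed
  qed
  moreover have "?F ` carrier (free_Abelian_group ?S) = carrier (lambda_grp C n)"
  proof
    show "?F ` carrier (free_Abelian_group ?S) \<subseteq> carrier (lambda_grp C n)"
      using hom_carrier[OF hom] .
    show "carrier (lambda_grp C n) \<subseteq> ?F ` carrier (free_Abelian_group ?S)"
    proof
      fix X assume "X \<in> carrier (lambda_grp C n)"
      then obtain b where b: "Poly_Mapping.keys b \<subseteq> gens n" "X = lambda_coset C n b"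
        by (rule carrier_rep) blast
      let ?c = "frag_extend (frag_of \<circ> lambda_cls C n) b"
      have c: "Poly_Mapping.keys ?c \<subseteq> ?S"
        by (rule keys_frag_extend_subset) (use b in auto)
      have "?f ?c = frag_extend ((\<lambda>s. frag_of (g s)) \<circ> lambda_cls C n) b" by (rule frag_extend_compose)
      also have "\<dots> = frag_extend frag_of b"
        by (rule frag_extend_eq) (use b gc in auto)
      also have "\<dots> = b" using frag_expansion[of b] by simp
      finally have "?F ?c = X" using F[OF c] b(2) by simp
      then show "X \<in> ?F ` carrier (free_Abelian_group ?S)" using c by (intro image_eqI[of _ _ ?c]) auto
    qed
  qed
  ultimately have "?F \<in> iso (free_Abelian_group ?S) (lambda_grp C n)"
    using hom by (simp add: iso_def bij_betw_def)
  moreover have "?S \<subseteq> carrier (lambda_grp C n)" using cls_carrier gens_cells by blast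
  ultimately show ?thesis unfolding free_abelian_on_def using G.comm_group_axioms by blast
qed

lemma adc_le_iff:
  assumes "X \<in> carrier (lambda_grp C n)" "Y \<in> carrier (lambda_grp C n)"
  shows "X \<sqsubseteq>\<^bsub>adc_order (lambda C) n\<^esub> Y \<longleftrightarrow> (\<forall>e\<in>gens n. co n X e \<le> co n Y e)"
proof -
  interpret G: comm_group "lambda_grp C n" by (rule comm_group_lambda_grp)
  show ?thesis
    using P_iff[of "Y \<otimes>\<^bsub>lambda_grp C n\<^esub> inv\<^bsub>lambda_grp C n\<^esub> X" n] assms
    by (simp add: adc_order_def pos_eq_P co_mult co_inv)
qed

text \<open>The meet is by definition a chosen greatest lower bound. It is pinned down by building
  the coordinatewise minimum as an explicit chain \<open>m\<close> and showing that no other element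
  is a greatest lower bound.\<close>

lemma disjoint_iff:
  assumes X: "X \<in> carrier (lambda_grp C n)" and Y: "Y \<in> carrier (lambda_grp C n)"
  shows "disjoint_elts (lambda C) n X Y \<longleftrightarrow> (\<forall>e\<in>gens n. min (co n X e) (co n Y e) = 0)"
proof -
  interpret G: comm_group "lambda_grp C n" by (rule comm_group_lambda_grp)
  let ?L = "adc_order (lambda C) n"
  have car: "carrier ?L = carrier (lambda_grp C n)" by (simp add: adc_order_def)
  obtain a where a: "Poly_Mapping.keys a \<subseteq> gens n"
    "\<And>e. e \<in> gens n \<Longrightarrow> co n X e = Poly_Mapping.lookup a e"
    using carrier_rep[OF X] by blast
  obtain b where b: "Poly_Mapping.keys b \<subseteq> gens n"
    "\<And>e. e \<in> gens n \<Longrightarrow> co n Y e = Poly_Mapping.lookup b e"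
    using carrier_rep[OF Y] by blast
  define m where "m = (\<Sum>e\<in>Poly_Mapping.keys a \<union> Poly_Mapping.keys b.
    frag_cmul (min (Poly_Mapping.lookup a e) (Poly_Mapping.lookup b e)) (frag_of e))"
  have km: "Poly_Mapping.keys m \<subseteq> gens n"
    unfolding m_def by (rule keys_sum_subset) (use a(1) b(1) in auto)
  have lm: "Poly_Mapping.lookup m e = min (Poly_Mapping.lookup a e) (Poly_Mapping.lookup b e)" for e
  proof -
    have "Poly_Mapping.lookup m e = (\<Sum>x\<in>Poly_Mapping.keys a \<union> Poly_Mapping.keys b.
        if x = e then min (Poly_Mapping.lookup a e) (Poly_Mapping.lookup b e) else 0)"
      unfolding m_def lookup_sum
      by (rule sum.cong) (auto simp: lookup_single when_def)
    also have "\<dots> = min (Poly_Mapping.lookup a e) (Poly_Mapping.lookup b e)"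
      by (simp add: in_keys_iff)
    finally show ?thesis .
  qed
  let ?M = "lambda_coset C n m"
  have M: "?M \<in> carrier (lambda_grp C n)" by (rule lambda_coset_carrier[OF keys_gens[OF km]])
  have coM: "co n ?M e = min (co n X e) (co n Y e)" if "e \<in> gens n" for e
    using co_coset[OF keys_gens[OF km]] cf_gens[OF km that] lm a(2)[OF that] b(2)[OF that] by simp
  have glb: "greatest ?L Z (Lower ?L {X, Y}) \<longleftrightarrow> Z = ?M" for Z
  proof
    assume Z: "greatest ?L Z (Lower ?L {X, Y})"
    then have ZL: "Z \<in> Lower ?L {X, Y}" and Zc: "Z \<in> carrier (lambda_grp C n)"
      and gr: "\<And>W. W \<in> Lower ?L {X, Y} \<Longrightarrow> W \<sqsubseteq>\<^bsub>?L\<^esub> Z"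
      by (auto simp: greatest_def Lower_def car)
    have "?M \<in> Lower ?L {X, Y}"
      using M X Y coM by (auto simp: Lower_def car adc_le_iff)
    then have "co n ?M e \<le> co n Z e" if "e \<in> gens n" for e
      using gr adc_le_iff[OF M Zc] that by blast
    moreover have "co n Z e \<le> co n X e" "co n Z e \<le> co n Y e" if "e \<in> gens n" for e
      using ZL adc_le_iff[OF Zc X] adc_le_iff[OF Zc Y] that X Y by (auto simp: Lower_def car)
    ultimately show "Z = ?M"
      using coM by (intro co_eqI[OF Zc M]) (simp add: order_antisym)
  next
    assume "Z = ?M"
    then show "greatest ?L Z (Lower ?L {X, Y})"
      using M X Y coM by (auto simp: greatest_def Lower_def car adc_le_iff)
  qed
  have "X \<sqinter>\<^bsub>?L\<^esub> Y = ?M" unfolding meet_def inf_def glb by simp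
  then have "disjoint_elts (lambda C) n X Y \<longleftrightarrow> ?M = \<one>\<^bsub>lambda_grp C n\<^esub>"
    by (simp add: disjoint_elts_def)
  also have "\<dots> \<longleftrightarrow> (\<forall>e\<in>gens n. co n ?M e = 0)"
    using co_eqI[OF M G.one_closed] by (auto simp: co_one)
  finally show ?thesis using coM by auto
qed

text \<open>The difference of \<open>p\<close> and \<open>q\<close> is prescribed and in each
  coordinate their minimum is zero, so they are the positive and negative parts of the boundary. As
  the two boundary generators are distinct, these parts are the generators themselves.\<close>

lemma bd_split_gen:
  assumes e: "e \<in> gens (Suc n)"
  shows "bd_split (lambda C) n (lambda_cls C (Suc n) e) p q \<longleftrightarrow>
    p = lambda_cls C n (dd C Plus n e) \<and> q = lambda_cls C n (dd C Minus n e)"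
proof -
  interpret G: comm_group "lambda_grp C n" by (rule comm_group_lambda_grp)
  have d: "dd C s n e \<in> gens n" for s using dd_gen[of e n s] e by auto
  have neq: "dd C Minus n e \<noteq> dd C Plus n e" using dd_gen_neq[of e n] e by auto
  let ?p = "lambda_cls C n (dd C Plus n e)" and ?q = "lambda_cls C n (dd C Minus n e)"
  have pq: "?p \<in> carrier (lambda_grp C n)" "?q \<in> carrier (lambda_grp C n)"
    using cls_carrier[OF gens_cells[OF d]] by auto
  have k: "Poly_Mapping.keys (frag_of (dd C s n e)) \<subseteq> cells C n" for s using gens_cells[OF d[of s]] by simp
  have bd: "bd (lambda C) n (lambda_cls C (Suc n) e) = ?p \<otimes>\<^bsub>lambda_grp C n\<^esub> inv\<^bsub>lambda_grp C n\<^esub> ?q"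
    using gens_cells[OF e] gens_cells[OF d] unfolding lambda_cls_def
    by (simp add: bd_lambda lambda_coset_inv lambda_coset_add)
  show ?thesis
  proof
    assume s: "bd_split (lambda C) n (lambda_cls C (Suc n) e) p q"
    then have p: "p \<in> carrier (lambda_grp C n)" and q: "q \<in> carrier (lambda_grp C n)"
      and eq: "?p \<otimes>\<^bsub>lambda_grp C n\<^esub> inv\<^bsub>lambda_grp C n\<^esub> ?q = p \<otimes>\<^bsub>lambda_grp C n\<^esub> inv\<^bsub>lambda_grp C n\<^esub> q"
      and dis: "disjoint_elts (lambda C) n q p"
      unfolding bd_split_def bd by auto
    have diff: "co n ?p x - co n ?q x = co n p x - co n q x" for x
      using arg_cong[OF eq, of "\<lambda>X. co n X x"] p q pq by (simp add: co_mult co_inv)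
    have min: "min (co n q x) (co n p x) = 0" if "x \<in> gens n" for x
      using disjoint_iff[OF q p] dis that by blast
    have "co n p x = co n ?p x \<and> co n q x = co n ?q x" if x: "x \<in> gens n" for x
      using diff[of x] min[OF x] co_cls_gen[OF d[of Plus] x] co_cls_gen[OF d[of Minus] x] neq
      by (auto simp: min_def split: if_splits)
    then show "p = ?p \<and> q = ?q" using co_eqI p q pq by blast
  next
    assume "p = ?p \<and> q = ?q"
    moreover have "disjoint_elts (lambda C) n ?q ?p"
      using co_cls_gen[OF d[of Plus]] co_cls_gen[OF d[of Minus]] neq by (auto simp: disjoint_iff[OF pq(2,1)])
    ultimately show "bd_split (lambda C) n (lambda_cls C (Suc n) e) p q"
      unfolding bd_split_def bd using pq by simp
  qed
qed

lemma bd_gen: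
  assumes "e \<in> gens (Suc n)"
  shows "bd_plus (lambda C) n (lambda_cls C (Suc n) e) = lambda_cls C n (dd C Plus n e)"
    "bd_minus (lambda C) n (lambda_cls C (Suc n) e) = lambda_cls C n (dd C Minus n e)"
  unfolding bd_plus_def bd_minus_def bd_split_gen[OF assms] by auto

text \<open>No other basis element lies below a single basis element. Strong loop-freeness therefore
  only asks for an order in which each generator lies after its source and before its target, and
  comparison of ranks is one.\<close>

theorem has_slf_atomic_basis: "has_slf_atomic_basis C"
proof -
  let ?b = "\<lambda>e. (dim e, lambda_cls C (dim e) e)"
  let ?B = "?b ` E"
  have Bn: "{b. (n, b) \<in> ?B} = lambda_cls C n ` gens n" for n by auto
  have inj: "inj_on ?b E"
  proof (rule inj_onI)
    fix x y assume x: "x \<in> E" and y: "y \<in> E" and eq: "?b x = ?b y"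
    have d: "dim x = dim y" and c: "lambda_cls C (dim x) x = lambda_cls C (dim y) y"
      using conjunct1[OF eq[unfolded prod.inject]] conjunct2[OF eq[unfolded prod.inject]] .
    show "x = y"
    proof (rule inj_onD[OF inj_cls])
      show "lambda_cls C (dim y) x = lambda_cls C (dim y) y" using c unfolding d .
    qed (use x y d in simp_all)
  qed
  have "is_omega_basis C E dim ?B"
    unfolding is_omega_basis_def is_adc_basis_def Bn lambda_simps
    using generated free_abelian_on_gens pos_eq_P inj by (auto simp: bij_betw_def)
  moreover have "is_atomic C E dim"
    unfolding is_atomic_def
  proof (intro ballI allI impI)
    fix e n assume e: "e \<in> E" and n: "n < dim e"
    have d: "dd C s n e \<in> gens n" for s using dd_gen[OF e n] by auto
    show "disjoint_elts (lambda C) n (lambda_cls C n (dd C Minus n e)) (lambda_cls C n (dd C Plus n e))"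
      using co_cls_gen[OF d[of Plus]] co_cls_gen[OF d[of Minus]] dd_gen_neq[OF e n]
      by (auto simp: disjoint_iff[OF cls_carrier[OF gens_cells[OF d]] cls_carrier[OF gens_cells[OF d]]])
  qed
  moreover have "strongly_loop_free (lambda C) ?B"
  proof -
    \<comment> \<open>The order is needed on classes rather than on generators; the rank is carried
      over along the injection \<open>?b\<close>.\<close>
    define \<rho> where "\<rho> x = rank (inv_into E ?b x)" for x
    have \<rho>: "\<rho> (?b e) = rank e" if "e \<in> E" for e
      unfolding \<rho>_def inv_into_f_f[OF inj that] ..
    define r where "r = {(x, y) \<in> ?B \<times> ?B. x = y \<or> \<rho> x < \<rho> y}"
    have "partial_order_on ?B r"
      unfolding r_def by (rule partial_order_on_rank)
    moreover have lower: "((n, a), (Suc n, b)) \<in> r - Id"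
      if ab: "(n, a) \<in> ?B" "(Suc n, b) \<in> ?B" "a \<sqsubseteq>\<^bsub>adc_order (lambda C) n\<^esub> bd_minus (lambda C) n b" for n a b
    proof -
      obtain e f where e: "e \<in> gens n" "a = lambda_cls C n e"
        and f: "f \<in> gens (Suc n)" "b = lambda_cls C (Suc n) f" using ab by auto
      have d: "dd C Minus n f \<in> gens n" using dd_gen[of f n Minus] f by auto
      have "co n a e \<le> co n (lambda_cls C n (dd C Minus n f)) e"
        using ab(3) e unfolding f(2) bd_gen[OF f(1)] e(2)
        by (subst (asm) adc_le_iff[OF cls_carrier[OF gens_cells[OF e(1)]] cls_carrier[OF gens_cells[OF d]]]) blast
      then have "e = dd C Minus n f"
        using co_cls_gen[OF e(1) e(1)] co_cls_gen[OF d e(1)] e(2) by (auto split: if_splits)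
      then have "rank e < rank f" using rank_dd[of f n] f by simp
      then show ?thesis using ab(1,2) \<rho>[of e] \<rho>[of f] e f by (auto simp: r_def)
    qed
    moreover have upper: "((Suc n, a), (n, b)) \<in> r - Id"
      if ab: "(Suc n, a) \<in> ?B" "(n, b) \<in> ?B" "b \<sqsubseteq>\<^bsub>adc_order (lambda C) n\<^esub> bd_plus (lambda C) n a" for n a b
    proof -
      obtain e f where e: "e \<in> gens n" "b = lambda_cls C n e"
        and f: "f \<in> gens (Suc n)" "a = lambda_cls C (Suc n) f" using ab by auto
      have d: "dd C Plus n f \<in> gens n" using dd_gen[of f n Plus] f by auto
      have "co n b e \<le> co n (lambda_cls C n (dd C Plus n f)) e"
        using ab(3) e unfolding f(2) bd_gen[OF f(1)] e(2)
        by (subst (asm) adc_le_iff[OF cls_carrier[OF gens_cells[OF e(1)]] cls_carrier[OF gens_cells[OF d]]]) blast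
      then have "e = dd C Plus n f"
        using co_cls_gen[OF e(1) e(1)] co_cls_gen[OF d e(1)] e(2) by (auto split: if_splits)
      then have "rank f < rank e" using rank_dd[of f n] f by simp
      then show ?thesis using ab(1,2) \<rho>[of e] \<rho>[of f] e f by (auto simp: r_def)
    qed
    ultimately show ?thesis unfolding strongly_loop_free_def by blast
  qed
  ultimately show ?thesis unfolding has_slf_atomic_basis_def by blast
qed

end


section \<open>Bases of the presented omega-categories\<close>

text \<open>Cells of the omega-category of double sequences
  \<open>(x\<^sup>-\<^sub>0, x\<^sup>+\<^sub>0 | x\<^sup>-\<^sub>1, x\<^sup>+\<^sub>1 | \<dots>)\<close> with entries in a free abelian group, as in the omega-category
  associated to an augmented directed complex.  The axioms hold without any condition relating
  the entries to a boundary.\<close>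

type_synonym dseq = "sign \<Rightarrow> nat \<Rightarrow> int \<Rightarrow> int"

text \<open>The composite is \<open>x - d + y\<close>, where \<open>d\<close> is the common
  \<open>n\<close>-boundary of \<open>x\<close> and \<open>y\<close>. It is spelled out level by
  level: below \<open>n\<close> the terms cancel to the common entry, at \<open>n\<close> the outer
  entries survive, and above \<open>n\<close> the entries add.\<close>

definition dseq_cat :: "dseq omega_cat" where
  "dseq_cat =
     \<lparr>carrier = {x. \<exists>n. x Minus n = x Plus n \<and> (\<forall>j>n. \<forall>s. x s j = (\<lambda>p. 0))},
      dd = (\<lambda>s n x. \<lambda>t j. if j < n then x t j else if j = n then x s n else (\<lambda>p. 0)),
      cmp = (\<lambda>n x y. \<lambda>t j. if j < n then x t j
        else if j = n then (if t = Minus then x Minus n else y Plus n)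
        else (\<lambda>p. x t j p + y t j p))\<rparr>"

lemma dseq_simps:
  "dd dseq_cat s n x = (\<lambda>t j. if j < n then x t j else if j = n then x s n else (\<lambda>p. 0))"
  "cmp dseq_cat n x y = (\<lambda>t j. if j < n then x t j
     else if j = n then (if t = Minus then x Minus n else y Plus n)
     else (\<lambda>p. x t j p + y t j p))"
  by (simp_all add: dseq_cat_def)

lemma dseq_composable:
  assumes "composable dseq_cat n x y"
  shows "j < n \<Longrightarrow> x t j = y t j" "x Plus n = y Minus n"
proof -
  have e: "dd dseq_cat Plus n x t j = dd dseq_cat Minus n y t j" for t j
    using assms by (simp add: composable_def)
  show "j < n \<Longrightarrow> x t j = y t j" using e[of t j] by (simp add: dseq_simps)
  show "x Plus n = y Minus n" using e[of _ n] by (simp add: dseq_simps)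
qed

lemma is_omega_category_dseq: "is_omega_category dseq_cat"
proof (rule is_omega_categoryI)
  fix s n x assume "x \<in> carrier dseq_cat"
  show "dd dseq_cat s n x \<in> carrier dseq_cat"
    by (auto simp: dseq_cat_def intro!: exI[of _ n])
next
  fix n x y assume c: "composable dseq_cat n x y"
  then obtain a b where a: "x Minus a = x Plus a" "\<And>j s. j > a \<Longrightarrow> x s j = (\<lambda>p. 0)"
    and b: "y Minus b = y Plus b" "\<And>j s. j > b \<Longrightarrow> y s j = (\<lambda>p. 0)"
    by (auto simp: composable_def dseq_cat_def)
  \<comment> \<open>The witness lies above \<open>n\<close>, where composition is addition, and
    above \<open>a\<close> and \<open>b\<close>, where both entries vanish.\<close>
  show "cmp dseq_cat n x y \<in> carrier dseq_cat"
    using a b by (auto simp: dseq_cat_def intro!: exI[of _ "Suc (max n (max a b))"])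
next
  fix x assume "x \<in> carrier dseq_cat"
  then obtain n where n: "x Minus n = x Plus n" "\<And>j s. j > n \<Longrightarrow> x s j = (\<lambda>p. 0)"
    by (auto simp: dseq_cat_def)
  have "dd dseq_cat Minus n x t j = x t j" for t j
    using n(1) n(2)[of j t] by (cases t; cases j n rule: linorder_cases) (auto simp: dseq_simps)
  then show "\<exists>n. dd dseq_cat Minus n x = x" by blast
next
  fix s m n x y assume "composable dseq_cat n x y" "n < m"
  then show "dd dseq_cat s m (cmp dseq_cat n x y) =
      cmp dseq_cat n (dd dseq_cat s m x) (dd dseq_cat s m y)"
    by (auto simp: dseq_simps fun_eq_iff)
next
  fix n x y assume c: "composable dseq_cat n x y"
  show "dd dseq_cat Minus n (cmp dseq_cat n x y) = dd dseq_cat Minus n x"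
    "dd dseq_cat Plus n (cmp dseq_cat n x y) = dd dseq_cat Plus n y"
    using dseq_composable[OF c] by (auto simp: dseq_simps fun_eq_iff)
next
  fix n x y z assume c: "composable dseq_cat n x y" "composable dseq_cat n y z"
  show "cmp dseq_cat n (cmp dseq_cat n x y) z = cmp dseq_cat n x (cmp dseq_cat n y z)"
    using dseq_composable[OF c(1)] dseq_composable[OF c(2)] by (auto simp: dseq_simps fun_eq_iff)
next
  fix n x
  show "cmp dseq_cat n (dd dseq_cat Minus n x) x = x" "cmp dseq_cat n x (dd dseq_cat Plus n x) = x"
    by (rule ext, rename_tac t, rule ext, rename_tac j, case_tac t; force simp: dseq_simps)+
qed (auto simp: dseq_simps fun_eq_iff)

context
  assumes inacc: "inaccessible TYPE('u)"
begin

text \<open>\<open>pos i s j\<close> places the boundary \<open>d^s_j\<close> of generator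
  \<open>i\<close> on the integer line, separately in each dimension \<open>j\<close>. By
  \<open>rel\<close>, \<open>rel_less\<close> and \<open>top\<close> the unit vectors at these
  positions satisfy the relations in \<open>dseq_cat\<close>, so the universal property gives a map
  \<open>F\<close> that counts basis cells. By \<open>sep\<close> two boundaries at the same
  position are the same cell, so these counts are dual to the generators. By \<open>ord\<close>
  boundaries move outwards as the dimension drops, so positions also serve as ranks.\<close>

theorem presented_slf:
  fixes n k :: nat and R :: relations and pos :: "nat \<Rightarrow> sign \<Rightarrow> nat \<Rightarrow> int"
  defines "P \<equiv> (presented n k R :: 'u omega_cat)" and "g \<equiv> generator n k R"
  assumes rel: "\<And>i m j. (i, m, j) \<in> R \<Longrightarrow> i < k \<Longrightarrow> j < k \<Longrightarrow> pos i Plus m = pos j Minus m"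
    and rel_less: "\<And>i m j s l. (i, m, j) \<in> R \<Longrightarrow> i < k \<Longrightarrow> j < k \<Longrightarrow> l < m \<Longrightarrow> pos i s l = pos j s l"
    and top: "\<And>i. i < k \<Longrightarrow> pos i Minus n = pos i Plus n"
    and ord: "\<And>i s j. i < k \<Longrightarrow> j < n \<Longrightarrow>
      pos i Minus j < pos i s (Suc j) \<and> pos i s (Suc j) < pos i Plus j"
    and sep: "\<And>i i' s s' j. i < k \<Longrightarrow> i' < k \<Longrightarrow> j \<le> n \<Longrightarrow> pos i s j = pos i' s' j \<Longrightarrow>
      dd P s j (g i) = dd P s' j (g i')"
  shows "has_slf_atomic_basis P"
proof -
  interpret P: omega_category P
    unfolding P_def using is_omega_category_presented[OF inacc] by unfold_locales
  interpret D: omega_category dseq_cat using is_omega_category_dseq by unfold_locales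
  define \<delta> where "\<delta> a = (\<lambda>p. if p = a then 1 else (0 :: int))" for a :: int
  have \<delta>_eq: "\<delta> a = \<delta> b \<longleftrightarrow> a = b" for a b by (auto simp: \<delta>_def fun_eq_iff split: if_splits)
  define v where "v i = (\<lambda>s j. if j \<le> n then \<delta> (pos i s j) else (\<lambda>p. 0))" for i
  define F where "F = (classify n k R dseq_cat v :: 'u \<Rightarrow> dseq)"
  have v: "satisfies n k R dseq_cat v"
    unfolding satisfies_def
  proof (intro conjI allI impI ballI)
    fix i assume i: "i < k"
    have "v i \<in> carrier dseq_cat"
      using top[OF i] by (auto simp: dseq_cat_def v_def intro!: exI[of _ n])
    moreover have "dd dseq_cat Minus n (v i) t j = v i t j" for t j
      using top[OF i] by (cases t) (auto simp: dseq_simps v_def)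
    then have "dd dseq_cat Minus n (v i) = v i" by blast
    ultimately show "v i \<in> cells dseq_cat n" by (simp add: cells_def)
  next
    fix r assume r: "r \<in> R"
    obtain i m j where e: "r = (i, m, j)" using prod_cases3 by blast
    show "case r of (i, m, j) \<Rightarrow> i < k \<longrightarrow> j < k \<longrightarrow> dd dseq_cat Plus m (v i) = dd dseq_cat Minus m (v j)"
      unfolding e prod.case
    proof (intro impI ext)
      fix s l p assume ij: "i < k" "j < k"
      have "(i, m, j) \<in> R" using r e by simp
      from rel[OF this ij] rel_less[OF this ij]
      show "dd dseq_cat Plus m (v i) s l p = dd dseq_cat Minus m (v j) s l p"
        by (simp add: dseq_simps v_def)
    qed
  qed
  note Fs = classify_dd[OF inacc is_omega_category_dseq v, folded P_def F_def]
    classify_cmp[OF inacc is_omega_category_dseq v, folded P_def F_def]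
  have Fg: "F (g i) = v i" if "i < k" for i
    unfolding F_def g_def by (rule classify_generator[OF inacc is_omega_category_dseq v that])
  have g: "g i \<in> cells P n" "g i \<in> carrier P" if "i < k" for i
    using generator_cells[OF inacc that] P.cells_carrier unfolding g_def P_def by auto
  let ?e = "\<lambda>s j i. dd P s j (g i)"
  have Fe: "F (?e s j i) t l = (if l < j then v i t l else if l = j then v i s j else (\<lambda>p. 0))"
    if "i < k" for s j i t l
    using Fs(1)[OF g(2)[OF that]] Fg[OF that] by (simp add: dseq_simps)
  define E where "E = {?e s j i | s j i. j \<le> n \<and> i < k}"
  \<comment> \<open>A basis cell can be a boundary of several generators. Its dimension and, through
    \<open>F\<close>, its position are therefore defined from the cell itself and not from such a
    description.\<close>
  define dim where "dim e = (LEAST j. dd P Minus j e = e)" for e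
  define rank where "rank e = (THE p. F e Minus (dim e) = \<delta> p)" for e
  have dim: "dim (?e s j i) = j" if i: "i < k" and j: "j \<le> n" for s j i
    unfolding dim_def
  proof (rule Least_equality)
    show "dd P Minus j (?e s j i) = ?e s j i" using P.dd_ge[OF g(2)[OF i]] by simp
    fix l assume l: "dd P Minus l (?e s j i) = ?e s j i"
    show "j \<le> l"
    proof (rule ccontr)
      assume "\<not> j \<le> l"
      then have lj: "l < j" by simp
      then have "?e Minus l i = ?e s j i" using l P.dd_less[OF g(2)[OF i]] by simp
      \<comment> \<open>At level \<open>j\<close> the left side is zero, being truncated at
        \<open>l\<close>, while the right side is a unit vector.\<close>
      then have "F (?e Minus l i) Minus j = F (?e s j i) Minus j" by simp
      then have "\<delta> (pos i s j) = (\<lambda>p. 0)" using lj j by (simp add: Fe[OF i] v_def)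
      then have "\<delta> (pos i s j) (pos i s j) = 0" by simp
      then show False by (simp add: \<delta>_def)
    qed
  qed
  have F_top: "F (?e s j i) Minus j = \<delta> (pos i s j)" if "i < k" "j \<le> n" for s j i
    using Fe[OF that(1), of s j Minus j] that(2) by (simp add: v_def)
  have rank: "rank (?e s j i) = pos i s j" if "i < k" "j \<le> n" for s j i
    unfolding rank_def dim[OF that] F_top[OF that] \<delta>_eq by simp
  have E: "?e s j i \<in> E" if "i < k" "j \<le> n" for s j i using that unfolding E_def by blast
  have closure_mono: "x \<in> comp_closure P S \<Longrightarrow> S \<subseteq> T \<Longrightarrow> x \<in> comp_closure P T" for x S T
    by (induction rule: comp_closure.induct) (auto intro: comp_closure.intros)
  \<comment> \<open>A statement about all boundaries of an arbitrary cell survives each of the three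
    constructors, unlike one about cells of a given dimension. The latter is the special case of a
    cell that is its own boundary.\<close>
  have dd_closure: "dd P s l z \<in> comp_closure P {e \<in> E. dim e \<le> l}" if "z \<in> carrier P" for s l z
    using that
  proof (induction z arbitrary: s l rule: presented_induct[OF inacc, where n = n and k = k and R = R,
        folded P_def g_def, consumes 1, case_names gen dd cmp])
    case (gen i)
    show ?case
    proof (cases "l \<le> n")
      case True then show ?thesis using E[OF gen True] dim[OF gen True] by (intro comp_closure.gen) simp
    next
      case False
      then have "?e s l i = ?e s n i" using P.cells_dd[OF g(1)[OF gen]] by simp
      then show ?thesis using E[OF gen order_refl, of s] dim[OF gen order_refl, of s] False
        by (intro comp_closure.gen) simp
    qed
  next
    case (dd t m x)
    show ?case
    proof (cases "l < m")
      case True then show ?thesis using dd P.dd_less by simp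
    next
      case False
      then show ?thesis using P.dd_ge[OF dd.hyps, of m l] 
        by (simp, intro closure_mono[OF dd.IH[of t m]]) auto
    qed
  next
    case (cmp m x y)
    consider "l < m" | "l = m" | "m < l" by linarith
    then show ?case
    proof cases
      case 1 then show ?thesis using P.cmp_less[OF cmp.hyps] cmp.IH by simp
    next
      case 2 then show ?thesis using P.cmp_minus[OF cmp.hyps] P.cmp_plus[OF cmp.hyps] cmp.IH by (cases s) simp_all
    next
      case l: 3
      show ?thesis
        unfolding P.cmp_greater[OF cmp.hyps l]
        by (rule comp_closure.comp[OF cmp.IH P.composable_dd[OF cmp.hyps l]])
    qed
  qed
  have closure_cells: "x \<in> cells P l" if "x \<in> comp_closure P {e \<in> E. dim e \<le> l}" for x l
    using that
  proof (induction rule: comp_closure.induct)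
    case (gen x)
    then obtain s j i where "x = ?e s j i" "j \<le> n" "i < k" unfolding E_def by blast
    then show ?case using gen dim P.cells_mono[OF _ P.dd_cells[OF g(2)]] by auto
  next
    case (comp x y m) then show ?case using P.cmp_cells by blast
  qed
  have "composition_generated P E dim"
    unfolding composition_generated_def
  proof (intro conjI allI)
    show "E \<subseteq> carrier P" using g(2) by (auto simp: E_def)
    fix l
    have "x \<in> comp_closure P {e \<in> E. dim e \<le> l}" if "x \<in> cells P l" for x
      using dd_closure[of x Minus l] that P.cells_carrier[OF that] P.cells_dd[OF that order_refl] by simp
    then show "cells P l = comp_closure P {e \<in> E. dim e \<le> l}" using closure_cells by blast
  qed
  \<comment> \<open>The multiplicity of \<open>e\<close> is the value, at the position of
    \<open>e\<close>, of the entry at level \<open>l\<close>. It is additive because a composite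
    along \<open>m < l\<close> adds entries at that level.\<close>
  then interpret atomic_generators P E dim "\<lambda>l x e. F x Minus l (rank e)" rank
  proof unfold_locales
    fix m l x y e
    assume "m < (l :: nat)" "composable P m x y"
    then show "F (cmp P m x y) Minus l (rank e) = F x Minus l (rank e) + F y Minus l (rank e)"
      using Fs(2) by (simp add: dseq_simps)
  next
    fix e e' l assume "e \<in> E" "e' \<in> E" "dim e = l" "dim e' = l"
    then obtain s i s' i' where e: "e = ?e s l i" "i < k" "l \<le> n" and e': "e' = ?e s' l i'" "i' < k"
      unfolding E_def using dim by auto
    have "e = e' \<longleftrightarrow> pos i s l = pos i' s' l"
      using sep[OF e(2) e'(2) e(3)] rank[OF e(2,3), of s] rank[OF e'(2) e(3), of s'] e(1) e'(1) by auto
    moreover have "F e Minus l (rank e') = (if pos i' s' l = pos i s l then 1 else 0)"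
      unfolding e(1) e'(1) F_top[OF e(2,3)] rank[OF e'(2) e(3)] \<delta>_def ..
    ultimately show "F e Minus l (rank e') = (if e = e' then 1 else 0)" by auto
  next
    fix e l s assume "e \<in> E" and l: "l < dim e"
    then obtain t j i where e: "e = ?e t j i" "i < k" "j \<le> n" unfolding E_def by blast
    have lj: "l < j" using l dim[OF e(2,3)] e(1) by simp
    have d: "dd P s l e = ?e s l i" for s using e(1) P.dd_less[OF g(2)[OF e(2)] lj] by simp
    have ln: "l \<le> n" "l < n" using lj e(3) by auto
    show "dd P s l e \<in> E \<and> dim (dd P s l e) = l" unfolding d using E[OF e(2) ln(1)] dim[OF e(2) ln(1)] by blast
    have "pos i Minus l < pos i Plus l" using ord[OF e(2) ln(2), of Plus] by linarith
    then show "dd P Minus l e \<noteq> dd P Plus l e"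
      unfolding d using rank[OF e(2) ln(1), of Minus] rank[OF e(2) ln(1), of Plus] by auto
  next
    fix e l assume "e \<in> E" and l: "dim e = Suc l"
    then obtain t i where e: "e = ?e t (Suc l) i" "i < k" "Suc l \<le> n" unfolding E_def using dim by auto
    have d: "dd P s l e = ?e s l i" for s using e(1) P.dd_less[OF g(2)[OF e(2)]] by simp
    have ln: "l \<le> n" "l < n" using e(3) by auto
    show "rank (dd P Minus l e) < rank e \<and> rank e < rank (dd P Plus l e)"
      unfolding d rank[OF e(2) ln(1)] using ord[OF e(2) ln(2), of t] rank[OF e(2,3), of t] e(1) by simp
  qed
  show ?thesis by (rule has_slf_atomic_basis)
qed

end


section \<open>Globes, chains of globes and grids\<close>

abbreviation globe :: "nat \<Rightarrow> 'u omega_cat" where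
  "globe n \<equiv> presented n (Suc 0) {}"

definition pair_rels :: "nat \<Rightarrow> relations" where
  "pair_rels m = {(0, m, 1)}"

definition triple_rels :: "nat \<Rightarrow> relations" where
  "triple_rels m = {(0, m, 1), (1, m, 2)}"

text \<open>Only the first cells of the two columns are related along \<open>p\<close>. For
  \<open>p < q\<close> the two cells of a column share their boundaries in dimension
  \<open>p\<close>, so composability of generators 1 and 3 follows.\<close>

definition grid_rels :: "nat \<Rightarrow> nat \<Rightarrow> relations" where
  "grid_rels q p = {(0, q, 1), (2, q, 3), (0, p, 2)}"

text \<open>In the following proofs the basis cells of each dimension are placed on a line in the order
  in which they occur in the pasting diagram, cells of lower dimension lying further out.\<close>

definition sgn_of :: "sign \<Rightarrow> int" where
  "sgn_of s = (case s of Minus \<Rightarrow> -1 | Plus \<Rightarrow> 1)"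

lemma sgn_of_simps [simp]: "sgn_of Minus = -1" "sgn_of Plus = 1"
  by (simp_all add: sgn_of_def)

context
  assumes inacc: "inaccessible TYPE('u)"
begin

lemma presented_rel:
  assumes "(i, m, j) \<in> R" "i < k" "j < k"
  shows "dd (presented n k R :: 'u omega_cat) Plus m (generator n k R i) =
      dd (presented n k R) Minus m (generator n k R j)"
    "l < m \<Longrightarrow> dd (presented n k R :: 'u omega_cat) s l (generator n k R i) =
      dd (presented n k R) s l (generator n k R j)"
proof -
  interpret P: omega_category "presented n k R :: 'u omega_cat"
    using is_omega_category_presented[OF inacc] by unfold_locales
  show e: "dd (presented n k R :: 'u omega_cat) Plus m (generator n k R i) =
      dd (presented n k R) Minus m (generator n k R j)"
    using satisfies_generator[OF inacc, of n k R] assms unfolding satisfies_def by fastforce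
  have "composable (presented n k R :: 'u omega_cat) m (generator n k R i) (generator n k R j)"
    using e P.cells_carrier[OF generator_cells[OF inacc assms(2)]]
      P.cells_carrier[OF generator_cells[OF inacc assms(3)]] by (simp add: composable_def)
  then show "l < m \<Longrightarrow> dd (presented n k R :: 'u omega_cat) s l (generator n k R i) =
      dd (presented n k R) s l (generator n k R j)"
    by (rule P.dd_less_eq)
qed

lemma presented_top:
  "i < k \<Longrightarrow> dd (presented n k R :: 'u omega_cat) s n (generator n k R i) = generator n k R i"
  using omega_category.cells_dd[OF omega_category.intro[OF is_omega_category_presented[OF inacc]]
      generator_cells[OF inacc]] by blast

text \<open>The top cell sits at 0 and the two boundaries of dimension \<open>j\<close> at distance
  \<open>n - j\<close> on either side, so lower dimensions lie further out.\<close>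

lemma slf_globe: "has_slf_atomic_basis (globe n :: 'u omega_cat)"
proof (rule presented_slf[OF inacc, where pos = "\<lambda>i s j. sgn_of s * (int n - int j)"])
  fix i i' :: nat and s s' j
  assume i: "i < Suc 0" "i' < Suc 0" and j: "j \<le> n"
    and eq: "sgn_of s * (int n - int j) = sgn_of s' * (int n - int j)"
  then have "s = s' \<or> j = n" by (cases s; cases s') auto
  then show "dd (globe n :: 'u omega_cat) s j (generator n (Suc 0) {} i) =
      dd (globe n) s' j (generator n (Suc 0) {} i')"
    using i presented_top[of 0 "Suc 0" n "{}"] by auto
next
  fix i j :: nat and s
  assume "i < Suc 0" "j < n"
  then show "sgn_of Minus * (int n - int j) < sgn_of s * (int n - int (Suc j)) \<and>
      sgn_of s * (int n - int (Suc j)) < sgn_of Plus * (int n - int j)"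
    by (cases s) auto
qed auto

text \<open>Generator \<open>i\<close> is centred at \<open>2 i (n + 1)\<close>, and its boundaries
  above dimension \<open>m\<close> lie at distance \<open>n - j\<close> from there. The
  \<open>m\<close>-cells sit at odd multiples of \<open>n + 1\<close>, the one between consecutive
  blocks being shared. Below \<open>m\<close> all generators have the same boundaries: these lie
  symmetrically about the midpoint \<open>(k - 1) (n + 1)\<close> of the chain, beyond the outermost
  \<open>m\<close>-cells, whose distance from it is \<open>k (n + 1)\<close>.\<close>

definition chain_pos :: "nat \<Rightarrow> nat \<Rightarrow> int \<Rightarrow> nat \<Rightarrow> sign \<Rightarrow> nat \<Rightarrow> int" where
  "chain_pos n m k i s j =
     (if m < j then 2 * int i * (int n + 1) + sgn_of s * (int n - int j)
      else if j = m then (2 * int i + sgn_of s) * (int n + 1)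
      else (k - 1) * (int n + 1) + sgn_of s * (k * (int n + 1) + int m - int j))"

lemma chain_pos_ord:
  assumes "m < n" "j < n" "int i < k"
  shows "chain_pos n m k i Minus j < chain_pos n m k i s (Suc j) \<and>
    chain_pos n m k i s (Suc j) < chain_pos n m k i Plus j"
proof -
  \<comment> \<open>Naming the two products makes the goal linear. The bounds \<open>a\<close> say
    that block \<open>i\<close> lies within the chain of \<open>k\<close> blocks.\<close>
  define t where "t = int i * (int n + 1)"
  define u where "u = k * (int n + 1)"
  have a: "0 \<le> t" "t \<le> u - (int n + 1)"
    using mult_right_mono[of "int i" "k - 1" "int n + 1"] assms(3)
    by (simp_all add: t_def u_def algebra_simps)
  have pos: "chain_pos n m k i s j =
     (if m < j then 2 * t + sgn_of s * (int n - int j)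
      else if j = m then 2 * t + sgn_of s * (int n + 1)
      else u - (int n + 1) + sgn_of s * (u + int m - int j))" for s j
    by (simp add: chain_pos_def t_def u_def algebra_simps)
  consider "m < j" | "j = m" | "Suc j = m" | "Suc j < m" by linarith
  then show ?thesis
    using assms(1,2) a by cases (cases s; auto simp: pos)+
qed

text \<open>The alternatives are exactly the coincidences of cells in a chain: the same boundary of
  the same generator, the top cell, a common boundary below \<open>m\<close>, and the
  \<open>m\<close>-cell shared by neighbours in either order.\<close>

lemma chain_pos_sep:
  assumes m: "m < n" and j: "j \<le> n" and k: "k > 0" and eq: "chain_pos n m k i s j = chain_pos n m k i' s' j"
  shows "(i = i' \<and> s = s') \<or> (i = i' \<and> j = n) \<or> (j < m \<and> s = s') \<or>
    (j = m \<and> i' = Suc i \<and> s = Plus \<and> s' = Minus) \<or> (j = m \<and> i = Suc i' \<and> s = Minus \<and> s' = Plus)"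
proof -
  consider "m < j" | "j = m" | "j < m" by linarith
  then show ?thesis
  proof cases
    case 1
    \<comment> \<open>Centres of different blocks are at least \<open>2 (n + 1)\<close> apart, more
      than the two offsets can bridge, so the blocks agree.\<close>
    let ?a = "sgn_of s * (int n - int j)" and ?b = "sgn_of s' * (int n - int j)"
    have ab: "2 * ((int i - int i') * (int n + 1)) = ?b - ?a"
      using eq 1 by (simp add: chain_pos_def algebra_simps)
    have "\<bar>?b - ?a\<bar> \<le> 2 * (int n - int j)" using j by (cases s; cases s') auto
    also have "\<dots> < 2 * (int n + 1)" by simp
    finally have "\<bar>2 * ((int i - int i') * (int n + 1))\<bar> < 2 * (int n + 1)"
      unfolding ab by simp
    then have "\<bar>(int i - int i') * (int n + 1)\<bar> < 1 * (int n + 1)" by linarith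
    then have "\<bar>int i - int i'\<bar> * (int n + 1) < 1 * (int n + 1)" by (simp only: abs_mult)
    then have "\<bar>int i - int i'\<bar> < 1" by (rule mult_right_less_imp_less) simp
    then have "i = i'" by simp
    moreover then have "s = s' \<or> j = n" using ab by (cases s; cases s') auto
    ultimately show ?thesis by blast
  next
    case 2
    then have "(2 * int i + sgn_of s) * (int n + 1) = (2 * int i' + sgn_of s') * (int n + 1)"
      using eq by (simp add: chain_pos_def)
    then have "2 * int i + sgn_of s = 2 * int i' + sgn_of s'" by simp
    then show ?thesis using 2 by (cases s; cases s') auto
  next
    case 3
    have "0 < k * (int n + 1)" using k by simp
    then have "s = s'" using eq 3 by (cases s; cases s') (auto simp: chain_pos_def)
    then show ?thesis using 3 by blast
  qed
qed

lemma chain_pos_simps: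
  "m < n \<Longrightarrow> chain_pos n m k i Minus n = chain_pos n m k i Plus n"
  "chain_pos n m k i Plus m = chain_pos n m k (Suc i) Minus m"
  "l < m \<Longrightarrow> chain_pos n m k i s l = chain_pos n m k i' s l"
  by (simp_all add: chain_pos_def algebra_simps)

lemma slf_chain:
  assumes m: "m < n" and k: "0 < k"
    and R: "R = {(i, m, Suc i) | i. Suc i < k}"
  shows "has_slf_atomic_basis (presented n k R :: 'u omega_cat)"
proof (rule presented_slf[OF inacc, where pos = "chain_pos n m (int k)"])
  fix i i' :: nat and s s' j
  assume i: "i < k" "i' < k" and j: "j \<le> n"
    and eq: "chain_pos n m (int k) i s j = chain_pos n m (int k) i' s' j"
  have step: "dd (presented n k R :: 'u omega_cat) Plus m (generator n k R i) =
      dd (presented n k R) Minus m (generator n k R (Suc i))" if "Suc i < k" for i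
    by (rule presented_rel(1)) (use that R in auto)
  have low0: "dd (presented n k R :: 'u omega_cat) s l (generator n k R i) =
      dd (presented n k R) s l (generator n k R 0)" if "i < k" "l < m" for i s l
    using that
  proof (induction i)
    case (Suc i)
    have "dd (presented n k R :: 'u omega_cat) s l (generator n k R i) =
      dd (presented n k R) s l (generator n k R (Suc i))"
      by (rule presented_rel(2)[of _ m]) (use Suc R in auto)
    then show ?case using Suc by simp
  qed simp
  show "dd (presented n k R :: 'u omega_cat) s j (generator n k R i) =
      dd (presented n k R) s' j (generator n k R i')"
    using chain_pos_sep[OF m j _ eq] k presented_top[OF i(1)] step[of i] step[of i'] i
      low0[OF i(1), of j s] low0[OF i(2), of j s] by auto
next
  fix i j s assume "i < k" "j < n"
  then show "chain_pos n m (int k) i Minus j < chain_pos n m (int k) i s (Suc j) \<and>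
    chain_pos n m (int k) i s (Suc j) < chain_pos n m (int k) i Plus j"
    using chain_pos_ord[OF m] by simp
qed (use chain_pos_simps m R in auto)

lemma slf_pair: "m < n \<Longrightarrow> has_slf_atomic_basis (presented n 2 (pair_rels m) :: 'u omega_cat)"
  by (rule slf_chain[of m]) (auto simp: pair_rels_def)

lemma slf_triple: "m < n \<Longrightarrow> has_slf_atomic_basis (presented n 3 (triple_rels m) :: 'u omega_cat)"
proof (rule slf_chain[of m])
  have "Suc i < 3 \<longleftrightarrow> i = 0 \<or> i = 1" for i by linarith
  then show "triple_rels m = {(i, m, Suc i) | i. Suc i < 3}"
    by (auto simp: triple_rels_def numeral_2_eq_2)
qed auto

text \<open>Generators 0 and 1 form the first column of the grid, 2 and 3 the second one.\<close>

definition grid_pos :: "nat \<Rightarrow> nat \<Rightarrow> nat \<Rightarrow> nat \<Rightarrow> sign \<Rightarrow> nat \<Rightarrow> int" where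
  "grid_pos n q p i s j =
    (let c = (if i = 0 \<or> i = 1 then -1 else 1); r = (if i = 0 \<or> i = 2 then -1 else 1);
         w = int n + 1; v = 4 * int n + 8; a = c * v; b = r * w in
     if q < j then a + b + sgn_of s * (int n - int j)
     else if j = q then a + b + sgn_of s * w
     else if p < j then a + sgn_of s * (2 * w + int q - int j)
     else if j = p then a + sgn_of s * v
     else sgn_of s * (2 * v + int p - int j))"

text \<open>In \<open>grid_pos\<close> the columns are centred at \<open>-v\<close> and
  \<open>v\<close>, and the rows of a column at offsets \<open>-w\<close> and \<open>w\<close> from
  its centre. Here \<open>w = n + 1\<close> exceeds every offset \<open>n - j\<close> of a single
  generator, and \<open>v = 4 n + 8\<close> amply exceeds every offset \<open>2 w + q - j\<close> of
  a whole column, so blocks never meet. The \<open>q\<close>-cell shared within a column falls on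
  its centre, and the \<open>p\<close>-cell shared by the columns on 0.\<close>

lemma slf_grid:
  assumes pq: "p < q" and qn: "q < n"
  shows "has_slf_atomic_basis (presented n 4 (grid_rels q p) :: 'u omega_cat)"
proof (rule presented_slf[OF inacc, where pos = "grid_pos n q p"])
  let ?P = "presented n 4 (grid_rels q p) :: 'u omega_cat" and ?g = "generator n 4 (grid_rels q p)"
  have four: "i < 4 \<Longrightarrow> i = 0 \<or> i = 1 \<or> i = 2 \<or> i = 3" for i :: nat by linarith
  have r01: "dd ?P Plus q (?g 0) = dd ?P Minus q (?g 1)" and r23: "dd ?P Plus q (?g 2) = dd ?P Minus q (?g 3)"
    and r02: "dd ?P Plus p (?g 0) = dd ?P Minus p (?g 2)"
    by (rule presented_rel(1); simp add: grid_rels_def)+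
  have l01: "dd ?P s l (?g 0) = dd ?P s l (?g 1)" and l23: "dd ?P s l (?g 2) = dd ?P s l (?g 3)"
    if "l < q" for s l
    by (rule presented_rel(2)[of _ q]; simp add: grid_rels_def that)+
  have l02: "dd ?P s l (?g 0) = dd ?P s l (?g 2)" if "l < p" for s l
    by (rule presented_rel(2)[of _ p]) (simp_all add: grid_rels_def that)
  fix i i' :: nat and s s' j
  assume i: "i < 4" "i' < 4" and j: "j \<le> n" and eq: "grid_pos n q p i s j = grid_pos n q p i' s' j"
  note pos = grid_pos_def Let_def
  \<comment> \<open>These are the branches of \<open>grid_pos\<close>, with \<open>j = n\<close>
    split off because there both signs give the same cell. In each branch an equality of positions
    is traced to the relations \<open>r01\<close> to \<open>l02\<close>.\<close>
  consider "j = n" | "q < j" "j < n" | "j = q" | "p < j" "j < q" | "j = p" | "j < p" using j by linarith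
  then show "dd ?P s j (?g i) = dd ?P s' j (?g i')"
  proof cases
    case 1
    then have "i = i'" using eq qn four[OF i(1)] four[OF i(2)] by (auto simp: pos)
    then show ?thesis using 1 presented_top i by simp
  next
    case 2
    then have "i = i' \<and> s = s'"
      using eq qn four[OF i(1)] four[OF i(2)] by (cases s; cases s') (auto simp: pos)
    then show ?thesis by simp
  next
    case 3
    then have "i = i' \<and> s = s' \<or> i = 0 \<and> i' = 1 \<and> s = Plus \<and> s' = Minus \<or>
        i = 1 \<and> i' = 0 \<and> s = Minus \<and> s' = Plus \<or> i = 2 \<and> i' = 3 \<and> s = Plus \<and> s' = Minus \<or>
        i = 3 \<and> i' = 2 \<and> s = Minus \<and> s' = Plus"
      using eq qn four[OF i(1)] four[OF i(2)] by (cases s; cases s') (auto simp: pos)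
    then show ?thesis using r01 r23 3 by auto
  next
    case 4
    then have "s = s' \<and> (i \<in> {0, 1} \<and> i' \<in> {0, 1} \<or> i \<in> {2, 3} \<and> i' \<in> {2, 3})"
      using eq qn four[OF i(1)] four[OF i(2)] by (cases s; cases s') (auto simp: pos)
    then show ?thesis using l01[of j] l23[of j] 4 by auto
  next
    case 5
    then have "s = s' \<and> (i \<in> {0, 1} \<and> i' \<in> {0, 1} \<or> i \<in> {2, 3} \<and> i' \<in> {2, 3}) \<or>
        s = Plus \<and> s' = Minus \<and> i \<in> {0, 1} \<and> i' \<in> {2, 3} \<or>
        s = Minus \<and> s' = Plus \<and> i \<in> {2, 3} \<and> i' \<in> {0, 1}"
      using eq pq qn four[OF i(1)] four[OF i(2)] by (cases s; cases s') (auto simp: pos)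
    then show ?thesis using l01[of j] l23[of j] r02 5 pq by auto
  next
    case 6
    then have "s = s'" using eq pq qn by (cases s; cases s') (auto simp: pos)
    then show ?thesis using l01[of j s] l23[of j s] l02[of j s] 6 pq four[OF i(1)] four[OF i(2)] by auto
  qed
next
  fix i j s assume i: "i < (4 :: nat)" and j: "j < n"
  note pos = grid_pos_def Let_def
  consider "q < j" | "j = q" | "Suc j = q" "p < j" | "Suc j < q" "p < j" | "j = p" "Suc j = q"
    | "j = p" "Suc j < q" | "Suc j = p" | "Suc j < p" using pq by linarith
  then show "grid_pos n q p i Minus j < grid_pos n q p i s (Suc j) \<and>
    grid_pos n q p i s (Suc j) < grid_pos n q p i Plus j"
    using j pq qn by cases (cases s; auto simp: pos)+
qed (use pq qn in \<open>auto simp: grid_rels_def grid_pos_def Let_def\<close>)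

end


section \<open>Globes and pairs of globes are dense\<close>

abbreviation pairing :: "nat \<Rightarrow> nat \<Rightarrow> 'u omega_cat" where
  "pairing n m \<equiv> presented n 2 (pair_rels m)"

abbreviation (input) slf :: "'u omega_cat set" where
  "slf \<equiv> {C. has_slf_atomic_basis C}"

definition top_cell :: "nat \<Rightarrow> 'u" where
  "top_cell n = generator n (Suc 0) {} 0"

definition cell_map :: "'u omega_cat \<Rightarrow> nat \<Rightarrow> 'u \<Rightarrow> 'u \<Rightarrow> 'u" where
  "cell_map C n x = classify n (Suc 0) {} C (\<lambda>_. x)"

definition pair_map :: "'u omega_cat \<Rightarrow> nat \<Rightarrow> nat \<Rightarrow> 'u \<Rightarrow> 'u \<Rightarrow> 'u \<Rightarrow> 'u" where
  "pair_map C n m x y = classify n 2 (pair_rels m) C (\<lambda>i. if i = 0 then x else y)"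

definition dense_shapes :: "'u omega_cat set" where
  "dense_shapes = range globe \<union> {pairing n m | n m. m < n}"

context
  assumes inacc: "inaccessible TYPE('u)"
begin

lemma omega_category_presented: "omega_category (presented n k R :: 'u omega_cat)"
  by (rule omega_category.intro[OF is_omega_category_presented[OF inacc]])

lemma top_cell_cells: "(top_cell n :: 'u) \<in> cells (globe n) n"
  unfolding top_cell_def using generator_cells[OF inacc] by simp

lemma top_cell_carrier: "(top_cell n :: 'u) \<in> carrier (globe n)"
  by (rule omega_category.cells_carrier[OF omega_category_presented top_cell_cells])

lemma cell_map:
  assumes "is_omega_category (C :: 'u omega_cat)" "x \<in> cells C n"
  shows "cell_map C n x \<in> omega_hom (globe n) C" "cell_map C n x (top_cell n) = x"
proof -
  have "satisfies n (Suc 0) {} C (\<lambda>_. x)" using assms(2) by (simp add: satisfies_def)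
  then show "cell_map C n x \<in> omega_hom (globe n) C" "cell_map C n x (top_cell n) = x"
    unfolding cell_map_def top_cell_def
    using classify_hom[OF inacc assms(1)] classify_generator[OF inacc assms(1)] by auto
qed

lemma globe_hom_eq:
  assumes "f \<in> omega_hom (globe n :: 'u omega_cat) C" "g \<in> omega_hom (globe n) C"
    "f (top_cell n) = g (top_cell n)"
  shows "f = g"
  using presented_hom_eq[OF inacc assms(1,2)] assms(3) by (simp add: top_cell_def)

lemma compose_cell_map:
  assumes C: "is_omega_category (C :: 'u omega_cat)" and D: "is_omega_category D"
    and f: "f \<in> omega_hom C D" and x: "x \<in> cells C n"
  shows "compose (carrier (globe n)) f (cell_map C n x) = cell_map D n (f x)"
proof (rule globe_hom_eq)
  have fx: "f x \<in> cells D n" using omega_homD(6)[OF f x] .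
  show "compose (carrier (globe n)) f (cell_map C n x) \<in> omega_hom (globe n) D"
    by (rule omega_hom_compose[OF cell_map(1)[OF C x] f is_omega_category_presented[OF inacc]])
  show "cell_map D n (f x) \<in> omega_hom (globe n) D" by (rule cell_map(1)[OF D fx])
  show "compose (carrier (globe n)) f (cell_map C n x) (top_cell n) = cell_map D n (f x) (top_cell n)"
    using cell_map(2)[OF C x] cell_map(2)[OF D fx] by (simp add: compose_eq top_cell_carrier)
qed

lemma hom_eq_cell_map:
  assumes C: "is_omega_category (C :: 'u omega_cat)" and f: "f \<in> omega_hom (globe n) C"
  shows "f = cell_map C n (f (top_cell n))" "f (top_cell n) \<in> cells C n"
proof -
  show *: "f (top_cell n) \<in> cells C n" using omega_homD(6)[OF f top_cell_cells] .
  show "f = cell_map C n (f (top_cell n))"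
    by (rule globe_hom_eq[OF f cell_map(1)[OF C *]]) (simp add: cell_map(2)[OF C *])
qed

abbreviation "fst_gen n m \<equiv> (generator n 2 (pair_rels m) 0 :: 'u)"
abbreviation "snd_gen n m \<equiv> (generator n 2 (pair_rels m) (Suc 0) :: 'u)"

lemma pair_gens:
  "fst_gen n m \<in> cells (pairing n m) n" "snd_gen n m \<in> cells (pairing n m) n"
  "composable (pairing n m) m (fst_gen n m) (snd_gen n m)"
proof -
  interpret P: omega_category "pairing n m :: 'u omega_cat" by (rule omega_category_presented)
  show c: "fst_gen n m \<in> cells (pairing n m) n" "snd_gen n m \<in> cells (pairing n m) n"
    by (rule generator_cells[OF inacc], simp)+
  show "composable (pairing n m) m (fst_gen n m) (snd_gen n m)"
    unfolding composable_def
    using P.cells_carrier[OF c(1)] P.cells_carrier[OF c(2)]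
      presented_rel(1)[OF inacc, of 0 m "Suc 0" "pair_rels m" 2 n] by (simp add: pair_rels_def)
qed

lemma pair_map:
  assumes "is_omega_category (C :: 'u omega_cat)" "x \<in> cells C n" "y \<in> cells C n" "composable C m x y"
  shows "pair_map C n m x y \<in> omega_hom (pairing n m) C" "pair_map C n m x y (fst_gen n m) = x"
    "pair_map C n m x y (snd_gen n m) = y"
proof -
  have "satisfies n 2 (pair_rels m) C (\<lambda>i. if i = 0 then x else y)"
    using assms(2-) by (simp add: satisfies_def pair_rels_def composable_def)
  note c = classify_hom[OF inacc assms(1) this] classify_generator[OF inacc assms(1) this]
  show "pair_map C n m x y \<in> omega_hom (pairing n m) C" "pair_map C n m x y (fst_gen n m) = x"
    "pair_map C n m x y (snd_gen n m) = y"
    unfolding pair_map_def using c(1) c(2)[of 0] c(2)[of "Suc 0"] by auto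
qed

lemma dense_shapes_Ob: "T \<in> dense_shapes \<Longrightarrow> (T :: 'u omega_cat) \<in> Ob omega_Cat"
  using presented_in_omega_Cat[OF inacc] by (auto simp: dense_shapes_def)

lemma dense_shapes_slf: "(T :: 'u omega_cat) \<in> dense_shapes \<Longrightarrow> T \<in> slf"
  using slf_globe[OF inacc] slf_pair[OF inacc] by (auto simp: dense_shapes_def)

lemma globe_dense: "globe n \<in> dense_shapes" by (simp add: dense_shapes_def)

lemma pairing_dense: "m < n \<Longrightarrow> pairing n m \<in> dense_shapes" by (auto simp: dense_shapes_def)

text \<open>Every cell is the image of the top cell of some globe, so globes alone detect equality
  of morphisms. Pairs enter in the existence statement that follows.\<close>

lemma density_unique:
  assumes C: "is_omega_category (C :: 'u omega_cat)" and h: "h \<in> omega_hom C D" and k: "k \<in> omega_hom C D"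
    and eq: "\<And>n f. f \<in> omega_hom (globe n) C \<Longrightarrow>
      compose (carrier (globe n)) h f = compose (carrier (globe n)) k f"
  shows "h = k"
proof (rule PiE_ext[OF omega_homD(1)[OF h] omega_homD(1)[OF k]])
  interpret C: omega_category C using C by unfold_locales
  fix x assume x: "x \<in> carrier C"
  then obtain n where n: "x \<in> cells C n" using C.ex_cells by blast
  have "compose (carrier (globe n)) h (cell_map C n x) (top_cell n) =
      compose (carrier (globe n)) k (cell_map C n x) (top_cell n)"
    using eq[OF cell_map(1)[OF C n]] by simp
  then show "h x = k x" by (simp add: compose_eq top_cell_carrier cell_map(2)[OF C n])
qed

text \<open>The value of \<open>h\<close> at \<open>x\<close> is found by applying
  \<open>\<phi>\<close> to the map from a globe that classifies \<open>x\<close> and evaluating at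
  the top cell. Naturality along the collapse of a larger globe onto a smaller one shows that the
  dimension of the globe does not matter. Two composable cells can thus be handled over a single
  pairing, where \<open>\<phi>\<close> yields a morphism and so respects the composite.\<close>

theorem density:
  fixes C D :: "'u omega_cat" and \<phi> :: "'u omega_cat \<Rightarrow> ('u \<Rightarrow> 'u) \<Rightarrow> 'u \<Rightarrow> 'u"
  assumes C: "is_omega_category C" and D: "is_omega_category D"
    and hom: "\<And>T f. T \<in> dense_shapes \<Longrightarrow> f \<in> omega_hom T C \<Longrightarrow> \<phi> T f \<in> omega_hom T D"
    and nat: "\<And>T T' f g. T \<in> dense_shapes \<Longrightarrow> T' \<in> dense_shapes \<Longrightarrow> g \<in> omega_hom T' T \<Longrightarrow>
      f \<in> omega_hom T C \<Longrightarrow> \<phi> T' (compose (carrier T') f g) = compose (carrier T') (\<phi> T f) g"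
  shows "\<exists>h\<in>omega_hom C D. \<forall>T\<in>dense_shapes. \<forall>f\<in>omega_hom T C. \<phi> T f = compose (carrier T) h f"
proof -
  interpret C: omega_category C using C by unfold_locales
  interpret D: omega_category D using D by unfold_locales
  note Gc = is_omega_category_presented[OF inacc]
  define val where "val n x = \<phi> (globe n) (cell_map C n x) (top_cell n)" for n x
  have val_map: "\<phi> T f z = val n (f z)"
    if T: "T \<in> dense_shapes" and f: "f \<in> omega_hom T C" and z: "z \<in> cells T n" for T f n z
  proof -
    have Tc: "is_omega_category T" using dense_shapes_Ob[OF T] by simp
    have "val n (f z) = \<phi> (globe n) (compose (carrier (globe n)) f (cell_map T n z)) (top_cell n)"
      unfolding val_def compose_cell_map[OF Tc C f z] ..
    also have "\<dots> = compose (carrier (globe n)) (\<phi> T f) (cell_map T n z) (top_cell n)"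
      unfolding nat[OF T globe_dense cell_map(1)[OF Tc z] f] ..
    also have "\<dots> = \<phi> T f z" by (simp add: compose_eq top_cell_carrier cell_map(2)[OF Tc z])
    finally show ?thesis by simp
  qed
  have val_mono: "val m x = val n x" if "n \<le> m" and x: "x \<in> cells C n" for n m x
  proof -
    have "top_cell n \<in> cells (globe n :: 'u omega_cat) m"
      by (rule omega_category.cells_mono[OF omega_category_presented \<open>n \<le> m\<close> top_cell_cells])
    from val_map[OF globe_dense cell_map(1)[OF C x] this]
    show ?thesis by (simp add: val_def cell_map(2)[OF C x])
  qed
  define h where "h = (\<lambda>x\<in>carrier C. val (LEAST n. x \<in> cells C n) x)"
  have h: "h x = val n x" if x: "x \<in> cells C n" for n x
    using val_mono[OF Least_le[of "\<lambda>n. x \<in> cells C n", OF x] LeastI[of "\<lambda>n. x \<in> cells C n", OF x]]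
      C.cells_carrier[OF x] by (simp add: h_def)
  have val_cells: "val n x \<in> cells D n" if "x \<in> cells C n" for n x
    unfolding val_def
    by (rule omega_homD(6)[OF hom[OF globe_dense cell_map(1)[OF C that]] top_cell_cells])
  have h_hom: "h \<in> omega_hom C D"
  proof (rule omega_homI)
    show "h \<in> extensional (carrier C)" by (simp add: h_def)
    fix x assume x: "x \<in> carrier C"
    then obtain n where n: "x \<in> cells C n" using C.ex_cells by blast
    show "h x \<in> carrier D" unfolding h[OF n] by (rule D.cells_carrier[OF val_cells[OF n]])
    fix s k
    let ?f = "cell_map C n x"
    have f: "?f \<in> omega_hom (globe n) C" by (rule cell_map(1)[OF C n])
    have d: "dd (globe n :: 'u omega_cat) s k (top_cell n) \<in> cells (globe n) n"
      by (rule omega_category.dd_cells'[OF omega_category_presented top_cell_cells])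
    have fd: "?f (dd (globe n) s k (top_cell n)) = dd C s k x"
      using omega_homD(3)[OF f top_cell_carrier] cell_map(2)[OF C n] by simp
    have "h (dd C s k x) = val n (?f (dd (globe n) s k (top_cell n)))"
      unfolding fd by (rule h[OF C.dd_cells'[OF n]])
    also have "\<dots> = \<phi> (globe n) ?f (dd (globe n) s k (top_cell n))"
      using val_map[OF globe_dense f d] by simp
    also have "\<dots> = dd D s k (val n x)"
      using omega_homD(3)[OF hom[OF globe_dense f] top_cell_carrier] by (simp add: val_def)
    finally show "h (dd C s k x) = dd D s k (h x)" using h[OF n] by simp
  next
    fix m x y assume c: "composable C m x y"
    then obtain a b where ab: "x \<in> cells C a" "y \<in> cells C b" using C.composable_in C.ex_cells by blast
    \<comment> \<open>A dimension common to both cells and also above \<open>m\<close>, since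
      \<open>pairing n m\<close> is a dense shape only for \<open>m < n\<close>.\<close>
    define n where "n = Suc (max m (max a b))"
    have n: "m < n" "x \<in> cells C n" "y \<in> cells C n"
      using C.cells_mono[OF _ ab(1), of n] C.cells_mono[OF _ ab(2), of n] unfolding n_def by auto
    let ?T = "pairing n m :: 'u omega_cat"
    let ?f = "pair_map C n m x y"
    have T: "?T \<in> dense_shapes" by (rule pairing_dense[OF n(1)])
    note f = pair_map[OF C n(2,3) c]
    have "cmp ?T m (fst_gen n m) (snd_gen n m) \<in> cells ?T n"
      by (rule omega_category.cmp_cells[OF omega_category_presented pair_gens(3,1,2)])
    from val_map[OF T f(1) this]
    have "h (cmp C m x y) = \<phi> ?T ?f (cmp ?T m (fst_gen n m) (snd_gen n m))"
      using omega_homD(4)[OF f(1) pair_gens(3)] f(2,3) h[OF C.cmp_cells[OF c n(2,3)]] by simp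
    also have "\<dots> = cmp D m (\<phi> ?T ?f (fst_gen n m)) (\<phi> ?T ?f (snd_gen n m))"
      by (rule omega_homD(4)[OF hom[OF T f(1)] pair_gens(3)])
    also have "\<dots> = cmp D m (h x) (h y)"
      using val_map[OF T f(1) pair_gens(1)] val_map[OF T f(1) pair_gens(2)] f(2,3) h[OF n(2)] h[OF n(3)] by simp
    finally show "h (cmp C m x y) = cmp D m (h x) (h y)" .
  qed
  moreover have "\<phi> T f = compose (carrier T) h f" if T: "T \<in> dense_shapes" and f: "f \<in> omega_hom T C" for T f
  proof (rule PiE_ext[OF omega_homD(1)[OF hom[OF T f]]])
    have Tc: "is_omega_category T" using dense_shapes_Ob[OF T] by simp
    show "compose (carrier T) h f \<in> carrier T \<rightarrow>\<^sub>E carrier D"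
      by (rule omega_homD(1)[OF omega_hom_compose[OF f h_hom Tc]])
    fix z assume z: "z \<in> carrier T"
    then obtain n where n: "z \<in> cells T n"
      using omega_category.ex_cells[OF omega_category.intro[OF Tc]] by blast
    show "\<phi> T f z = compose (carrier T) h f z"
      using val_map[OF T f n] h[OF omega_homD(6)[OF f n]] z by (simp add: compose_eq)
  qed
  ultimately show ?thesis by blast
qed


section \<open>Colimit diagrams of globes\<close>

text \<open>The category of elements of \<open>hom(-, S)\<close> on the dense shapes. Its diagram
  consists of objects with strongly loop-free atomic bases, so the hypothesis on \<open>P\<close>
  applies to its colimit whenever \<open>S\<close> has such a basis too.\<close>

definition elements_cat :: "'u omega_cat \<Rightarrow> ('u omega_cat \<times> ('u \<Rightarrow> 'u), 'u \<Rightarrow> 'u) category" where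
  "elements_cat S =
     \<lparr>Ob = {(T, f). T \<in> dense_shapes \<and> f \<in> omega_hom T S},
      Hom = (\<lambda>(T, f) (T', f'). {h \<in> omega_hom T T'. compose (carrier T) f' h = f}),
      Idn = (\<lambda>(T, f). \<lambda>x\<in>carrier T. x),
      Cmp = (\<lambda>(T, f) b c h g. compose (carrier T) h g)\<rparr>"

definition elements_diagram :: "('u omega_cat \<times> ('u \<Rightarrow> 'u), 'u \<Rightarrow> 'u, 'u omega_cat, 'u \<Rightarrow> 'u) funct" where
  "elements_diagram = \<lparr>fob = fst, far = (\<lambda>a b h. h)\<rparr>"

lemma compose_assoc_hom:
  "f \<in> omega_hom A B \<Longrightarrow> compose (carrier A) h (compose (carrier A) g f) =
    compose (carrier A) (compose (carrier B) h g) f"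
  using omega_homD(2)[of f A B] by (auto simp: compose_def fun_eq_iff)

lemma is_category_elements: "is_category (elements_cat S)"
proof (rule is_categoryI)
  fix a assume "a \<in> Ob (elements_cat S)"
  then obtain T f where a: "a = (T, f)" "T \<in> dense_shapes" "f \<in> omega_hom T S"
    by (auto simp: elements_cat_def)
  then show "Idn (elements_cat S) a \<in> Hom (elements_cat S) a a"
    using omega_hom_id dense_shapes_Ob[of T] omega_homD(1)[OF a(3)]
    by (auto simp: elements_cat_def compose_def fun_eq_iff PiE_def extensional_def)
next
  fix a b c g h
  assume "a \<in> Ob (elements_cat S)" "b \<in> Ob (elements_cat S)" "c \<in> Ob (elements_cat S)"
    "g \<in> Hom (elements_cat S) a b" "h \<in> Hom (elements_cat S) b c"
  then show "Cmp (elements_cat S) a b c h g \<in> Hom (elements_cat S) a c"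
    using dense_shapes_Ob by (auto simp: elements_cat_def compose_assoc_hom intro!: omega_hom_compose)
next
  fix a b g
  assume "a \<in> Ob (elements_cat S)" "b \<in> Ob (elements_cat S)" and g: "g \<in> Hom (elements_cat S) a b"
  then have "g \<in> omega_hom (fst a) (fst b)" by (auto simp: elements_cat_def)
  then have "g \<in> carrier (fst a) \<rightarrow>\<^sub>E carrier (fst b)" by (rule omega_homD(1))
  then show "Cmp (elements_cat S) a a b g (Idn (elements_cat S) a) = g"
    "Cmp (elements_cat S) a b b (Idn (elements_cat S) b) g = g"
    by (cases a; cases b; auto simp: elements_cat_def compose_def fun_eq_iff PiE_def extensional_def)+
next
  fix a b c d f g h
  assume "f \<in> Hom (elements_cat S) a b"
  then show "Cmp (elements_cat S) a c d h (Cmp (elements_cat S) a b c g f) =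
      Cmp (elements_cat S) a b d (Cmp (elements_cat S) b c d h g) f"
    using compose_assoc_hom by (cases a; cases b) (auto simp: elements_cat_def)
qed

lemma small_elements:
  assumes S: "(S :: 'u omega_cat) \<in> Ob omega_Cat"
  shows "small_category TYPE('u) (elements_cat S)"
  unfolding small_category_def
proof (intro conjI ballI)
  have "countable (dense_shapes :: 'u omega_cat set)"
  proof -
    have "dense_shapes \<subseteq> range globe \<union> (\<lambda>(n, m). pairing n m :: 'u omega_cat) ` UNIV"
      by (auto simp: dense_shapes_def)
    then show ?thesis by (rule countable_subset) (simp only: countable_Un countable_image countableI_type)
  qed
  then have "small TYPE('u) (Sigma (dense_shapes :: 'u omega_cat set) (\<lambda>T. omega_hom T S))"
  proof (rule small_Sigma[OF inacc small_countable[OF inacc]])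
    show "small TYPE('u) (omega_hom T S)" if "T \<in> dense_shapes" for T :: "'u omega_cat"
      using small_omega_hom[OF inacc, of T S] dense_shapes_Ob[OF that] S by simp
  qed
  moreover have "Ob (elements_cat S) = Sigma dense_shapes (\<lambda>T. omega_hom T S)"
    by (auto simp: elements_cat_def)
  ultimately show "small TYPE('u) (Ob (elements_cat S))" by simp
  fix a b assume ab: "a \<in> Ob (elements_cat S)" "b \<in> Ob (elements_cat S)"
  then have "small TYPE('u) (omega_hom (fst a) (fst b))"
    using small_omega_hom[OF inacc, of "fst a" "fst b"] dense_shapes_Ob by (auto simp: elements_cat_def)
  then show "small TYPE('u) (Hom (elements_cat S) a b)"
    by (rule small_subset) (cases a; cases b; auto simp: elements_cat_def)
qed (rule is_category_elements)

lemma is_functor_elements: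
  "is_functor (elements_cat S) (full_subcat (omega_Cat :: ('u omega_cat, 'u \<Rightarrow> 'u) category) slf) elements_diagram"
proof (rule is_functorI[OF is_category_elements is_category_full_subcat[OF is_category_omega_Cat]])
  show "fob elements_diagram a \<in> Ob (full_subcat omega_Cat slf)" if "a \<in> Ob (elements_cat S)"
    for a :: "'u omega_cat \<times> ('u \<Rightarrow> 'u)"
    using that dense_shapes_Ob dense_shapes_slf by (auto simp: elements_cat_def elements_diagram_def)
qed (auto simp: elements_cat_def elements_diagram_def)

lemma is_functor_full_subcat:
  "is_functor J (full_subcat C X) D \<Longrightarrow> is_category C \<Longrightarrow> is_functor J C D"
  unfolding is_functor_def by simp

text \<open>A cocone on this diagram is a family natural in the shape, which is what
  \<open>density\<close> turns into a morphism.\<close>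

lemma colimit_elements:
  assumes S: "(S :: 'u omega_cat) \<in> Ob omega_Cat"
  shows "is_colimit (elements_cat S) omega_Cat elements_diagram S snd"
  unfolding is_colimit_def
proof (intro conjI allI impI)
  show "is_functor (elements_cat S) omega_Cat elements_diagram"
    by (rule is_functor_full_subcat[OF is_functor_elements is_category_omega_Cat])
  show "is_cocone (elements_cat S) omega_Cat elements_diagram S snd"
    using S by (auto simp: is_cocone_def elements_cat_def elements_diagram_def)
  fix C \<iota> assume cc: "is_cocone (elements_cat S) omega_Cat elements_diagram C \<iota>"
  have Sc: "is_omega_category S" using S by simp
  have C: "is_omega_category C" using cc by (simp add: is_cocone_def)
  have hom: "\<iota> (T, f) \<in> omega_hom T C" if "T \<in> dense_shapes" "f \<in> omega_hom T S" for T f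
    using cc that by (auto simp: is_cocone_def elements_cat_def elements_diagram_def)
  have "\<exists>h\<in>omega_hom S C. \<forall>T\<in>dense_shapes. \<forall>f\<in>omega_hom T S. \<iota> (T, f) = compose (carrier T) h f"
  proof (rule density[OF Sc C])
    fix T T' f g
    assume T: "T \<in> dense_shapes" "T' \<in> dense_shapes" "g \<in> omega_hom T' T" "f \<in> omega_hom T S"
    have "(T', compose (carrier T') f g) \<in> Ob (elements_cat S)" "(T, f) \<in> Ob (elements_cat S)"
      "g \<in> Hom (elements_cat S) (T', compose (carrier T') f g) (T, f)"
      using T dense_shapes_Ob by (auto simp: elements_cat_def intro!: omega_hom_compose)
    then have "Cmp omega_Cat (fob elements_diagram (T', compose (carrier T') f g)) (fob elements_diagram (T, f)) C
        (\<iota> (T, f)) (far elements_diagram (T', compose (carrier T') f g) (T, f) g) =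
      \<iota> (T', compose (carrier T') f g)"
      using cc unfolding is_cocone_def by blast
    then show "\<iota> (T', compose (carrier T') f g) = compose (carrier T') (\<iota> (T, f)) g"
      by (simp add: elements_diagram_def)
  qed (rule hom)
  then obtain h where h: "h \<in> omega_hom S C"
    "\<And>T f. T \<in> dense_shapes \<Longrightarrow> f \<in> omega_hom T S \<Longrightarrow> \<iota> (T, f) = compose (carrier T) h f" by blast
  show "\<exists>!h. h \<in> Hom omega_Cat S C \<and> (\<forall>j\<in>Ob (elements_cat S).
      Cmp omega_Cat (fob elements_diagram j) S C h (snd j) = \<iota> j)"
  proof (rule ex1I[of _ h])
    show "h \<in> Hom omega_Cat S C \<and> (\<forall>j\<in>Ob (elements_cat S).
      Cmp omega_Cat (fob elements_diagram j) S C h (snd j) = \<iota> j)"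
      using h by (auto simp: elements_cat_def elements_diagram_def)
    fix k assume k: "k \<in> Hom omega_Cat S C \<and> (\<forall>j\<in>Ob (elements_cat S).
      Cmp omega_Cat (fob elements_diagram j) S C k (snd j) = \<iota> j)"
    show "k = h"
    proof (rule density_unique[OF Sc _ h(1)])
      show "k \<in> omega_hom S C" using k by simp
      fix n f assume f: "f \<in> omega_hom (globe n) S"
      then have "(globe n, f) \<in> Ob (elements_cat S)" by (simp add: elements_cat_def globe_dense)
      then show "compose (carrier (globe n)) k f = compose (carrier (globe n)) h f"
        using k h(2)[OF globe_dense f] by (force simp: elements_diagram_def)
    qed
  qed
qed

end


text \<open>A presented omega-category is a colimit of globes: one for each generator and one for each
  relation \<open>(i, m, j)\<close>, mapped to the globes of \<open>i\<close> and \<open>j\<close> by arrows 1 and 2.  Arrow 0 is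
  always the identity, so that one of two composable arrows is 0.\<close>

definition gluing_cat :: "nat \<Rightarrow> relations \<Rightarrow> (nat + nat \<times> nat \<times> nat, nat) category" where
  "gluing_cat k R =
     \<lparr>Ob = Inl ` {..<k} \<union> Inr ` {(i, m, j) \<in> R. i < k \<and> j < k},
      Hom = (\<lambda>a b. if a = b then {0} else
        (case (a, b) of (Inr (i, m, j), Inl l) \<Rightarrow> {v. v = 1 \<and> l = i \<or> v = 2 \<and> l = j} | _ \<Rightarrow> {})),
      Idn = (\<lambda>a. 0), Cmp = (\<lambda>a b c g f. f + g)\<rparr>"

text \<open>The boundary of dimension \<open>m\<close> as an endomorphism of the
  \<open>n\<close>-globe. Relations are glued along copies of \<open>globe n\<close> rather than of
  \<open>globe m\<close>, so the same object stands at every vertex of the diagram.\<close>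

definition glue_map :: "nat \<Rightarrow> sign \<Rightarrow> nat \<Rightarrow> 'u \<Rightarrow> 'u" where
  "glue_map n s m = cell_map (globe n) n (dd (globe n) s m (top_cell n))"

definition gluing_diagram ::
    "nat \<Rightarrow> (nat + nat \<times> nat \<times> nat, nat, 'u omega_cat, 'u \<Rightarrow> 'u) funct" where
  "gluing_diagram n =
     \<lparr>fob = (\<lambda>a. globe n),
      far = (\<lambda>a b v. if v = 0 then (\<lambda>x\<in>carrier (globe n). x)
        else glue_map n (if v = 1 then Plus else Minus) (case a of Inr (i, m, j) \<Rightarrow> m))\<rparr>"

definition gluing_cocone ::
    "nat \<Rightarrow> nat \<Rightarrow> relations \<Rightarrow> nat + nat \<times> nat \<times> nat \<Rightarrow> 'u \<Rightarrow> 'u" where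
  "gluing_cocone n k R a = cell_map (presented n k R) n
     (case a of Inl i \<Rightarrow> generator n k R i
      | Inr (i, m, j) \<Rightarrow> dd (presented n k R) Plus m (generator n k R i))"

lemma is_category_gluing: "is_category (gluing_cat k R)"
  by (rule is_categoryI) (auto simp: gluing_cat_def split: if_splits sum.splits)

context
  assumes inacc: "inaccessible TYPE('u)"
begin

lemma small_gluing: "small_category TYPE('u) (gluing_cat k R)"
  unfolding small_category_def
  by (intro conjI ballI is_category_gluing small_countable[OF inacc] countableI_type)

lemma globe_category: "is_omega_category (globe n :: 'u omega_cat)"
  by (rule is_omega_category_presented[OF inacc])

lemma dd_top_cell: "dd (globe n :: 'u omega_cat) s m (top_cell n) \<in> cells (globe n) n"
  by (rule omega_category.dd_cells'[OF omega_category_presented[OF inacc] top_cell_cells[OF inacc]])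

lemma glue_map: "(glue_map n s m :: 'u \<Rightarrow> 'u) \<in> omega_hom (globe n) (globe n)"
  "(glue_map n s m :: 'u \<Rightarrow> 'u) (top_cell n) = dd (globe n) s m (top_cell n)"
  unfolding glue_map_def using cell_map[OF inacc globe_category dd_top_cell] by auto

lemma compose_glue_map:
  assumes C: "is_omega_category (C :: 'u omega_cat)" and f: "f \<in> omega_hom (globe n) C"
  shows "compose (carrier (globe n)) f (glue_map n s m) = cell_map C n (dd C s m (f (top_cell n)))"
  unfolding glue_map_def compose_cell_map[OF inacc globe_category C f dd_top_cell]
  using omega_homD(3)[OF f top_cell_carrier[OF inacc]] by simp

lemma compose_restrict_id:
  assumes "f \<in> carrier A \<rightarrow>\<^sub>E B"
  shows "compose (carrier A) f (\<lambda>x\<in>carrier A. x) = f"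
    "(\<And>x. x \<in> carrier A \<Longrightarrow> f x \<in> B') \<Longrightarrow> compose (carrier A) (\<lambda>x\<in>B'. x) f = f"
  using assms by (auto simp: compose_def fun_eq_iff PiE_def extensional_def)

lemma is_functor_gluing:
  "is_functor (gluing_cat k R) (full_subcat (omega_Cat :: ('u omega_cat, 'u \<Rightarrow> 'u) category) slf)
    (gluing_diagram n)"
proof (rule is_functorI[OF is_category_gluing is_category_full_subcat[OF is_category_omega_Cat]])
  show "fob (gluing_diagram n) a \<in> Ob (full_subcat (omega_Cat :: ('u omega_cat, 'u \<Rightarrow> 'u) category) slf)"
    for a
    using presented_in_omega_Cat[OF inacc] slf_globe[OF inacc] by (simp add: gluing_diagram_def)
  show far: "far (gluing_diagram n) a b v \<in>
      Hom (full_subcat (omega_Cat :: ('u omega_cat, 'u \<Rightarrow> 'u) category) slf)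
        (fob (gluing_diagram n) a) (fob (gluing_diagram n) b)" for a b v
    using glue_map(1) omega_hom_id[OF globe_category] by (simp add: gluing_diagram_def)
  fix a b c v w
  assume "v \<in> Hom (gluing_cat k R) a b" "w \<in> Hom (gluing_cat k R) b c"
  then have vw: "v = 0 \<and> a = b \<or> w = 0"
    by (auto simp: gluing_cat_def split: if_splits sum.splits)
  have "(far (gluing_diagram n) a b v :: 'u \<Rightarrow> 'u) \<in> omega_hom (globe n) (globe n)" for a b v
    using far[of a b v] by (simp add: gluing_diagram_def)
  note h = omega_homD(1,2)[OF this]
  show "far (gluing_diagram n) a c (Cmp (gluing_cat k R) a b c w v) =
      Cmp (full_subcat (omega_Cat :: ('u omega_cat, 'u \<Rightarrow> 'u) category) slf)
        (fob (gluing_diagram n) a) (fob (gluing_diagram n) b) (fob (gluing_diagram n) c)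
        (far (gluing_diagram n) b c w) (far (gluing_diagram n) a b v)"
    using vw
  proof
    assume v: "v = 0 \<and> a = b"
    then show ?thesis
      using compose_restrict_id(1)[OF h(1)[of b c w]]
      by (simp add: gluing_cat_def) (simp add: gluing_diagram_def)
  next
    assume w: "w = 0"
    have "(far (gluing_diagram n) a c v :: 'u \<Rightarrow> 'u) = far (gluing_diagram n) a b v"
      by (simp add: gluing_diagram_def)
    then show ?thesis
      using w compose_restrict_id(2)[OF h(1)[of a b v] h(2)]
      by (simp add: gluing_cat_def) (simp add: gluing_diagram_def)
  qed
qed (simp add: gluing_cat_def gluing_diagram_def)

text \<open>A cocone amounts to a choice of one \<open>n\<close>-cell for each generator such that
  the leg at a relation classifies both the \<open>m\<close>-target of the one cell and the
  \<open>m\<close>-source of the other. This is a family satisfying the relations, so the claim is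
  the universal property of the presentation.\<close>

lemma colimit_gluing:
  "is_colimit (gluing_cat k R) omega_Cat (gluing_diagram n) (presented n k R :: 'u omega_cat)
    (gluing_cocone n k R)"
  unfolding is_colimit_def
proof (intro conjI allI impI)
  let ?P = "presented n k R :: 'u omega_cat" and ?g = "generator n k R :: nat \<Rightarrow> 'u" and ?G = "globe n :: 'u omega_cat"
  interpret P: omega_category ?P by (rule omega_category_presented[OF inacc])
  have P: "is_omega_category ?P" by (rule P.omega)
  have g: "?g i \<in> cells ?P n" if "i < k" for i by (rule generator_cells[OF inacc that])
  have rel: "dd ?P Plus m (?g i) = dd ?P Minus m (?g j)" if "(i, m, j) \<in> R" "i < k" "j < k" for i m j
    by (rule presented_rel(1)[OF inacc that])
  show "is_functor (gluing_cat k R) (omega_Cat :: ('u omega_cat, 'u \<Rightarrow> 'u) category) (gluing_diagram n)"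
    by (rule is_functor_full_subcat[OF inacc is_functor_gluing is_category_omega_Cat])
  have co_hom: "gluing_cocone n k R a \<in> omega_hom ?G ?P" if "a \<in> Ob (gluing_cat k R)" for a
    using that g P.dd_cells' cell_map(1)[OF inacc P]
    by (auto simp: gluing_cat_def gluing_cocone_def)
  show "is_cocone (gluing_cat k R) omega_Cat (gluing_diagram n) ?P (gluing_cocone n k R)"
    unfolding is_cocone_def
  proof (intro conjI ballI)
    show "?P \<in> Ob omega_Cat" by (rule presented_in_omega_Cat[OF inacc])
    show "gluing_cocone n k R a \<in> Hom omega_Cat (fob (gluing_diagram n) a) ?P"
      if "a \<in> Ob (gluing_cat k R)" for a
      using co_hom[OF that] by (simp add: gluing_diagram_def)
    fix a b v assume a: "a \<in> Ob (gluing_cat k R)" and b: "b \<in> Ob (gluing_cat k R)"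
      and v: "v \<in> Hom (gluing_cat k R) a b"
    show "Cmp omega_Cat (fob (gluing_diagram n) a) (fob (gluing_diagram n) b) ?P
        (gluing_cocone n k R b) (far (gluing_diagram n) a b v) = gluing_cocone n k R a"
    proof (cases "a = b")
      case True
      then show ?thesis
        using v compose_restrict_id(1)[OF omega_homD(1)[OF co_hom[OF b]]]
        by (simp add: gluing_cat_def gluing_diagram_def)
    next
      case False
      then obtain i m j l where ab: "a = Inr (i, m, j)" "b = Inl l" "v = 1 \<and> l = i \<or> v = 2 \<and> l = j"
        using v by (auto simp: gluing_cat_def split: if_splits sum.splits)
      have r: "(i, m, j) \<in> R" "i < k" "j < k" using a ab by (auto simp: gluing_cat_def)
      have l: "l < k" using b ab by (auto simp: gluing_cat_def)
      have "compose (carrier ?G) (gluing_cocone n k R b) (glue_map n s m) =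
          cell_map ?P n (dd ?P s m (?g l))" for s
        using compose_glue_map[OF P co_hom[OF b], of s m] cell_map(2)[OF inacc P g[OF l]] ab
        by (simp add: gluing_cocone_def)
      then show ?thesis
        using ab rel[OF r] by (auto simp: gluing_diagram_def gluing_cocone_def)
    qed
  qed
  fix C :: "'u omega_cat" and \<iota> assume cc: "is_cocone (gluing_cat k R) omega_Cat (gluing_diagram n) C \<iota>"
  have C: "is_omega_category C" using cc by (simp add: is_cocone_def)
  have \<iota>: "\<iota> a \<in> omega_hom ?G C" if "a \<in> Ob (gluing_cat k R)" for a
    using cc that by (simp add: is_cocone_def gluing_diagram_def)
  define x where "x i = \<iota> (Inl i) (top_cell n)" for i
  have obl: "Inl i \<in> Ob (gluing_cat k R)" if "i < k" for i using that by (simp add: gluing_cat_def)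
  have x: "x i \<in> cells C n" if "i < k" for i
    unfolding x_def by (rule omega_homD(6)[OF \<iota>[OF obl[OF that]] top_cell_cells[OF inacc]])
  have \<iota>r: "cell_map C n (dd C Plus m (x i)) = \<iota> (Inr (i, m, j))"
     "cell_map C n (dd C Minus m (x j)) = \<iota> (Inr (i, m, j))"
    if r: "(i, m, j) \<in> R" "i < k" "j < k" for i m j
  proof -
    have ob: "Inr (i, m, j) \<in> Ob (gluing_cat k R)" using r by (simp add: gluing_cat_def)
    have "compose (carrier ?G) (\<iota> (Inl i)) (glue_map n Plus m) = \<iota> (Inr (i, m, j))"
    proof -
      have "1 \<in> Hom (gluing_cat k R) (Inr (i, m, j)) (Inl i)" by (simp add: gluing_cat_def)
      then have "Cmp omega_Cat (fob (gluing_diagram n) (Inr (i, m, j))) (fob (gluing_diagram n) (Inl i)) C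
          (\<iota> (Inl i)) (far (gluing_diagram n) (Inr (i, m, j)) (Inl i) 1) = \<iota> (Inr (i, m, j))"
        using cc ob obl[OF r(2)] unfolding is_cocone_def by blast
      then show ?thesis by (simp add: gluing_diagram_def)
    qed
    then show "cell_map C n (dd C Plus m (x i)) = \<iota> (Inr (i, m, j))"
      using compose_glue_map[OF C \<iota>[OF obl[OF r(2)]]] by (simp add: x_def)
    have "compose (carrier ?G) (\<iota> (Inl j)) (glue_map n Minus m) = \<iota> (Inr (i, m, j))"
    proof -
      have "2 \<in> Hom (gluing_cat k R) (Inr (i, m, j)) (Inl j)" by (simp add: gluing_cat_def)
      then have "Cmp omega_Cat (fob (gluing_diagram n) (Inr (i, m, j))) (fob (gluing_diagram n) (Inl j)) C
          (\<iota> (Inl j)) (far (gluing_diagram n) (Inr (i, m, j)) (Inl j) 2) = \<iota> (Inr (i, m, j))"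
        using cc ob obl[OF r(3)] unfolding is_cocone_def by blast
      then show ?thesis by (simp add: gluing_diagram_def)
    qed
    then show "cell_map C n (dd C Minus m (x j)) = \<iota> (Inr (i, m, j))"
      using compose_glue_map[OF C \<iota>[OF obl[OF r(3)]]] by (simp add: x_def)
  qed
  interpret C: omega_category C using C by unfold_locales
  have "dd C Plus m (x i) = dd C Minus m (x j)" if r: "(i, m, j) \<in> R" "i < k" "j < k" for i m j
    using cell_map(2)[OF inacc C C.dd_cells'[OF x[OF r(2)]], of Plus m]
      cell_map(2)[OF inacc C C.dd_cells'[OF x[OF r(3)]], of Minus m] \<iota>r[OF r] by simp
  then have sat: "satisfies n k R C x" using x by (auto simp: satisfies_def)
  let ?h = "classify n k R C x"
  have h: "?h \<in> omega_hom ?P C" "\<And>i. i < k \<Longrightarrow> ?h (?g i) = x i"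
    using classify_hom[OF inacc C sat] classify_generator[OF inacc C sat] by auto
  show "\<exists>!h. h \<in> Hom omega_Cat ?P C \<and> (\<forall>j\<in>Ob (gluing_cat k R).
      Cmp omega_Cat (fob (gluing_diagram n) j) ?P C h (gluing_cocone n k R j) = \<iota> j)"
  proof (rule ex1I[of _ ?h])
    have "compose (carrier ?G) ?h (gluing_cocone n k R a) = \<iota> a" if a: "a \<in> Ob (gluing_cat k R)" for a
    proof (cases a)
      case (Inl i)
      then have i: "i < k" using a by (auto simp: gluing_cat_def)
      have "compose (carrier ?G) ?h (cell_map ?P n (?g i)) = cell_map C n (x i)"
        using compose_cell_map[OF inacc P C h(1) g[OF i]] h(2)[OF i] by simp
      also have "\<dots> = \<iota> a"
        using hom_eq_cell_map(1)[OF inacc C \<iota>[OF a]] Inl by (simp add: x_def)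
      finally show ?thesis using Inl by (simp add: gluing_cocone_def)
    next
      case (Inr r)
      then obtain i m j where r: "r = (i, m, j)" "(i, m, j) \<in> R" "i < k" "j < k"
        using a by (auto simp: gluing_cat_def)
      have "compose (carrier ?G) ?h (cell_map ?P n (dd ?P Plus m (?g i))) = cell_map C n (dd C Plus m (x i))"
        using compose_cell_map[OF inacc P C h(1) P.dd_cells'[OF g[OF r(3)]]]
          omega_homD(3)[OF h(1) P.cells_carrier[OF g[OF r(3)]]] h(2)[OF r(3)] by simp
      then show ?thesis using \<iota>r(1)[OF r(2-4)] Inr r(1) by (simp add: gluing_cocone_def)
    qed
    then show "?h \<in> Hom omega_Cat ?P C \<and> (\<forall>j\<in>Ob (gluing_cat k R).
      Cmp omega_Cat (fob (gluing_diagram n) j) ?P C ?h (gluing_cocone n k R j) = \<iota> j)"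
      using h(1) by (simp add: gluing_diagram_def)
    fix f assume f: "f \<in> Hom omega_Cat ?P C \<and> (\<forall>j\<in>Ob (gluing_cat k R).
      Cmp omega_Cat (fob (gluing_diagram n) j) ?P C f (gluing_cocone n k R j) = \<iota> j)"
    show "f = ?h"
    proof (rule presented_hom_eq[OF inacc _ h(1)])
      show "f \<in> omega_hom ?P C" using f by simp
      fix i assume i: "i < k"
      have "compose (carrier ?G) f (cell_map ?P n (?g i)) (top_cell n) = \<iota> (Inl i) (top_cell n)"
        using f obl[OF i] by (force simp: gluing_diagram_def gluing_cocone_def)
      then show "f (?g i) = ?h (?g i)"
        using h(2)[OF i] cell_map(2)[OF inacc P g[OF i]]
        by (simp add: compose_eq top_cell_carrier[OF inacc] x_def)
    qed
  qed
qed

end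


section \<open>Reconstruction of an omega-category from a functor\<close>

lemma (in omega_category) assoc_composable:
  assumes "composable C n x y" "composable C n y z"
  shows "composable C n (cmp C n x y) z" "composable C n x (cmp C n y z)"
  using assms cmp_plus[OF assms(1)] cmp_minus[OF assms(2)] cmp_closed[OF assms(1)] cmp_closed[OF assms(2)]
  by (simp_all add: composable_def)

lemma (in omega_category) interchange_composable:
  assumes "m < n" "composable C n x y" "composable C n x' y'" "composable C m x x'"
  shows "composable C m (cmp C n x y) (cmp C n x' y')" "composable C m y y'"
    "composable C n (cmp C m x x') (cmp C m y y')"
proof -
  show "composable C m (cmp C n x y) (cmp C n x' y')"
    using assms(4) cmp_less[OF assms(2,1)] cmp_less[OF assms(3,1)]
      cmp_closed[OF assms(2)] cmp_closed[OF assms(3)] unfolding composable_def by simp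
  show yy': "composable C m y y'"
    using assms(4) dd_less_eq[OF assms(2,1), of Plus] dd_less_eq[OF assms(3,1), of Minus]
      composable_in[OF assms(2)] composable_in[OF assms(3)] unfolding composable_def by simp
  show "composable C n (cmp C m x x') (cmp C m y y')"
    using cmp_greater[OF assms(4,1), of Plus] cmp_greater[OF yy' assms(1), of Minus]
      cmp_closed[OF assms(4)] cmp_closed[OF yy'] assms(2,3) unfolding composable_def by simp
qed

text \<open>The isomorphism points from \<open>G\<close> to \<open>F\<close>: the bijections
  constructed below start at \<open>P\<close>, while essential surjectivity wants an arrow ending
  there.\<close>

lemma iso_in_functor_cat_set:
  assumes F: "is_functor C (set_cat u) F" and G: "is_functor C (set_cat u) G"
    and bij: "\<And>a. a \<in> Ob C \<Longrightarrow> bij_betw (\<eta> a) (fob F a) (fob G a)"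
    and nat: "\<And>a b f x. a \<in> Ob C \<Longrightarrow> b \<in> Ob C \<Longrightarrow> f \<in> Hom C a b \<Longrightarrow> x \<in> fob F a \<Longrightarrow>
      \<eta> b (far F a b f x) = far G a b f (\<eta> a x)"
  shows "\<exists>\<phi>. is_iso_arrow (functor_cat C (set_cat u)) G F \<phi>"
proof -
  define \<psi> where "\<psi> = (\<lambda>a\<in>Ob C. \<lambda>x\<in>fob F a. \<eta> a x)"
  define \<phi> where "\<phi> = (\<lambda>a\<in>Ob C. \<lambda>y\<in>fob G a. inv_into (fob F a) (\<eta> a) y)"
  have Fm: "far F a b f x \<in> fob F b" if "a \<in> Ob C" "b \<in> Ob C" "f \<in> Hom C a b" "x \<in> fob F a" for a b f x
    using functor_ar[OF F that(1-3)] that(4) by auto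
  have Gm: "far G a b f x \<in> fob G b" if "a \<in> Ob C" "b \<in> Ob C" "f \<in> Hom C a b" "x \<in> fob G a" for a b f x
    using functor_ar[OF G that(1-3)] that(4) by auto
  have \<eta>: "\<eta> a x \<in> fob G a" if "a \<in> Ob C" "x \<in> fob F a" for a x
    using bij_betwE[OF bij[OF that(1)]] that(2) by blast
  have \<theta>: "inv_into (fob F a) (\<eta> a) y \<in> fob F a" "\<eta> a (inv_into (fob F a) (\<eta> a) y) = y"
    if "a \<in> Ob C" "y \<in> fob G a" for a y
    using bij[OF that(1)] that(2) by (auto simp: bij_betw_def inv_into_into f_inv_into_f)
  have \<theta>\<eta>: "inv_into (fob F a) (\<eta> a) (\<eta> a x) = x" if "a \<in> Ob C" "x \<in> fob F a" for a x
    using bij[OF that(1)] that(2) by (simp add: bij_betw_def)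
  have \<theta>nat: "inv_into (fob F b) (\<eta> b) (far G a b f y) = far F a b f (inv_into (fob F a) (\<eta> a) y)"
    if "a \<in> Ob C" "b \<in> Ob C" "f \<in> Hom C a b" "y \<in> fob G a" for a b f y
    using nat[OF that(1-3) \<theta>(1)[OF that(1,4)]] \<theta>[OF that(1,4)]
      \<theta>\<eta>[OF that(2) Fm[OF that(1-3) \<theta>(1)[OF that(1,4)]]] by simp
  have "\<phi> \<in> Hom (functor_cat C (set_cat u)) G F"
    using \<theta> \<theta>nat Gm by (auto simp: is_nat_trans_def \<phi>_def compose_def fun_eq_iff)
  moreover have "\<psi> \<in> Hom (functor_cat C (set_cat u)) F G"
    using \<eta> nat Fm by (auto simp: is_nat_trans_def \<psi>_def compose_def fun_eq_iff)
  moreover have "Cmp (functor_cat C (set_cat u)) G F G \<psi> \<phi> = Idn (functor_cat C (set_cat u)) G"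
    using \<theta> by (auto simp: \<phi>_def \<psi>_def compose_def fun_eq_iff)
  moreover have "Cmp (functor_cat C (set_cat u)) F G F \<phi> \<psi> = Idn (functor_cat C (set_cat u)) F"
    using \<theta>\<eta> \<eta> by (auto simp: \<phi>_def \<psi>_def compose_def fun_eq_iff)
  ultimately show ?thesis unfolding is_iso_arrow_def by blast
qed

locale colimit_to_limit_functor =
  fixes P :: "('u omega_cat, 'u \<Rightarrow> 'u, ('u \<Rightarrow> 'u) set, ('u \<Rightarrow> 'u) \<Rightarrow> 'u \<Rightarrow> 'u) funct"
  assumes inacc: "inaccessible TYPE('u)"
    and P: "is_functor (op_cat (full_subcat omega_Cat slf)) (set_cat TYPE('u)) P"
    and lim: "takes_colimits_to_limits TYPE('u) omega_Cat slf P"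
begin

abbreviation "FF \<equiv> Ob (full_subcat (omega_Cat :: ('u omega_cat, 'u \<Rightarrow> 'u) category) slf)"

lemma FF_category: "T \<in> FF \<Longrightarrow> omega_category T" by (simp add: omega_category_def)

lemma presented_FF: "has_slf_atomic_basis (presented n k R :: 'u omega_cat) \<Longrightarrow> presented n k R \<in> FF"
  using presented_in_omega_Cat[OF inacc] by simp

lemma dense_FF: "(T :: 'u omega_cat) \<in> dense_shapes \<Longrightarrow> T \<in> FF"
  using dense_shapes_Ob[OF inacc] dense_shapes_slf[OF inacc] by simp

lemma globe_FF: "globe n \<in> FF"
  by (rule dense_FF[OF globe_dense[OF inacc]])

section \<open>Elements of the functor, their restriction along morphisms, and germs\<close>

abbreviation act :: "'u omega_cat \<Rightarrow> 'u omega_cat \<Rightarrow> ('u \<Rightarrow> 'u) \<Rightarrow> ('u \<Rightarrow> 'u) \<Rightarrow> 'u \<Rightarrow> 'u" where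
  "act S T h p \<equiv> far P T S h p"

lemma act_in: "S \<in> FF \<Longrightarrow> T \<in> FF \<Longrightarrow> h \<in> omega_hom S T \<Longrightarrow> p \<in> fob P T \<Longrightarrow> act S T h p \<in> fob P S"
  using functor_ar[OF P, of T S h] by auto

lemma act_id: "T \<in> FF \<Longrightarrow> p \<in> fob P T \<Longrightarrow> act T T (\<lambda>x\<in>carrier T. x) p = p"
  using functor_idn[OF P, of T] by simp

lemma act_comp:
  assumes "S \<in> FF" "T \<in> FF" "V \<in> FF" "g \<in> omega_hom S T" "h \<in> omega_hom T V" "p \<in> fob P V"
  shows "act S V (compose (carrier S) h g) p = act S T g (act T V h p)"
  using functor_cmp[OF P, of V T S h g] assms by (simp add: compose_eq)

text \<open>One formula covers both directions: for \<open>k < n\<close> it is the inclusion of the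
  iterated source, and for \<open>n \<le> k\<close> the collapse of the larger globe onto the
  smaller, as the top cell is then its own \<open>k\<close>-source.\<close>

definition restr :: "nat \<Rightarrow> nat \<Rightarrow> 'u \<Rightarrow> 'u" where
  "restr k n = cell_map (globe n) k (dd (globe n) Minus k (top_cell n))"

lemma restr: "restr k n \<in> omega_hom (globe k) (globe n)"
  "restr k n (top_cell k) = dd (globe n) Minus k (top_cell n)"
proof -
  have "dd (globe n :: 'u omega_cat) Minus k (top_cell n) \<in> cells (globe n) k"
    by (rule omega_category.dd_cells[OF omega_category_presented[OF inacc] top_cell_carrier[OF inacc]])
  then show "restr k n \<in> omega_hom (globe k) (globe n)"
    "restr k n (top_cell k) = dd (globe n) Minus k (top_cell n)"
    unfolding restr_def using cell_map[OF inacc globe_category[OF inacc]] by auto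
qed

lemma dd_top: "n \<le> m \<Longrightarrow> dd (globe n :: 'u omega_cat) s m (top_cell n) = top_cell n"
  by (rule omega_category.cells_dd[OF omega_category_presented[OF inacc] top_cell_cells[OF inacc]])

lemma top_cells: "n \<le> m \<Longrightarrow> (top_cell n :: 'u) \<in> cells (globe n) m"
  by (rule omega_category.cells_mono[OF omega_category_presented[OF inacc] _ top_cell_cells[OF inacc]])

lemma restr_top: "n \<le> m \<Longrightarrow> restr m n (top_cell m) = top_cell n"
  using restr(2) dd_top by simp

lemma cell_map_top: "cell_map (globe n :: 'u omega_cat) n (top_cell n) = (\<lambda>x\<in>carrier (globe n). x)"
  using hom_eq_cell_map(1)[OF inacc globe_category[OF inacc] omega_hom_id[OF globe_category[OF inacc]]]
    top_cell_carrier[OF inacc] by simp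

lemma cell_map_restr:
  assumes T: "is_omega_category (T :: 'u omega_cat)" and x: "x \<in> cells T n" and "n \<le> m"
  shows "cell_map T m x = compose (carrier (globe m)) (cell_map T n x) (restr m n)"
proof -
  have "restr m n = cell_map (globe n) m (top_cell n)" unfolding restr_def dd_top[OF \<open>n \<le> m\<close>] ..
  then show ?thesis
    using compose_cell_map[OF inacc globe_category[OF inacc] T cell_map(1)[OF inacc T x] top_cells[OF \<open>n \<le> m\<close>]]
      cell_map(2)[OF inacc T x] by simp
qed

text \<open>A cell is coded by the sequence of its iterated sources, where the identities on a cell
  count as its sources in the dimensions above: this code does not depend on the globe used to
  represent the cell.\<close>

definition gseq :: "nat \<Rightarrow> ('u \<Rightarrow> 'u) \<Rightarrow> nat \<Rightarrow> 'u \<Rightarrow> 'u" where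
  "gseq n a = (\<lambda>k. act (globe k) (globe n) (restr k n) a)"

lemma gseq_self: "a \<in> fob P (globe n) \<Longrightarrow> gseq n a n = a"
  unfolding gseq_def restr_def dd_top[OF order_refl] cell_map_top by (rule act_id[OF globe_FF])

text \<open>An identity has the same iterated sources as the cell it belongs to:
  \<open>restr k m\<close> followed by the collapse \<open>restr m n\<close> is
  \<open>restr k n\<close>, as a look at the top cell shows.\<close>

lemma gseq_raise:
  assumes a: "a \<in> fob P (globe n)" and nm: "n \<le> m"
  shows "gseq m (act (globe m) (globe n) (restr m n) a) = gseq n a"
proof
  fix k
  have "restr k n = compose (carrier (globe k)) (restr m n) (restr k m)"
  proof (rule globe_hom_eq[OF inacc restr(1)])
    show "compose (carrier (globe k)) (restr m n) (restr k m) \<in> omega_hom (globe k) (globe n)"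
      by (rule omega_hom_compose[OF restr(1) restr(1) globe_category[OF inacc]])
    have "compose (carrier (globe k)) (restr m n) (restr k m) (top_cell k) =
        restr m n (dd (globe m) Minus k (top_cell m))"
      by (simp add: compose_eq top_cell_carrier[OF inacc] restr(2))
    also have "\<dots> = restr k n (top_cell k)"
      using omega_homD(3)[OF restr(1) top_cell_carrier[OF inacc]] restr_top[OF nm] restr(2) by simp
    finally show "restr k n (top_cell k) = compose (carrier (globe k)) (restr m n) (restr k m) (top_cell k)"
      by simp
  qed
  then show "gseq m (act (globe m) (globe n) (restr m n) a) k = gseq n a k"
    unfolding gseq_def using act_comp[OF globe_FF globe_FF globe_FF restr(1) restr(1) a] by simp
qed

definition seqs :: "(nat \<Rightarrow> 'u \<Rightarrow> 'u) set" where
  "seqs = {gseq n a | n a. a \<in> fob P (globe n)}"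

lemma small_seqs: "small TYPE('u) seqs"
proof -
  have "small TYPE('u) (fob P (globe n))" for n
    using functor_ob[OF P, of "globe n"] globe_FF[of n] by simp
  then have "small TYPE('u) (SIGMA n:UNIV. fob P (globe n))"
    by (intro small_Sigma[OF inacc small_countable[OF inacc]]) auto
  then have "small TYPE('u) ((\<lambda>(n, a). gseq n a) ` (SIGMA n:UNIV. fob P (globe n)))"
    by (rule small_image)
  then show ?thesis by (rule small_subset) (auto simp: seqs_def)
qed

text \<open>The codes are sequences of functions and not elements of \<open>'u\<close>. There are
  only few of them, so they can be renamed injectively, which gives the reconstructed cells the type
  that \<open>omega_Cat\<close> requires.\<close>

definition enc :: "(nat \<Rightarrow> 'u \<Rightarrow> 'u) \<Rightarrow> 'u" where
  "enc = (SOME f. inj_on f seqs)"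

lemma inj_enc: "inj_on enc seqs"
proof -
  obtain f :: "(nat \<Rightarrow> 'u \<Rightarrow> 'u) \<Rightarrow> 'u" where "inj_on f seqs" using small_inj[OF small_seqs] by blast
  then show ?thesis unfolding enc_def by (rule someI[of "\<lambda>f. inj_on f seqs"])
qed

definition germ :: "nat \<Rightarrow> ('u \<Rightarrow> 'u) \<Rightarrow> 'u" where
  "germ n a = enc (gseq n a)"

text \<open>The entry of the code of \<open>a\<close> at \<open>n\<close> is \<open>a\<close>
  itself.\<close>

lemma germ_inj:
  assumes "a \<in> fob P (globe n)" "b \<in> fob P (globe n)" "germ n a = germ n b"
  shows "a = b"
proof -
  have "gseq n a = gseq n b"
  proof (rule inj_onD[OF inj_enc])
    show "enc (gseq n a) = enc (gseq n b)" using assms(3) by (simp add: germ_def)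
  qed (use assms(1,2) in \<open>auto simp: seqs_def\<close>)
  then have "gseq n a n = gseq n b n" by (rule fun_cong)
  then show ?thesis unfolding gseq_self[OF assms(1)] gseq_self[OF assms(2)] .
qed

lemma germ_raise:
  assumes "a \<in> fob P (globe n)" "n \<le> m"
  shows "germ m (act (globe m) (globe n) (restr m n) a) = germ n a"
  unfolding germ_def gseq_raise[OF assms] ..

lemma germ_raise_ex:
  assumes "a \<in> fob P (globe n)" "n \<le> m"
  shows "\<exists>b\<in>fob P (globe m). germ n a = germ m b"
  using germ_raise[OF assms] act_in[OF globe_FF globe_FF restr(1) assms(1)] by metis

text \<open>An element \<open>p\<close> of \<open>P T\<close> is to become a morphism from \<open>T\<close> to the reconstructed
  omega-category; \<open>germ_val T p x\<close> is its value at \<open>x\<close>.\<close>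

definition germ_val :: "'u omega_cat \<Rightarrow> ('u \<Rightarrow> 'u) \<Rightarrow> 'u \<Rightarrow> 'u" where
  "germ_val T p x = (let n = LEAST n. x \<in> cells T n in germ n (act (globe n) T (cell_map T n x) p))"

text \<open>A classifying map out of a larger globe factors through the collapse onto a smaller one,
  and germs are unchanged by the collapse. So any dimension may replace the least one of the
  definition.\<close>

lemma germ_val:
  assumes T: "T \<in> FF" and p: "p \<in> fob P T" and x: "x \<in> cells T n"
  shows "germ_val T p x = germ n (act (globe n) T (cell_map T n x) p)"
proof -
  let ?k = "LEAST n. x \<in> cells T n"
  have Tc: "is_omega_category T" using T by simp
  have k: "x \<in> cells T ?k" and kn: "?k \<le> n"
    using x by (auto intro: LeastI[of "\<lambda>n. x \<in> cells T n"] Least_le)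
  note h = cell_map(1)[OF inacc Tc k]
  have "act (globe n) T (cell_map T n x) p =
      act (globe n) (globe ?k) (restr n ?k) (act (globe ?k) T (cell_map T ?k x) p)"
    unfolding cell_map_restr[OF Tc k kn] by (rule act_comp[OF globe_FF globe_FF T restr(1) h p])
  then show ?thesis
    using germ_raise[OF act_in[OF globe_FF T h p] kn] by (simp add: germ_val_def Let_def)
qed

lemma germ_val_top: "a \<in> fob P (globe n) \<Longrightarrow> germ_val (globe n) a (top_cell n) = germ n a"
  using germ_val[OF globe_FF _ top_cell_cells[OF inacc]] act_id[OF globe_FF] by (simp add: cell_map_top)

lemma germ_val_act:
  assumes S: "S \<in> FF" and T: "T \<in> FF" and h: "h \<in> omega_hom S T" and p: "p \<in> fob P T"
    and x: "x \<in> carrier S"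
  shows "germ_val S (act S T h p) x = germ_val T p (h x)"
proof -
  interpret S: omega_category S by (rule FF_category[OF S])
  have Sc: "is_omega_category S" and Tc: "is_omega_category T" using S T by auto
  obtain n where n: "x \<in> cells S n" using S.ex_cells[OF x] by blast
  have "act (globe n) S (cell_map S n x) (act S T h p) = act (globe n) T (cell_map T n (h x)) p"
    using act_comp[OF globe_FF S T cell_map(1)[OF inacc Sc n] h p] compose_cell_map[OF inacc Sc Tc h n] by simp
  then show ?thesis
    using germ_val[OF S act_in[OF S T h p] n] germ_val[OF T p omega_homD(6)[OF h n]] by simp
qed

definition germs :: "'u set" where
  "germs = {germ n a | n a. a \<in> fob P (globe n)}"

lemma germ_val_in: "T \<in> FF \<Longrightarrow> p \<in> fob P T \<Longrightarrow> x \<in> carrier T \<Longrightarrow> germ_val T p x \<in> germs"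
proof -
  assume T: "T \<in> FF" and p: "p \<in> fob P T" and x: "x \<in> carrier T"
  obtain n where n: "x \<in> cells T n" using omega_category.ex_cells[OF FF_category[OF T] x] by blast
  have Tc: "is_omega_category T" using T by simp
  show ?thesis
    unfolding germ_val[OF T p n] germs_def
    using act_in[OF globe_FF T cell_map(1)[OF inacc Tc n] p] by blast
qed

lemma germs_common:
  assumes "finite Z" "Z \<subseteq> germs"
  shows "\<exists>n>m. \<forall>z\<in>Z. \<exists>a\<in>fob P (globe n). z = germ n a"
  using assms
proof (induction Z rule: finite_induct)
  case empty then show ?case by blast
next
  case (insert z Z)
  then obtain n where n: "n > m" "\<forall>z\<in>Z. \<exists>a\<in>fob P (globe n). z = germ n a" by auto
  obtain k a where z: "a \<in> fob P (globe k)" "z = germ k a" using insert.prems by (auto simp: germs_def)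
  have "\<exists>b\<in>fob P (globe (max n k)). y = germ (max n k) b" if "y \<in> insert z Z" for y
    using that n(2) z germ_raise_ex[of _ n "max n k"] germ_raise_ex[of _ k "max n k"] by fastforce
  then show ?case using n(1) by (intro exI[of _ "max n k"]) auto
qed

text \<open>The presentation is a gluing colimit that \<open>P\<close> preserves, so an element is
  known from its restrictions to the globes of the diagram. The leg at a relation factors through
  the leg at its first generator, which leaves the generators.\<close>

lemma presented_eqI:
  assumes T: "(presented n k R :: 'u omega_cat) \<in> FF" and p: "p \<in> fob P (presented n k R)"
    and q: "q \<in> fob P (presented n k R)"
    and eq: "\<And>i. i < k \<Longrightarrow> germ_val (presented n k R) p (generator n k R i) =
      germ_val (presented n k R) q (generator n k R i)"
  shows "p = q"
proof (rule colimit_elements_eq[OF lim small_gluing[OF inacc] is_functor_gluing[OF inacc] T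
      colimit_gluing[OF inacc] p q])
  let ?T = "presented n k R :: 'u omega_cat"
  have Tc: "is_omega_category ?T" using T by simp
  fix a assume a: "a \<in> Ob (gluing_cat k R)"
  have gen: "act (globe n) ?T (cell_map ?T n (generator n k R i)) p =
      act (globe n) ?T (cell_map ?T n (generator n k R i)) q" if i: "i < k" for i
  proof -
    note c = generator_cells[OF inacc i]
    show ?thesis
    proof (rule germ_inj)
      show "germ n (act (globe n) ?T (cell_map ?T n (generator n k R i)) p) =
          germ n (act (globe n) ?T (cell_map ?T n (generator n k R i)) q)"
        using eq[OF i] germ_val[OF T p c] germ_val[OF T q c] by simp
    qed (rule act_in[OF globe_FF T cell_map(1)[OF inacc Tc c]], rule p,
      rule act_in[OF globe_FF T cell_map(1)[OF inacc Tc c]], rule q)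
  qed
  have "act (globe n) ?T (gluing_cocone n k R a) p = act (globe n) ?T (gluing_cocone n k R a) q"
  proof (cases a)
    case (Inl i) then show ?thesis using gen a by (auto simp: gluing_cocone_def gluing_cat_def)
  next
    case (Inr r)
    then obtain i m j where r: "r = (i, m, j)" "i < k" using a by (auto simp: gluing_cat_def)
    note c = generator_cells[OF inacc r(2)]
    note h = cell_map(1)[OF inacc Tc c]
    have e: "gluing_cocone n k R a =
        compose (carrier (globe n)) (cell_map ?T n (generator n k R i)) (glue_map n Plus m)"
      unfolding compose_glue_map[OF inacc Tc h] cell_map(2)[OF inacc Tc c]
      using Inr r by (simp add: gluing_cocone_def)
    show ?thesis
      unfolding e act_comp[OF globe_FF globe_FF T glue_map(1)[OF inacc] h p]
        act_comp[OF globe_FF globe_FF T glue_map(1)[OF inacc] h q] gen[OF r(2)] ..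
  qed
  then show "far P ?T (fob (gluing_diagram n) a) (gluing_cocone n k R a) p =
      far P ?T (fob (gluing_diagram n) a) (gluing_cocone n k R a) q"
    by (simp add: gluing_diagram_def)
qed

section \<open>Boundaries and composition of germs\<close>

definition germ_dd :: "sign \<Rightarrow> nat \<Rightarrow> 'u \<Rightarrow> 'u" where
  "germ_dd s m z = (case SOME (n, a). a \<in> fob P (globe n) \<and> z = germ n a of
     (n, a) \<Rightarrow> germ_val (globe n) a (dd (globe n) s m (top_cell n)))"

text \<open>The chosen representative and the given one become equal on a globe of common dimension,
  where germs determine elements. Boundaries can thus be computed in whichever \<open>T\<close>
  represents the cell, and this is how axioms pass from \<open>T\<close> to germs.\<close>

lemma germ_dd:
  assumes T: "T \<in> FF" and p: "p \<in> fob P T" and x: "x \<in> carrier T"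
  shows "germ_dd s m (germ_val T p x) = germ_val T p (dd T s m x)"
proof -
  have Tc: "is_omega_category T" using T by simp
  interpret T: omega_category T by (rule FF_category[OF T])
  let ?z = "germ_val T p x"
  obtain l b where lb: "(SOME (n, a). a \<in> fob P (globe n) \<and> ?z = germ n a) = (l, b)" by fastforce
  have "\<exists>na. (case na of (n, a) \<Rightarrow> a \<in> fob P (globe n) \<and> ?z = germ n a)"
    using germ_val_in[OF T p x] by (auto simp: germs_def)
  from someI_ex[OF this] have b: "b \<in> fob P (globe l)" "?z = germ l b" unfolding lb by auto
  obtain k where k: "x \<in> cells T k" using T.ex_cells[OF x] by blast
  define n where "n = max k l"
  have n: "x \<in> cells T n" "l \<le> n" using T.cells_mono[OF _ k, of n] by (auto simp: n_def)
  note h = cell_map(1)[OF inacc Tc n(1)]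
  let ?d = "dd (globe n :: 'u omega_cat) s m (top_cell n)"
  have d: "?d \<in> carrier (globe n)"
    by (rule omega_category.dd_closed[OF omega_category_presented[OF inacc] top_cell_carrier[OF inacc]])
  have e: "act (globe n) (globe l) (restr n l) b = act (globe n) T (cell_map T n x) p"
    by (rule germ_inj[OF act_in[OF globe_FF globe_FF restr(1) b(1)] act_in[OF globe_FF T h p]])
       (simp add: germ_raise[OF b(1) n(2)] b(2)[symmetric] germ_val[OF T p n(1)])
  have "germ_dd s m ?z = germ_val (globe l) b (dd (globe l) s m (top_cell l))"
    by (simp add: germ_dd_def lb)
  also have "\<dots> = germ_val (globe n) (act (globe n) (globe l) (restr n l) b) ?d"
    using germ_val_act[OF globe_FF globe_FF restr(1) b(1) d]
      omega_homD(3)[OF restr(1) top_cell_carrier[OF inacc]] restr_top[OF n(2)] by simp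
  also have "\<dots> = germ_val T p (dd T s m x)"
    unfolding e
    using germ_val_act[OF globe_FF T h p d] omega_homD(3)[OF h top_cell_carrier[OF inacc]]
      cell_map(2)[OF inacc Tc n(1)] by simp
  finally show ?thesis .
qed

text \<open>Existence to match the uniqueness in \<open>presented_eqI\<close>: germs whose
  boundaries satisfy the relations form a compatible family on the gluing diagram. Together the two
  give the universal property of the shape using boundaries alone, so it is available for defining
  the composition.\<close>

lemma realize:
  assumes T: "(presented n k R :: 'u omega_cat) \<in> FF"
    and z: "\<And>i. i < k \<Longrightarrow> \<exists>a\<in>fob P (globe n). z i = germ n a"
    and rel: "\<And>i m j. (i, m, j) \<in> R \<Longrightarrow> i < k \<Longrightarrow> j < k \<Longrightarrow> germ_dd Plus m (z i) = germ_dd Minus m (z j)"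
  shows "\<exists>p\<in>fob P (presented n k R). \<forall>i<k. germ_val (presented n k R) p (generator n k R i) = z i"
proof -
  let ?T = "presented n k R :: 'u omega_cat"
  obtain a where a: "\<And>i. i < k \<Longrightarrow> a i \<in> fob P (globe n)" "\<And>i. i < k \<Longrightarrow> z i = germ n (a i)"
    using z by metis
  have dz: "germ_dd s m (z i) = germ n (act (globe n) (globe n) (glue_map n s m) (a i))" if i: "i < k" for i s m
    using germ_dd[OF globe_FF a(1)[OF i] top_cell_carrier[OF inacc], of s m] germ_val_top[OF a(1)[OF i]]
      germ_val[OF globe_FF a(1)[OF i] dd_top_cell[OF inacc]] a(2)[OF i] by (simp add: glue_map_def)
  have act_a: "act (globe n) (globe n) (glue_map n s m) (a i) \<in> fob P (globe n)" if "i < k" for i s m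
    by (rule act_in[OF globe_FF globe_FF glue_map(1)[OF inacc] a(1)[OF that]])
  have rel': "act (globe n) (globe n) (glue_map n Plus m) (a i) = act (globe n) (globe n) (glue_map n Minus m) (a j)"
    if "(i, m, j) \<in> R" "i < k" "j < k" for i m j
    by (rule germ_inj[OF act_a[OF that(2)] act_a[OF that(3)]]) (use rel[OF that] dz that in simp)
  \<comment> \<open>The value at a relation is taken from its first generator; \<open>rel'\<close>
    says that the second one gives the same.\<close>
  define y where "y b = (case b of Inl i \<Rightarrow> a i
    | Inr (i, m, j) \<Rightarrow> act (globe n) (globe n) (glue_map n Plus m) (a i))" for b :: "nat + nat \<times> nat \<times> nat"
  have "\<exists>p\<in>fob P ?T. \<forall>b\<in>Ob (gluing_cat k R).
      far P ?T (fob (gluing_diagram n) b) (gluing_cocone n k R b) p = y b"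
  proof (rule colimit_elements_ex[OF inacc lim small_gluing[OF inacc] is_functor_gluing[OF inacc] T
        colimit_gluing[OF inacc]])
    show yb: "y b \<in> fob P (fob (gluing_diagram n) b)" if "b \<in> Ob (gluing_cat k R)" for b
      using that a(1) act_a by (auto simp: gluing_cat_def y_def gluing_diagram_def)
    fix b c v assume b: "b \<in> Ob (gluing_cat k R)" and c: "c \<in> Ob (gluing_cat k R)"
      and v: "v \<in> Hom (gluing_cat k R) b c"
    show "far P (fob (gluing_diagram n) c) (fob (gluing_diagram n) b) (far (gluing_diagram n) b c v) (y c) = y b"
    proof (cases "b = c")
      case True
      then show ?thesis
        using v yb[OF c] act_id[OF globe_FF] by (simp add: gluing_cat_def gluing_diagram_def)
    next
      case False
      then obtain i m j l where bc: "b = Inr (i, m, j)" "c = Inl l" "v = 1 \<and> l = i \<or> v = 2 \<and> l = j"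
        using v by (auto simp: gluing_cat_def split: if_splits sum.splits)
      have "(i, m, j) \<in> R" "i < k" "j < k" using b bc by (auto simp: gluing_cat_def)
      from rel'[OF this] show ?thesis using bc by (auto simp: gluing_diagram_def y_def)
    qed
  qed
  then obtain p where p: "p \<in> fob P ?T"
    "\<And>b. b \<in> Ob (gluing_cat k R) \<Longrightarrow> far P ?T (fob (gluing_diagram n) b) (gluing_cocone n k R b) p = y b"
    by blast
  have "germ_val ?T p (generator n k R i) = z i" if i: "i < k" for i
    using p(2)[of "Inl i"] germ_val[OF T p(1) generator_cells[OF inacc i]] a(2)[OF i] i
    by (simp add: gluing_cat_def y_def gluing_diagram_def gluing_cocone_def)
  then show ?thesis using p(1) by blast
qed

lemma pairing_FF: "m < n \<Longrightarrow> pairing n m \<in> FF"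
  by (rule dense_FF[OF pairing_dense[OF inacc]])

definition germ_cmp :: "nat \<Rightarrow> 'u \<Rightarrow> 'u \<Rightarrow> 'u" where
  "germ_cmp m z w = (case SOME (n, p). m < n \<and> p \<in> fob P (pairing n m) \<and>
       germ_val (pairing n m) p (fst_gen n m) = z \<and> germ_val (pairing n m) p (snd_gen n m) = w of
     (n, p) \<Rightarrow> germ_val (pairing n m) p (cmp (pairing n m) m (fst_gen n m) (snd_gen n m)))"

lemma germ_val_pair_map:
  assumes mn: "m < n" and T: "T \<in> FF" and p: "p \<in> fob P T"
    and x: "x \<in> cells T n" and y: "y \<in> cells T n" and c: "composable T m x y"
  defines "q \<equiv> act (pairing n m) T (pair_map T n m x y) p"
  shows "q \<in> fob P (pairing n m)" "germ_val (pairing n m) q (fst_gen n m) = germ_val T p x"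
    "germ_val (pairing n m) q (snd_gen n m) = germ_val T p y"
    "germ_val (pairing n m) q (cmp (pairing n m) m (fst_gen n m) (snd_gen n m)) = germ_val T p (cmp T m x y)"
proof -
  have Tc: "is_omega_category T" using T by simp
  interpret Q: omega_category "pairing n m :: 'u omega_cat" by (rule omega_category_presented[OF inacc])
  note f = pair_map[OF inacc Tc x y c] and g = pair_gens[OF inacc, of n m]
  show "q \<in> fob P (pairing n m)" unfolding q_def by (rule act_in[OF pairing_FF[OF mn] T f(1) p])
  note v = germ_val_act[OF pairing_FF[OF mn] T f(1) p, folded q_def]
  show "germ_val (pairing n m) q (fst_gen n m) = germ_val T p x"
    "germ_val (pairing n m) q (snd_gen n m) = germ_val T p y"
    using v[OF Q.cells_carrier[OF g(1)]] v[OF Q.cells_carrier[OF g(2)]] f(2,3) by auto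
  show "germ_val (pairing n m) q (cmp (pairing n m) m (fst_gen n m) (snd_gen n m)) = germ_val T p (cmp T m x y)"
    using v[OF Q.cmp_closed[OF g(3)]] omega_homD(4)[OF f(1) g(3)] f(2,3) by simp
qed

text \<open>The pairing chosen by the definition may have a dimension \<open>l\<close> unrelated to
  that of the cells of \<open>T\<close>. Both situations are pulled back to a pairing of a common
  dimension \<open>n\<close>, where they agree on the two generators and hence, by
  \<open>presented_eqI\<close>, altogether.\<close>

lemma germ_cmp:
  assumes T: "T \<in> FF" and p: "p \<in> fob P T" and c: "composable T m x y"
  shows "germ_cmp m (germ_val T p x) (germ_val T p y) = germ_val T p (cmp T m x y)"
proof -
  interpret T: omega_category T by (rule FF_category[OF T])
  let ?z = "germ_val T p x" and ?w = "germ_val T p y"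
  let ?Q = "\<lambda>(n, q). m < n \<and> q \<in> fob P (pairing n m) \<and>
       germ_val (pairing n m) q (fst_gen n m) = ?z \<and> germ_val (pairing n m) q (snd_gen n m) = ?w"
  have xy: "x \<in> carrier T" "y \<in> carrier T" using T.composable_in[OF c] by auto
  obtain j k where jk: "x \<in> cells T j" "y \<in> cells T k" using T.ex_cells[OF xy(1)] T.ex_cells[OF xy(2)] by blast
  have cell: "x \<in> cells T n" "y \<in> cells T n" if "max j k \<le> n" for n
    using T.cells_mono[OF _ jk(1), of n] T.cells_mono[OF _ jk(2), of n] that by auto
  define i where "i = Suc (max m (max j k))"
  have i: "m < i" "max j k \<le> i" by (auto simp: i_def)
  have "?Q (i, act (pairing i m) T (pair_map T i m x y) p)"
    using germ_val_pair_map[OF i(1) T p cell[OF i(2)] c] i(1) by simp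
  then have "\<exists>nq. ?Q nq" by (rule exI[of ?Q])
  from someI_ex[OF this] have some: "?Q (SOME nq. ?Q nq)" .
  obtain l q where lq: "(SOME nq. ?Q nq) = (l, q)" by fastforce
  have q: "m < l" "q \<in> fob P (pairing l m)" "germ_val (pairing l m) q (fst_gen l m) = ?z"
    "germ_val (pairing l m) q (snd_gen l m) = ?w"
    using some unfolding lq by auto
  define n where "n = max l (max j k)"
  have mn: "m < n" and ln: "l \<le> n" and jn: "max j k \<le> n" using q(1) by (auto simp: n_def)
  note v = germ_val_pair_map[OF mn T p cell[OF jn] c]
  have l: "(fst_gen l m :: 'u) \<in> cells (pairing l m) n" "(snd_gen l m :: 'u) \<in> cells (pairing l m) n"
    by (rule omega_category.cells_mono[OF omega_category_presented[OF inacc] ln pair_gens(1)[OF inacc]])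
       (rule omega_category.cells_mono[OF omega_category_presented[OF inacc] ln pair_gens(2)[OF inacc]])
  note w = germ_val_pair_map[OF mn pairing_FF[OF q(1)] q(2) l pair_gens(3)[OF inacc]]
  have "act (pairing n m) (pairing l m) (pair_map (pairing l m) n m (fst_gen l m) (snd_gen l m)) q =
      act (pairing n m) T (pair_map T n m x y) p"
  proof (rule presented_eqI[OF pairing_FF[OF mn] w(1) v(1)])
    fix i :: nat assume "i < 2"
    then have "i = 0 \<or> i = Suc 0" by linarith
    then show "germ_val (pairing n m)
        (act (pairing n m) (pairing l m) (pair_map (pairing l m) n m (fst_gen l m) (snd_gen l m)) q)
        (generator n 2 (pair_rels m) i) =
      germ_val (pairing n m) (act (pairing n m) T (pair_map T n m x y) p) (generator n 2 (pair_rels m) i)"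
      using v(2,3) w(2,3) q(3,4) by auto
  qed
  then have "germ_val (pairing l m) q (cmp (pairing l m) m (fst_gen l m) (snd_gen l m)) =
      germ_val T p (cmp T m x y)"
    using v(4) w(4) by simp
  then show ?thesis by (simp add: germ_cmp_def lq)
qed

section \<open>The reconstructed omega-category\<close>

definition germ_cat :: "'u omega_cat" where
  "germ_cat = \<lparr>carrier = germs, dd = germ_dd, cmp = germ_cmp\<rparr>"

lemma germ_cat_simps [simp]:
  "carrier germ_cat = germs" "dd germ_cat = germ_dd" "cmp germ_cat = germ_cmp"
  by (simp_all add: germ_cat_def)

text \<open>Finitely many germs can be represented on globes of one dimension, and that dimension
  can be taken above the bound \<open>l\<close> from which the shape has a basis.\<close>

lemma realize_finite:
  assumes slf: "\<And>n. l < n \<Longrightarrow> has_slf_atomic_basis (presented n k R :: 'u omega_cat)"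
    and z: "\<And>i. i < k \<Longrightarrow> z i \<in> germs"
    and rel: "\<And>i m j. (i, m, j) \<in> R \<Longrightarrow> composable germ_cat m (z i) (z j)"
  shows "\<exists>n p. l < n \<and> (presented n k R :: 'u omega_cat) \<in> FF \<and> p \<in> fob P (presented n k R) \<and>
    (\<forall>i<k. germ_val (presented n k R) p (generator n k R i) = z i)"
proof -
  have "z ` {..<k} \<subseteq> germs" using z by auto
  then obtain n where n: "l < n" "\<forall>y\<in>z ` {..<k}. \<exists>a\<in>fob P (globe n). y = germ n a"
    using germs_common[of "z ` {..<k}" l] by auto
  have "\<exists>p\<in>fob P (presented n k R). \<forall>i<k. germ_val (presented n k R) p (generator n k R i) = z i"
    by (rule realize[OF presented_FF[OF slf[OF n(1)]]])
       (use n(2) rel in \<open>auto simp: composable_def\<close>)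
  then show ?thesis using n(1) presented_FF[OF slf[OF n(1)]] by blast
qed

text \<open>This lemma, \<open>composable_rep\<close>, \<open>triple_rep\<close> and
  \<open>grid_rep\<close> serve one purpose: the cells occurring in an axiom become the values of
  one element \<open>p\<close> at cells of one omega-category \<open>T\<close>, where the axiom
  holds already.\<close>

lemma germs_rep:
  assumes "z \<in> germs"
  obtains T p x where "T \<in> FF" "p \<in> fob P T" "x \<in> carrier T" "z = germ_val T p x"
proof -
  obtain n a where "a \<in> fob P (globe n)" "z = germ n a" using assms by (auto simp: germs_def)
  then show thesis
    using that[OF globe_FF _ top_cell_carrier[OF inacc]] germ_val_top by simp
qed

lemma composable_rep:
  assumes "composable germ_cat m z w"
  shows "\<exists>T p x y. T \<in> FF \<and> p \<in> fob P T \<and> composable T m x y \<and> z = germ_val T p x \<and> w = germ_val T p y"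
proof -
  have "\<exists>n p. m < n \<and> (pairing n m :: 'u omega_cat) \<in> FF \<and> p \<in> fob P (pairing n m) \<and>
    (\<forall>i<2. germ_val (pairing n m) p (generator n 2 (pair_rels m) i) = (if i = 0 then z else w))"
    by (rule realize_finite[OF slf_pair[OF inacc]])
       (use assms in \<open>auto simp: composable_def pair_rels_def\<close>)
  then obtain n p where np: "m < n" "(pairing n m :: 'u omega_cat) \<in> FF" "p \<in> fob P (pairing n m)"
    "\<forall>i<2. germ_val (pairing n m) p (generator n 2 (pair_rels m) i) = (if i = 0 then z else w)" by blast
  have "germ_val (pairing n m) p (fst_gen n m) = z" "germ_val (pairing n m) p (snd_gen n m) = w"
    using np(4)[rule_format, of 0] np(4)[rule_format, of "Suc 0"] by auto
  then show ?thesis using np(2,3) pair_gens(3)[OF inacc, of n m] by metis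
qed

lemma presented_composable_gens:
  assumes "(i, m, j) \<in> R" "i < k" "j < k"
  shows "composable (presented n k R :: 'u omega_cat) m (generator n k R i) (generator n k R j)"
  unfolding composable_def
  using presented_rel(1)[OF inacc assms]
    omega_category.cells_carrier[OF omega_category_presented[OF inacc] generator_cells[OF inacc assms(2)]]
    omega_category.cells_carrier[OF omega_category_presented[OF inacc] generator_cells[OF inacc assms(3)]]
  by simp

lemma triple_rep:
  assumes "composable germ_cat m x y" "composable germ_cat m y z"
  shows "\<exists>T p x' y' z'. T \<in> FF \<and> p \<in> fob P T \<and> composable T m x' y' \<and> composable T m y' z' \<and>
    x = germ_val T p x' \<and> y = germ_val T p y' \<and> z = germ_val T p z'"
proof -
  let ?z = "\<lambda>i :: nat. if i = 0 then x else if i = 1 then y else z"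
  have three: "i < 3 \<Longrightarrow> i = 0 \<or> i = 1 \<or> i = 2" for i :: nat by linarith
  have "\<exists>n p. m < n \<and> (presented n 3 (triple_rels m) :: 'u omega_cat) \<in> FF \<and>
      p \<in> fob P (presented n 3 (triple_rels m)) \<and>
      (\<forall>i<3. germ_val (presented n 3 (triple_rels m)) p (generator n 3 (triple_rels m) i) = ?z i)"
    by (rule realize_finite[OF slf_triple[OF inacc]])
       (use assms in \<open>auto simp: composable_def triple_rels_def\<close>)
  then obtain n p where np: "(presented n 3 (triple_rels m) :: 'u omega_cat) \<in> FF"
      "p \<in> fob P (presented n 3 (triple_rels m))"
      "\<forall>i<3. germ_val (presented n 3 (triple_rels m)) p (generator n 3 (triple_rels m) i) = ?z i" by blast
  show ?thesis
    by (rule exI[of _ "presented n 3 (triple_rels m)"], rule exI[of _ p],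
        rule exI[of _ "generator n 3 (triple_rels m) 0"], rule exI[of _ "generator n 3 (triple_rels m) 1"],
        rule exI[of _ "generator n 3 (triple_rels m) 2"])
       (use np in \<open>auto intro!: presented_composable_gens simp: triple_rels_def\<close>)
qed

lemma grid_rep:
  assumes "m < l" "composable germ_cat l x y" "composable germ_cat l x' y'" "composable germ_cat m x x'"
  shows "\<exists>T p a b a' b'. T \<in> FF \<and> p \<in> fob P T \<and> composable T l a b \<and> composable T l a' b' \<and>
    composable T m a a' \<and> x = germ_val T p a \<and> y = germ_val T p b \<and> x' = germ_val T p a' \<and>
    y' = germ_val T p b'"
proof -
  let ?R = "grid_rels l m"
  let ?z = "\<lambda>i :: nat. if i = 0 then x else if i = 1 then y else if i = 2 then x' else y'"
  have "\<exists>n p. l < n \<and> (presented n 4 ?R :: 'u omega_cat) \<in> FF \<and> p \<in> fob P (presented n 4 ?R) \<and>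
      (\<forall>i<4. germ_val (presented n 4 ?R) p (generator n 4 ?R i) = ?z i)"
    by (rule realize_finite[OF slf_grid[OF inacc assms(1)]])
       (use assms in \<open>auto simp: composable_def grid_rels_def\<close>)
  then obtain n p where np: "(presented n 4 ?R :: 'u omega_cat) \<in> FF" "p \<in> fob P (presented n 4 ?R)"
      "\<forall>i<4. germ_val (presented n 4 ?R) p (generator n 4 ?R i) = ?z i" by blast
  show ?thesis
    by (rule exI[of _ "presented n 4 ?R"], rule exI[of _ p], rule exI[of _ "generator n 4 ?R 0"],
        rule exI[of _ "generator n 4 ?R 1"], rule exI[of _ "generator n 4 ?R 2"],
        rule exI[of _ "generator n 4 ?R 3"])
       (use np in \<open>auto intro!: presented_composable_gens simp: grid_rels_def\<close>)
qed

lemma is_omega_category_germ_cat: "is_omega_category germ_cat"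
proof (rule is_omega_categoryI)
  fix s m z assume "z \<in> carrier germ_cat"
  then obtain T p x where r: "T \<in> FF" "p \<in> fob P T" "x \<in> carrier T" "z = germ_val T p x"
    unfolding germ_cat_simps by (elim germs_rep)
  interpret T: omega_category T by (rule FF_category[OF r(1)])
  show "dd germ_cat s m z \<in> carrier germ_cat"
    using germ_val_in[OF r(1,2)] r by (simp add: germ_dd)
next
  fix m z w assume "composable germ_cat m z w"
  then obtain T p x y where r: "T \<in> FF" "p \<in> fob P T" "composable T m x y" "z = germ_val T p x"
    "w = germ_val T p y" using composable_rep by blast
  interpret T: omega_category T by (rule FF_category[OF r(1)])
  show "cmp germ_cat m z w \<in> carrier germ_cat"
    using germ_val_in[OF r(1,2) T.cmp_closed[OF r(3)]] r(4,5) germ_cmp[OF r(1-3)] by simp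
  note cl = T.composable_in[OF r(3)] T.cmp_closed[OF r(3)]
  show "dd germ_cat Minus m (cmp germ_cat m z w) = dd germ_cat Minus m z"
    "dd germ_cat Plus m (cmp germ_cat m z w) = dd germ_cat Plus m w"
    using cl r(4,5) germ_cmp[OF r(1-3)] T.cmp_minus[OF r(3)] T.cmp_plus[OF r(3)] germ_dd[OF r(1,2)] by auto
next
  fix z assume "z \<in> carrier germ_cat"
  then obtain T p x where r: "T \<in> FF" "p \<in> fob P T" "x \<in> carrier T" "z = germ_val T p x"
    unfolding germ_cat_simps by (elim germs_rep)
  interpret T: omega_category T by (rule FF_category[OF r(1)])
  obtain n where "dd T Minus n x = x" using T.ex_dim[OF r(3)] by blast
  then have "dd germ_cat Minus n z = z" using germ_dd[OF r(1-3)] r(4) by simp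
  then show "\<exists>n. dd germ_cat Minus n z = z" by blast
next
  fix s t m n z assume mn: "m < (n :: nat)" and "z \<in> carrier germ_cat"
  then obtain T p x where r: "T \<in> FF" "p \<in> fob P T" "x \<in> carrier T" "z = germ_val T p x"
    unfolding germ_cat_simps by (elim germs_rep)
  interpret T: omega_category T by (rule FF_category[OF r(1)])
  show "dd germ_cat t m (dd germ_cat s n z) = dd germ_cat t m z"
    using r(3,4) mn by (simp add: germ_dd[OF r(1,2)] T.dd_less)
next
  fix s t m n z assume mn: "n \<le> (m :: nat)" and "z \<in> carrier germ_cat"
  then obtain T p x where r: "T \<in> FF" "p \<in> fob P T" "x \<in> carrier T" "z = germ_val T p x"
    unfolding germ_cat_simps by (elim germs_rep)
  interpret T: omega_category T by (rule FF_category[OF r(1)])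
  show "dd germ_cat t m (dd germ_cat s n z) = dd germ_cat s n z"
    using r(3,4) mn by (simp add: germ_dd[OF r(1,2)] T.dd_ge)
next
  fix m z assume "z \<in> carrier germ_cat"
  then obtain T p x where r: "T \<in> FF" "p \<in> fob P T" "x \<in> carrier T" "z = germ_val T p x"
    unfolding germ_cat_simps by (elim germs_rep)
  interpret T: omega_category T by (rule FF_category[OF r(1)])
  have c: "composable T m (dd T Minus m x) x" "composable T m x (dd T Plus m x)"
    using r(3) T.dd_ge[OF r(3) order_refl] by (simp_all add: composable_def)
  show "cmp germ_cat m (dd germ_cat Minus m z) z = z" "cmp germ_cat m z (dd germ_cat Plus m z) = z"
    using germ_dd[OF r(1-3)] germ_cmp[OF r(1,2) c(1)] germ_cmp[OF r(1,2) c(2)]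
      T.idl[OF r(3)] T.idr[OF r(3)] r(4) by simp_all
next
  fix s m n z w assume "composable germ_cat n z w" and mn: "m < (n :: nat)"
  then obtain T p x y where r: "T \<in> FF" "p \<in> fob P T" "composable T n x y" "z = germ_val T p x"
    "w = germ_val T p y" using composable_rep by blast
  interpret T: omega_category T by (rule FF_category[OF r(1)])
  show "dd germ_cat s m (cmp germ_cat n z w) = dd germ_cat s m z"
    using T.composable_in[OF r(3)] T.cmp_closed[OF r(3)] T.cmp_less[OF r(3) mn] r(4,5)
    by (simp add: germ_dd[OF r(1,2)] germ_cmp[OF r(1-3)])
next
  fix s m n z w assume "composable germ_cat n z w" and nm: "n < (m :: nat)"
  then obtain T p x y where r: "T \<in> FF" "p \<in> fob P T" "composable T n x y" "z = germ_val T p x"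
    "w = germ_val T p y" using composable_rep by blast
  interpret T: omega_category T by (rule FF_category[OF r(1)])
  show "dd germ_cat s m (cmp germ_cat n z w) = cmp germ_cat n (dd germ_cat s m z) (dd germ_cat s m w)"
    using T.composable_in[OF r(3)] T.cmp_closed[OF r(3)] T.cmp_greater[OF r(3) nm]
      T.composable_dd[OF r(3) nm] r(4,5)
    by (simp add: germ_dd[OF r(1,2)] germ_cmp[OF r(1,2)] r(3))
next
  fix m x y z assume "composable germ_cat m x y" "composable germ_cat m y z"
  then obtain T p a b c where r: "T \<in> FF" "p \<in> fob P T" "composable T m a b" "composable T m b c"
    "x = germ_val T p a" "y = germ_val T p b" "z = germ_val T p c" using triple_rep by blast
  interpret T: omega_category T by (rule FF_category[OF r(1)])
  show "cmp germ_cat m (cmp germ_cat m x y) z = cmp germ_cat m x (cmp germ_cat m y z)"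
    using T.assoc[OF r(3,4)] T.assoc_composable[OF r(3,4)] r(3-)
    by (simp add: germ_cmp[OF r(1,2)])
next
  fix m l x y x' y'
  assume ml: "m < (l :: nat)" and "composable germ_cat l x y" "composable germ_cat l x' y'"
    "composable germ_cat m x x'"
  then obtain T p a b a' b' where r: "T \<in> FF" "p \<in> fob P T" "composable T l a b" "composable T l a' b'"
    "composable T m a a'" "x = germ_val T p a" "y = germ_val T p b" "x' = germ_val T p a'"
    "y' = germ_val T p b'" using grid_rep by blast
  interpret T: omega_category T by (rule FF_category[OF r(1)])
  show "cmp germ_cat m (cmp germ_cat l x y) (cmp germ_cat l x' y') =
      cmp germ_cat l (cmp germ_cat m x x') (cmp germ_cat m y y')"
    using T.interchange[OF ml r(3-5)] T.interchange_composable[OF ml r(3-5)] r(3-)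
    by (simp add: germ_cmp[OF r(1,2)])
qed

lemma germ_cat_Ob: "germ_cat \<in> Ob omega_Cat"
proof -
  have "germs = enc ` seqs" by (auto simp: germs_def seqs_def germ_def)
  then show ?thesis using is_omega_category_germ_cat small_image[OF small_seqs] by simp
qed

section \<open>Comparison of the functor with the representable one\<close>

definition germ_hom :: "'u omega_cat \<Rightarrow> ('u \<Rightarrow> 'u) \<Rightarrow> 'u \<Rightarrow> 'u" where
  "germ_hom T p = (\<lambda>x\<in>carrier T. germ_val T p x)"

lemma germ_hom:
  assumes T: "T \<in> FF" and p: "p \<in> fob P T"
  shows "germ_hom T p \<in> omega_hom T germ_cat"
proof -
  interpret T: omega_category T by (rule FF_category[OF T])
  show ?thesis
  proof (rule omega_homI)
    show "germ_hom T p (cmp T m x y) = cmp germ_cat m (germ_hom T p x) (germ_hom T p y)"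
      if "composable T m x y" for m x y
      using T.composable_in[OF that] T.cmp_closed[OF that] germ_cmp[OF T p that] by (simp add: germ_hom_def)
  qed (simp_all add: germ_hom_def germ_val_in[OF T p] germ_dd[OF T p])
qed

text \<open>The equation stating that \<open>z\<close> is its own \<open>n\<close>-source can be
  computed in a \<open>T\<close> representing \<open>z\<close>; the \<open>n\<close>-source found
  there is classified by a map out of \<open>globe n\<close>.\<close>

lemma cells_germ_cat: "z \<in> cells germ_cat n \<Longrightarrow> \<exists>a\<in>fob P (globe n). z = germ n a"
proof -
  assume "z \<in> cells germ_cat n"
  then have z: "z \<in> germs" "germ_dd Minus n z = z" by (auto simp: cells_def)
  obtain T p x where r: "T \<in> FF" "p \<in> fob P T" "x \<in> carrier T" "z = germ_val T p x"
    using z(1) by (rule germs_rep)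
  have Tc: "is_omega_category T" using r(1) by simp
  have d: "dd T Minus n x \<in> cells T n" by (rule omega_category.dd_cells[OF FF_category[OF r(1)] r(3)])
  have "z = germ_val T p (dd T Minus n x)" using germ_dd[OF r(1-3)] z(2) r(4) by simp
  then show ?thesis
    using germ_val[OF r(1,2) d] act_in[OF globe_FF r(1) cell_map(1)[OF inacc Tc d] r(2)] by blast
qed

text \<open>Injectivity is \<open>presented_eqI\<close> and surjectivity is \<open>realize\<close>.
  The input of the latter comes from \<open>cells_germ_cat\<close> and from the relations, which any
  morphism out of the presentation respects.\<close>

lemma bij_germ_hom_presented:
  assumes T: "(presented n k R :: 'u omega_cat) \<in> FF"
  shows "bij_betw (germ_hom (presented n k R)) (fob P (presented n k R)) (omega_hom (presented n k R) germ_cat)"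
proof (rule bij_betw_imageI[OF inj_onI subset_antisym])
  let ?T = "presented n k R :: 'u omega_cat"
  have g: "generator n k R i \<in> carrier ?T" if "i < k" for i
    by (rule omega_category.cells_carrier[OF FF_category[OF T] generator_cells[OF inacc that]])
  fix p q assume p: "p \<in> fob P ?T" "q \<in> fob P ?T" and eq: "germ_hom ?T p = germ_hom ?T q"
  show "p = q"
  proof (rule presented_eqI[OF T p])
    fix i assume "i < k"
    from fun_cong[OF eq, of "generator n k R i"] g[OF this]
    show "germ_val ?T p (generator n k R i) = germ_val ?T q (generator n k R i)"
      by (simp add: germ_hom_def)
  qed
next
  let ?T = "presented n k R :: 'u omega_cat"
  have g: "generator n k R i \<in> carrier ?T" if "i < k" for i
    by (rule omega_category.cells_carrier[OF FF_category[OF T] generator_cells[OF inacc that]])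
  show "omega_hom ?T germ_cat \<subseteq> germ_hom ?T ` fob P ?T"
  proof
    fix f assume f: "f \<in> omega_hom ?T germ_cat"
    have "\<exists>p\<in>fob P ?T. \<forall>i<k. germ_val ?T p (generator n k R i) = f (generator n k R i)"
    proof (rule realize[OF T])
      show "\<exists>a\<in>fob P (globe n). f (generator n k R i) = germ n a" if "i < k" for i
        by (rule cells_germ_cat[OF omega_homD(6)[OF f generator_cells[OF inacc that]]])
      show "germ_dd Plus m (f (generator n k R i)) = germ_dd Minus m (f (generator n k R j))"
        if "(i, m, j) \<in> R" "i < k" "j < k" for i m j
        using hom_satisfies[OF inacc f] that by (fastforce simp: satisfies_def)
    qed
    then obtain p where p: "p \<in> fob P ?T" "\<And>i. i < k \<Longrightarrow> germ_val ?T p (generator n k R i) = f (generator n k R i)"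
      by blast
    have "f = germ_hom ?T p"
      by (rule presented_hom_eq[OF inacc f germ_hom[OF T p(1)]]) (use p(2) g in \<open>simp add: germ_hom_def\<close>)
    then show "f \<in> germ_hom ?T ` fob P ?T" using p(1) by blast
  qed
qed (use germ_hom[OF T] in blast)

lemma bij_germ_hom_dense:
  assumes "(T :: 'u omega_cat) \<in> dense_shapes"
  shows "bij_betw (germ_hom T) (fob P T) (omega_hom T germ_cat)"
  using assms bij_germ_hom_presented dense_FF[OF assms] unfolding dense_shapes_def by auto

lemma germ_hom_act:
  assumes S: "S \<in> FF" and T: "T \<in> FF" and h: "h \<in> omega_hom S T" and p: "p \<in> fob P T"
  shows "germ_hom S (act S T h p) = compose (carrier S) (germ_hom T p) h"
  using germ_val_act[OF assms] omega_homD(2)[OF h]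
  by (auto simp: germ_hom_def compose_def fun_eq_iff)

text \<open>A general \<open>T\<close> is the colimit of the dense shapes over it. Both
  \<open>P\<close> and \<open>hom(-, germ_cat)\<close> see \<open>T\<close> through this diagram,
  and on its vertices the bijection is known.\<close>

lemma bij_germ_hom:
  assumes T: "T \<in> FF"
  shows "bij_betw (germ_hom T) (fob P T) (omega_hom T germ_cat)"
proof (rule bij_betw_imageI[OF inj_onI subset_antisym])
  have TOb: "T \<in> Ob omega_Cat" and Tc: "is_omega_category T" using T by auto
  note colim = small_elements[OF inacc TOb] is_functor_elements[OF inacc] T colimit_elements[OF inacc TOb]
  have ob: "S \<in> dense_shapes \<and> f \<in> omega_hom S T" if "(S, f) \<in> Ob (elements_cat T)" for S f
    using that by (simp add: elements_cat_def[OF inacc])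
  show "p = q" if p: "p \<in> fob P T" and q: "q \<in> fob P T" and eq: "germ_hom T p = germ_hom T q" for p q
  proof (rule colimit_elements_eq[OF lim colim p q])
    fix j assume j: "j \<in> Ob (elements_cat T)"
    obtain S f where Sf: "j = (S, f)" by fastforce
    then have S: "S \<in> dense_shapes" and f: "f \<in> omega_hom S T" using ob j by auto
    note SF = dense_FF[OF S]
    have "act S T f p = act S T f q"
    proof (rule inj_onD[OF bij_betw_imp_inj_on[OF bij_germ_hom_dense[OF S]]])
      show "germ_hom S (act S T f p) = germ_hom S (act S T f q)"
        unfolding germ_hom_act[OF SF T f p] germ_hom_act[OF SF T f q] eq ..
    qed (rule act_in[OF SF T f p], rule act_in[OF SF T f q])
    then show "far P T (fob elements_diagram j) (snd j) p = far P T (fob elements_diagram j) (snd j) q"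
      by (simp add: Sf elements_diagram_def[OF inacc])
  qed
  show "omega_hom T germ_cat \<subseteq> germ_hom T ` fob P T"
  proof
    fix f assume f: "f \<in> omega_hom T germ_cat"
    \<comment> \<open>Pull \<open>f\<close> back to each shape over \<open>T\<close> and take the
      element of \<open>P\<close> representing the result. Compatibility of these elements follows
      from injectivity on shapes.\<close>
    define y where "y j = inv_into (fob P (fst j)) (germ_hom (fst j)) (compose (carrier (fst j)) f (snd j))" for j
    have y: "y (S, g) \<in> fob P S" "germ_hom S (y (S, g)) = compose (carrier S) f g"
      if S: "S \<in> dense_shapes" and g: "g \<in> omega_hom S T" for S g
    proof -
      have "compose (carrier S) f g \<in> germ_hom S ` fob P S"
        using omega_hom_compose[OF g f] dense_FF[OF S] bij_betw_imp_surj_on[OF bij_germ_hom_dense[OF S]] by simp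
      then show "y (S, g) \<in> fob P S" "germ_hom S (y (S, g)) = compose (carrier S) f g"
        unfolding y_def by (simp_all add: inv_into_into f_inv_into_f)
    qed
    have "\<exists>p\<in>fob P T. \<forall>j\<in>Ob (elements_cat T). far P T (fob elements_diagram j) (snd j) p = y j"
    proof (rule colimit_elements_ex[OF inacc lim colim])
      show "y j \<in> fob P (fob elements_diagram j)" if "j \<in> Ob (elements_cat T)" for j
        using y(1)[of "fst j" "snd j"] ob[of "fst j" "snd j"] that by (simp add: elements_diagram_def[OF inacc])
      fix i j h assume i: "i \<in> Ob (elements_cat T)" and j: "j \<in> Ob (elements_cat T)"
        and h: "h \<in> Hom (elements_cat T) i j"
      obtain S g S' g' where ij: "i = (S, g)" "j = (S', g')" by fastforce
      have S: "S \<in> dense_shapes" "g \<in> omega_hom S T" and S': "S' \<in> dense_shapes" "g' \<in> omega_hom S' T"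
        using ob i j ij by auto
      have h: "h \<in> omega_hom S S'" "compose (carrier S) g' h = g"
        using h ij by (auto simp: elements_cat_def[OF inacc])
      note SF = dense_FF[OF S(1)] and S'F = dense_FF[OF S'(1)]
      have "germ_hom S (act S S' h (y (S', g'))) = germ_hom S (y (S, g))"
        using germ_hom_act[OF SF S'F h(1) y(1)[OF S']] y(2)[OF S'] y(2)[OF S] h(2)
          compose_assoc_hom[OF inacc h(1), of f g'] by simp
      then have "act S S' h (y (S', g')) = y (S, g)"
        using inj_onD[OF bij_betw_imp_inj_on[OF bij_germ_hom_dense[OF S(1)]]]
          act_in[OF SF S'F h(1) y(1)[OF S']] y(1)[OF S] by blast
      then show "far P (fob elements_diagram j) (fob elements_diagram i) (far elements_diagram i j h) (y j) = y i"
        by (simp add: ij elements_diagram_def[OF inacc])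
    qed
    then obtain p where p: "p \<in> fob P T"
      "\<And>j. j \<in> Ob (elements_cat T) \<Longrightarrow> far P T (fob elements_diagram j) (snd j) p = y j" by blast
    have "germ_hom T p = f"
    proof (rule density_unique[OF inacc Tc germ_hom[OF T p(1)] f])
      fix n g assume g: "g \<in> omega_hom (globe n) T"
      then have "(globe n, g) \<in> Ob (elements_cat T)"
        by (simp add: elements_cat_def[OF inacc] globe_dense[OF inacc])
      from p(2)[OF this] have "act (globe n) T g p = y (globe n, g)"
        by (simp add: elements_diagram_def[OF inacc])
      then show "compose (carrier (globe n)) (germ_hom T p) g = compose (carrier (globe n)) f g"
        using germ_hom_act[OF globe_FF T g p(1)] y(2)[OF globe_dense[OF inacc] g] by simp
    qed
    then show "f \<in> germ_hom T ` fob P T" using p(1) by blast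
  qed
qed (use germ_hom[OF T] in blast)

theorem ex_representing:
  "\<exists>C\<in>Ob omega_Cat. \<exists>\<phi>. is_iso_arrow (colimit_to_limit_functors TYPE('u) omega_Cat slf)
    (hom_into omega_Cat C) P \<phi>"
proof -
  have small: "small TYPE('u) (Hom omega_Cat a b)"
    if "a \<in> Ob omega_Cat" "b \<in> Ob omega_Cat" for a b :: "'u omega_cat"
    using small_omega_hom[OF inacc, of a b] that by simp
  have "\<exists>\<phi>. is_iso_arrow (functor_cat (op_cat (full_subcat omega_Cat slf)) (set_cat TYPE('u)))
      (hom_into omega_Cat germ_cat) P \<phi>" (is "Ex ?iso")
  proof (rule iso_in_functor_cat_set[OF P])
    show "is_functor (op_cat (full_subcat omega_Cat slf)) (set_cat TYPE('u)) (hom_into omega_Cat germ_cat)"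
      by (rule is_functor_hom_into[OF is_category_omega_Cat small germ_cat_Ob])
    show "bij_betw (germ_hom T) (fob P T) (fob (hom_into omega_Cat germ_cat) T)"
      if "T \<in> Ob (op_cat (full_subcat omega_Cat slf))" for T
      using bij_germ_hom that by (simp add: hom_into_def)
    show "germ_hom b (far P a b f x) = far (hom_into omega_Cat germ_cat) a b f (germ_hom a x)"
      if "a \<in> Ob (op_cat (full_subcat omega_Cat slf))" "b \<in> Ob (op_cat (full_subcat omega_Cat slf))"
        "f \<in> Hom (op_cat (full_subcat omega_Cat slf)) a b" "x \<in> fob P a" for a b f x
      using that germ_hom_act[of b a f x] germ_hom[of a x] by (simp add: hom_into_def)
  qed
  then obtain \<phi> where \<phi>: "?iso \<phi>" ..
  \<comment> \<open>Restricting the objects leaves hom-sets alone, so the inverse found in the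
    functor category is still an arrow.\<close>
  have "is_iso_arrow (full_subcat D X) a b f = is_iso_arrow D a b f" for D :: "('o, 'm) category" and X a b f
    by (simp add: is_iso_arrow_def)
  then have "is_iso_arrow (colimit_to_limit_functors TYPE('u) omega_Cat slf) (hom_into omega_Cat germ_cat) P \<phi>"
    unfolding colimit_to_limit_functors_def using \<phi> by (rule iffD2)
  then show ?thesis by (intro bexI[OF exI germ_cat_Ob])
qed

end

section \<open>Full faithfulness and the equivalence\<close>

lemma restricted_yoneda_faithful:
  assumes inacc: "inaccessible TYPE('u)" and C: "is_omega_category (C :: 'u omega_cat)"
    and f: "f \<in> omega_hom C D" and g: "g \<in> omega_hom C D"
    and eq: "far (restricted_yoneda omega_Cat slf) C D f = far (restricted_yoneda omega_Cat slf) C D g"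
  shows "f = g"
proof (rule density_unique[OF inacc C f g])
  fix n h assume h: "h \<in> omega_hom (globe n) C"
  have "(globe n :: 'u omega_cat) \<in> Ob (full_subcat omega_Cat slf)"
    using presented_in_omega_Cat[OF inacc] slf_globe[OF inacc] by simp
  then have "(\<lambda>h\<in>Hom omega_Cat (globe n) C. Cmp omega_Cat (globe n) C D f h) =
      (\<lambda>h\<in>Hom omega_Cat (globe n) C. Cmp omega_Cat (globe n) C D g h)"
    using fun_cong[OF eq, of "globe n"] by (simp add: restricted_yoneda_def)
  from fun_cong[OF this, of h] h
  show "compose (carrier (globe n)) f h = compose (carrier (globe n)) g h" by simp
qed

text \<open>The components of a natural transformation at the dense shapes are a family of the kind
  that \<open>density\<close> integrates to a morphism \<open>h\<close>; the other components have
  to follow from these.\<close>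

lemma restricted_yoneda_full:
  assumes inacc: "inaccessible TYPE('u)"
    and C: "(C :: 'u omega_cat) \<in> Ob omega_Cat" and D: "D \<in> Ob omega_Cat"
    and \<eta>: "\<eta> \<in> extensional (Ob (full_subcat omega_Cat slf))"
      "is_nat_trans (op_cat (full_subcat omega_Cat slf)) (set_cat TYPE('u))
        (hom_into omega_Cat C) (hom_into omega_Cat D) \<eta>"
  shows "\<exists>h\<in>omega_hom C D. far (restricted_yoneda omega_Cat slf) C D h = \<eta>"
proof -
  let ?F = "Ob (full_subcat (omega_Cat :: ('u omega_cat, 'u \<Rightarrow> 'u) category) slf)"
  have Cc: "is_omega_category C" and Dc: "is_omega_category D" using C D by auto
  have PE: "\<eta> T \<in> omega_hom T C \<rightarrow>\<^sub>E omega_hom T D" if "T \<in> ?F" for T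
    using \<eta>(2) that by (simp add: is_nat_trans_def hom_into_def)
  have nat: "\<eta> S (compose (carrier S) f g) = compose (carrier S) (\<eta> T f) g"
    if S: "S \<in> ?F" and T: "T \<in> ?F" and g: "g \<in> omega_hom S T" and f: "f \<in> omega_hom T C" for S T f g
  proof -
    have "compose (omega_hom T C) (\<eta> S) (far (hom_into omega_Cat C) T S g) =
        compose (omega_hom T C) (far (hom_into omega_Cat D) T S g) (\<eta> T)"
      using \<eta>(2) S T g by (simp add: is_nat_trans_def hom_into_def)
    from fun_cong[OF this, of f] show ?thesis
      using f PiE_mem[OF PE[OF T] f] by (simp add: compose_eq hom_into_def)
  qed
  have dense: "T \<in> ?F" if "T \<in> dense_shapes" for T :: "'u omega_cat"
    using dense_shapes_Ob[OF inacc that] dense_shapes_slf[OF inacc that] by simp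
  have "\<exists>h\<in>omega_hom C D. \<forall>T\<in>dense_shapes. \<forall>f\<in>omega_hom T C. \<eta> T f = compose (carrier T) h f"
    by (rule density[OF inacc Cc Dc]) (use PE nat dense in blast)+
  then obtain h where h: "h \<in> omega_hom C D"
    "\<And>T f. T \<in> dense_shapes \<Longrightarrow> f \<in> omega_hom T C \<Longrightarrow> \<eta> T f = compose (carrier T) h f" by blast
  \<comment> \<open>For a general \<open>T\<close> both sides are morphisms out of \<open>T\<close>,
    hence determined by composition with maps from globes. There naturality reduces the equation to
    the dense shapes.\<close>
  have all: "\<eta> T f = compose (carrier T) h f" if T: "T \<in> ?F" and f: "f \<in> omega_hom T C" for T f
  proof (rule density_unique[OF inacc])
    show Tc: "is_omega_category T" using T by simp
    show "\<eta> T f \<in> omega_hom T D" using PiE_mem[OF PE[OF T] f] .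
    show "compose (carrier T) h f \<in> omega_hom T D" by (rule omega_hom_compose[OF f h(1) Tc])
    fix n g assume g: "g \<in> omega_hom (globe n) T"
    have G: "is_omega_category (globe n :: 'u omega_cat)" by (rule is_omega_category_presented[OF inacc])
    note gd = globe_dense[OF inacc]
    show "compose (carrier (globe n)) (\<eta> T f) g = compose (carrier (globe n)) (compose (carrier T) h f) g"
      using nat[OF dense[OF gd] T g f] h(2)[OF gd omega_hom_compose[OF g f G]]
        compose_assoc_hom[OF inacc g, of h f] by simp
  qed
  have "far (restricted_yoneda omega_Cat slf) C D h = \<eta>"
  proof
    fix T show "far (restricted_yoneda omega_Cat slf) C D h T = \<eta> T"
    proof (cases "T \<in> ?F")
      case True
      have "(\<lambda>f\<in>omega_hom T C. compose (carrier T) h f) = \<eta> T"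
        using PE[OF True] all[OF True] by (auto simp: fun_eq_iff PiE_def extensional_def)
      then show ?thesis using True by (simp add: restricted_yoneda_def)
    next
      case False
      then show ?thesis using extensional_arb[OF \<eta>(1) False] by (auto simp: restricted_yoneda_def)
    qed
  qed
  then show ?thesis using h(1) by blast
qed

theorem theorem7p4:
  assumes "inaccessible TYPE('u)"
  shows "is_equivalence
           (omega_Cat :: ('u omega_cat, 'u \<Rightarrow> 'u) category)
           (colimit_to_limit_functors TYPE('u) omega_Cat {C. has_slf_atomic_basis C})
           (restricted_yoneda omega_Cat {C. has_slf_atomic_basis C})"
proof (rule equivalence_if_fully_faithful_ess_surj)
  have small: "small TYPE('u) (Hom omega_Cat a b)"
    if "a \<in> Ob omega_Cat" "b \<in> Ob omega_Cat" for a b :: "'u omega_cat"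
    using small_omega_hom[OF assms, of a b] that by simp
  show "is_functor omega_Cat (colimit_to_limit_functors TYPE('u) omega_Cat slf)
      (restricted_yoneda omega_Cat (slf :: 'u omega_cat set))"
    by (rule is_functor_restricted_yoneda[OF is_category_omega_Cat small])
  show "f = g"
    if "C \<in> Ob omega_Cat" "f \<in> Hom omega_Cat C D" "g \<in> Hom omega_Cat C D"
      "far (restricted_yoneda omega_Cat slf) C D f = far (restricted_yoneda omega_Cat slf) C D g"
    for C D :: "'u omega_cat" and f g
    using restricted_yoneda_faithful[OF assms _ _ _ that(4)] that(1-3) by simp
  show "\<exists>f\<in>Hom omega_Cat C D. far (restricted_yoneda omega_Cat slf) C D f = \<eta>"
    if "C \<in> Ob omega_Cat" "D \<in> Ob omega_Cat"
      "\<eta> \<in> Hom (colimit_to_limit_functors TYPE('u) omega_Cat slf)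
        (fob (restricted_yoneda omega_Cat slf) C) (fob (restricted_yoneda omega_Cat slf) D)"
    for C D :: "'u omega_cat" and \<eta>
    using restricted_yoneda_full[OF assms that(1,2), of \<eta>] that(3)
    by (simp add: colimit_to_limit_functors_def restricted_yoneda_def)
  show "\<exists>C\<in>Ob omega_Cat. \<exists>\<phi>. is_iso_arrow (colimit_to_limit_functors TYPE('u) omega_Cat slf)
      (fob (restricted_yoneda omega_Cat slf) C) P \<phi>"
    if P: "P \<in> Ob (colimit_to_limit_functors TYPE('u) (omega_Cat :: ('u omega_cat, 'u \<Rightarrow> 'u) category) slf)" for P
  proof -
    interpret colimit_to_limit_functor P
      using P assms by unfold_locales (simp_all add: colimit_to_limit_functors_def)
    show ?thesis using ex_representing by (simp add: restricted_yoneda_def)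
  qed
qed

end
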